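(* Let $\mathbb{B}\subset \mathrm{SD}$ be Borel (i.e. a Borel subset of $\mathrm{SB}$ contained in $\mathrm{SD}$). There exists a Borel map $\mathbb{B}\to \mathrm{SB}$, $X\mapsto X^\bullet$, such that $X^\bullet\equiv X^*$ for all $X\in \mathbb{B}$. Moreover, let $$\mathbb{A}=\{(X,x,g)\in \mathbb{B}\times C(\Delta)\times C(\Delta)\mid x\in X,\ g\in X^\bullet\}.$$ Then there exists a Borel map $\langle\cdot,\cdot\rangle_{(\cdot)}:\mathbb{A}\to \mathbb{R}$, $(X,x,g)\mapsto \langle g,x\rangle_X$, such that, for each $X\in \mathbb{B}$, (i) $\langle \cdot,\cdot\rangle_X$ is bilinear and norm continuous, and (ii) $g\in X^\bullet\mapsto \langle g,\cdot\rangle_X\in X^*$ is a surjective linear isometry.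
   Context: $\Delta=2^{\mathbb{N}}$ is the Cantor set and $C(\Delta)$ is the Banach space of (real-valued) continuous functions on $\Delta$ with the supremum norm. $\mathrm{SB}=\{X\subset C(\Delta)\mid X\text{ is a closed linear subspace}\}$, endowed with the Effros-Borel structure, i.e. the $\sigma$-algebra generated by the sets $\{X\in \mathrm{SB}\mid X\cap U\neq\emptyset\}$, $U\subset C(\Delta)$ open; this is a standard Borel space. $\mathrm{SD}=\{X\in \mathrm{SB}\mid X^*\text{ is separable}\}$. $X\equiv Y$ means that the Banach spaces $X$ and $Y$ are linearly isometric. *)

theory Defs
  imports "HOL-Analysis.Analysis"
begin

type_synonym cantor = "nat \<Rightarrow> bool"

text \<open>\<open>cantor\<close> carries the product topology of the discrete type \<open>bool\<close>. It is compact, so every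
  continuous real function on it is bounded and \<open>C_cantor\<close> is the full space of continuous
  functions with the supremum norm.\<close>

type_synonym C_cantor = "cantor \<Rightarrow>\<^sub>C real"

definition SB :: "C_cantor set set" where
  "SB = {X. closed X \<and> subspace X}"

definition effros_borel :: "C_cantor set measure" where
  "effros_borel = sigma SB {{X \<in> SB. X \<inter> U \<noteq> {}} | U. open U}"

definition linear_functional_on :: "'a::real_vector set \<Rightarrow> ('a \<Rightarrow> real) \<Rightarrow> bool" where
  "linear_functional_on X f \<longleftrightarrow>
     (\<forall>x\<in>X. \<forall>y\<in>X. f (x + y) = f x + f y) \<and> (\<forall>c. \<forall>x\<in>X. f (c *\<^sub>R x) = c * f x)"

definition bilinear_form_on ::
    "'a::real_vector set \<Rightarrow> 'b::real_vector set \<Rightarrow> ('a \<Rightarrow> 'b \<Rightarrow> real) \<Rightarrow> bool" where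
  "bilinear_form_on X Y b \<longleftrightarrow>
     (\<forall>x\<in>X. linear_functional_on Y (\<lambda>y. b x y)) \<and> (\<forall>y\<in>Y. linear_functional_on X (\<lambda>x. b x y))"

text \<open>The dual of a subspace \<open>X\<close>. Its elements are extensional, so that a functional on \<open>X\<close> is
  represented by exactly one function on the ambient type.\<close>

definition dual_space :: "'a::real_normed_vector set \<Rightarrow> ('a \<Rightarrow> real) set" where
  "dual_space X = {f \<in> extensional X. linear_functional_on X f \<and>
                     (\<exists>K. \<forall>x\<in>X. \<bar>f x\<bar> \<le> K * norm x)}"

definition dual_norm :: "'a::real_normed_vector set \<Rightarrow> ('a \<Rightarrow> real) \<Rightarrow> real" where
  "dual_norm X f = (SUP x\<in>{x \<in> X. norm x \<le> 1}. \<bar>f x\<bar>)"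

text \<open>\<open>dual_norm X\<close> only looks at values on \<open>X\<close>, so the pointwise difference need not be restricted.
  The locale \<open>Metric_space\<close> requires the distance to be nonnegative on the whole type, whereas the
  supremum of an unbounded set is unspecified; hence the default value 0 off the dual.\<close>

definition dual_dist :: "'a::real_normed_vector set \<Rightarrow> ('a \<Rightarrow> real) \<Rightarrow> ('a \<Rightarrow> real) \<Rightarrow> real" where
  "dual_dist X f g =
     (if f \<in> dual_space X \<and> g \<in> dual_space X then dual_norm X (\<lambda>x. f x - g x) else 0)"

lemma dual_space_diff_bounded:
  assumes "f \<in> dual_space X" "g \<in> dual_space X"
  shows "\<exists>K. \<forall>x\<in>X. \<bar>f x - g x\<bar> \<le> K * norm x"
proof -
  obtain K L where K: "\<And>x. x \<in> X \<Longrightarrow> \<bar>f x\<bar> \<le> K * norm x" and L: "\<And>x. x \<in> X \<Longrightarrow> \<bar>g x\<bar> \<le> L * norm x"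
    using assms unfolding dual_space_def by blast
  have "\<bar>f x - g x\<bar> \<le> (K + L) * norm x" if "x \<in> X" for x
    using K[OF that] L[OF that] by (simp add: distrib_right)
  then show ?thesis by blast
qed

lemma dual_norm_bdd_above:
  assumes "\<exists>K. \<forall>x\<in>X. \<bar>f x\<bar> \<le> K * norm x"
  shows "bdd_above ((\<lambda>x. \<bar>f x\<bar>) ` {x \<in> X. norm x \<le> 1})"
proof -
  obtain K where K: "\<And>x. x \<in> X \<Longrightarrow> \<bar>f x\<bar> \<le> K * norm x"
    using assms by blast
  have "\<bar>f x\<bar> \<le> \<bar>K\<bar>" if "x \<in> X" "norm x \<le> 1" for x
  proof -
    have "K * norm x \<le> \<bar>K\<bar> * norm x"
      by (simp add: mult_right_mono)
    also have "\<dots> \<le> \<bar>K\<bar> * 1"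
      using that by (intro mult_left_mono) auto
    finally show ?thesis using K[OF that(1)] by simp
  qed
  then show ?thesis by (auto intro!: bdd_aboveI[of _ "\<bar>K\<bar>"])
qed

lemma dual_norm_upper:
  assumes "\<exists>K. \<forall>x\<in>X. \<bar>f x\<bar> \<le> K * norm x" "x \<in> X" "norm x \<le> 1"
  shows "\<bar>f x\<bar> \<le> dual_norm X f"
  unfolding dual_norm_def using assms by (intro cSUP_upper dual_norm_bdd_above) auto

lemma Metric_space_dual:
  fixes X :: "'a::real_normed_vector set"
  assumes X: "subspace X"
  shows "Metric_space (dual_space X) (dual_dist X)"
proof
  have zero: "0 \<in> X"
    using X by (rule subspace_0)
  fix f g h :: "'a \<Rightarrow> real"
  show "0 \<le> dual_dist X f g"
    using dual_norm_upper[OF dual_space_diff_bounded zero, of f g]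
    by (auto simp: dual_dist_def intro: order_trans[OF abs_ge_zero])
  show "dual_dist X f g = dual_dist X g f"
    by (simp add: dual_dist_def dual_norm_def abs_minus_commute)
  assume f: "f \<in> dual_space X" and g: "g \<in> dual_space X"
  show "dual_dist X f g = 0 \<longleftrightarrow> f = g"
  proof
    assume *: "dual_dist X f g = 0"
    have "f x = g x" if x: "x \<in> X" for x
    proof (cases "x = 0")
      case True
      have "\<bar>f 0 - g 0\<bar> \<le> 0"
        using dual_space_diff_bounded[OF f g] zero by fastforce
      then show ?thesis using True by simp
    next
      case False
      define y where "y = (1 / norm x) *\<^sub>R x"
      have y: "y \<in> X" "norm y \<le> 1"
        using X x False by (auto simp: y_def subspace_scale)
      have "\<bar>f y - g y\<bar> \<le> 0"
        using dual_norm_upper[OF dual_space_diff_bounded[OF f g] y] * f g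
        by (simp add: dual_dist_def)
      moreover have "f y - g y = (1 / norm x) * (f x - g x)"
        using f g x by (auto simp: y_def dual_space_def linear_functional_on_def algebra_simps)
      ultimately show ?thesis using False by (simp add: divide_le_0_iff)
    qed
    then show "f = g"
      using f g by (auto simp: dual_space_def intro: extensionalityI)
  next
    assume "f = g"
    moreover have "(SUP x\<in>{x \<in> X. norm x \<le> 1}. 0::real) = 0"
      using zero by (intro cSUP_const) auto
    ultimately show "dual_dist X f g = 0"
      using f g by (simp add: dual_dist_def dual_norm_def)
  qed
  assume h: "h \<in> dual_space X"
  have "\<bar>f x - h x\<bar> \<le> dual_dist X f g + dual_dist X g h" if "x \<in> X" "norm x \<le> 1" for x
    using dual_norm_upper[OF dual_space_diff_bounded[OF f g] that]
      dual_norm_upper[OF dual_space_diff_bounded[OF g h] that] f g h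
    by (simp add: dual_dist_def)
  then have "dual_norm X (\<lambda>x. f x - h x) \<le> dual_dist X f g + dual_dist X g h"
    unfolding dual_norm_def using zero by (intro cSUP_least) auto
  then show "dual_dist X f h \<le> dual_dist X f g + dual_dist X g h"
    using f h by (simp add: dual_dist_def)
qed

definition SD :: "C_cantor set set" where
  "SD = {X \<in> SB. separable_space (Metric_space.mtopology (dual_space X) (dual_dist X))}"

text \<open>\<open>T\<close> is a surjective linear isometry from the subspace \<open>Y\<close> onto the dual of the subspace \<open>X\<close>.
  The vector space operations of the dual are pointwise on \<open>X\<close>, so linearity of \<open>T\<close> is linearity
  of \<open>g \<mapsto> T g x\<close> for every \<open>x\<close> in \<open>X\<close>.\<close>

definition linear_isometry_onto_dual ::
    "'b::real_normed_vector set \<Rightarrow> 'a::real_normed_vector set \<Rightarrow> ('b \<Rightarrow> 'a \<Rightarrow> real) \<Rightarrow> bool" where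
  "linear_isometry_onto_dual Y X T \<longleftrightarrow>
     T ` Y = dual_space X \<and>
     (\<forall>x\<in>X. linear_functional_on Y (\<lambda>g. T g x)) \<and>
     (\<forall>g\<in>Y. dual_norm X (T g) = norm g)"

definition isometric_to_dual ::
    "'b::real_normed_vector set \<Rightarrow> 'a::real_normed_vector set \<Rightarrow> bool" where
  "isometric_to_dual Y X \<longleftrightarrow> (\<exists>T. linear_isometry_onto_dual Y X T)"

end

theory Submission
  imports Defs "HOL-Library.Sublist"
begin

text \<open>Parametrise the weak* compact unit ball of the dual of \<open>C(\<Delta>)\<close> by the Cantor set. By the
  Hahn-Banach theorem, every functional of norm at most 1 on \<open>X\<close> is the restriction of some point
  of this ball, so one has to choose, in a Borel way, a sequence of points which is dense for the
  norm of \<open>X\<^sup>*\<close>. For fixed \<open>\<epsilon>\<close>, the Szlenk derivative removes from a closed set all relatively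
  open pieces of norm diameter at most \<open>\<epsilon>\<close>, and from every removed piece one point can be chosen in
  a Borel way; it must be shown that countably many steps suffice for all members of \<open>B\<close>
  simultaneously. Since \<open>B\<close> is analytic, consider finite approximations to a point of \<open>B\<close> together
  with a Cantor scheme of \<open>\<epsilon>\<close>-separated functionals. If all extensions of such an approximation
  can be killed by Borel families of derived sets, then so can the approximation itself, by
  intersecting countably many families and deriving once more. Hence, if the empty approximation
  could not be killed, there would be an infinite chain of approximations, whose limit is a member
  of \<open>B\<close> with an \<open>\<epsilon>\<close>-separated Cantor set in its dual.

  Given a Borel dense sequence \<open>f n\<close> of functionals, the closure of the set of all sequences
  \<open>n \<mapsto> f n x\<close>, where \<open>x\<close> ranges over the unit ball of \<open>X\<close>, is a continuous image of the
  Cantor set in a Borel way, and evaluation at the points of this compact set embeds the dual of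
  \<open>X\<close> isometrically into \<open>C(\<Delta>)\<close>.\<close>

section \<open>Trees of binary strings\<close>

text \<open>Two obstacles shape the proof: derivatives quantify over points of the Cantor set, and
  the number of derivation steps depends on \<open>X\<close>. Compactness removes the first. Closed
  sets are coded by trees, and by Koenig's lemma a cylinder meets a closed set iff a condition on
  countably many strings holds, which is Borel in \<open>X\<close>. All members share one compact
  set, the dual ball of the ambient space; only the relation \<open>far\<close>, distance in the
  dual of \<open>X\<close>, varies. It is open and is witnessed by \<open>X\<close> meeting a small
  ball, which is what the Effros-Borel structure can test. The second is met without ordinals:
  \<open>covered\<close> records only that everything removed so far is approximated by countably
  many Borel choices, a property that survives countable intersections and derivation. Linear
  structure is carried by three-term inequalities: the range of a dense sequence is not closed under
  linear combinations, but an inequality between \<open>\<alpha> * b n + \<beta> * b m - b k\<close>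
  and the norm of the matching vectors passes to closures and yields linearity and continuity
  there.\<close>

definition initial :: "(nat \<Rightarrow> bool) \<Rightarrow> nat \<Rightarrow> bool list" where
  "initial t n = map t [0..<n]"

definition cylinder :: "bool list \<Rightarrow> (nat \<Rightarrow> bool) set" where
  "cylinder s = {t. initial t (length s) = s}"

text \<open>Padding with \<open>False\<close> gives one point in each cylinder, hence a countable
  dense set at which norms and codes can be tested.\<close>

definition pad :: "bool list \<Rightarrow> nat \<Rightarrow> bool" where
  "pad s i \<longleftrightarrow> i < length s \<and> s ! i"

definition branches :: "bool list set \<Rightarrow> (nat \<Rightarrow> bool) set" where
  "branches R = {t. \<forall>n. initial t n \<in> R}"

primrec greedy_initial :: "bool list set \<Rightarrow> (nat \<Rightarrow> bool) \<Rightarrow> nat \<Rightarrow> bool list" where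
  "greedy_initial S t 0 = []"
| "greedy_initial S t (Suc n) = greedy_initial S t n @
     [if greedy_initial S t n @ [t n] \<in> S then t n else \<not> t n]"

text \<open>If \<open>S\<close> is a pruned tree, this is a continuous retraction of the Cantor set onto the
  set of branches of \<open>S\<close>.\<close>

definition greedy :: "bool list set \<Rightarrow> (nat \<Rightarrow> bool) \<Rightarrow> nat \<Rightarrow> bool" where
  "greedy S t n = last (greedy_initial S t (Suc n))"

lemma length_initial [simp]: "length (initial t n) = n"
  by (simp add: initial_def)

lemma initial_0 [simp]: "initial t 0 = []"
  by (simp add: initial_def)

lemma initial_Suc: "initial t (Suc n) = initial t n @ [t n]"
  by (simp add: initial_def)

lemma initial_eq_iff: "initial t n = initial u n \<longleftrightarrow> (\<forall>i<n. t i = u i)"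
  by (auto simp: initial_def)

lemma take_initial: "m \<le> n \<Longrightarrow> take m (initial t n) = initial t m"
  by (simp add: initial_def take_map)

lemma prefix_initial: "m \<le> n \<Longrightarrow> prefix (initial t m) (initial t n)"
  by (metis take_initial take_is_prefix)

lemma prefix_initialD: "prefix v (initial t n) \<Longrightarrow> v = initial t (length v)"
  by (metis length_initial prefix_length_le take_initial prefix_def append_eq_conv_conj)

lemma initial_pad [simp]: "initial (pad s) (length s) = s"
  by (auto simp: initial_def pad_def intro: nth_equalityI)

lemma pad_in_cylinder [simp]: "pad s \<in> cylinder s"
  by (simp add: cylinder_def)

lemma in_cylinder_initial [simp]: "t \<in> cylinder (initial t n)"
  by (simp add: cylinder_def)

lemma cylinder_Nil [simp]: "cylinder [] = UNIV"
  by (simp add: cylinder_def)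

lemma cylinderD: "t \<in> cylinder s \<Longrightarrow> initial t (length s) = s"
  by (simp add: cylinder_def)

lemma cylinder_iff_prefix: "t \<in> cylinder s \<longleftrightarrow> (\<exists>n. prefix s (initial t n))"
proof
  assume "t \<in> cylinder s"
  then have "prefix s (initial t (length s))" by (simp add: cylinder_def)
  then show "\<exists>n. prefix s (initial t n)" by blast
qed (auto simp: cylinder_def dest: prefix_initialD)

lemma cylinder_mono: "prefix s u \<Longrightarrow> cylinder u \<subseteq> cylinder s"
  unfolding cylinder_iff_prefix subset_iff by (blast intro: prefix_order.trans)

lemma cylinder_initial_iff: "u \<in> cylinder (initial t n) \<longleftrightarrow> (\<forall>i<n. u i = t i)"
  by (simp add: cylinder_def initial_eq_iff)

lemma in_cylinder_prefix_initial: "t \<in> cylinder s \<Longrightarrow> length s \<le> n \<Longrightarrow> prefix s (initial t n)"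
  by (metis cylinderD prefix_initial)

lemma initial_greedy: "initial (greedy S t) n = greedy_initial S t n"
  by (induction n) (auto simp: initial_Suc greedy_def)

lemma greedy_Suc:
  "initial (greedy S t) (Suc n) =
     initial (greedy S t) n @ [if initial (greedy S t) n @ [t n] \<in> S then t n else \<not> t n]"
  by (simp only: initial_greedy greedy_initial.simps)

lemma greedy_in_branches:
  assumes "[] \<in> S" and "\<And>w. w \<in> S \<Longrightarrow> w @ [True] \<in> S \<or> w @ [False] \<in> S"
  shows "greedy S t \<in> branches S"
proof -
  have "initial (greedy S t) n \<in> S" for n
  proof (induction n)
    case (Suc n)
    then show ?case using assms(2)[OF Suc] by (cases "t n") (auto simp: greedy_Suc)
  qed (simp add: assms)
  then show ?thesis by (simp add: branches_def)
qed

lemma greedy_initial_eq: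
  assumes "\<And>m. m \<le> n \<Longrightarrow> initial t m \<in> S"
  shows "initial (greedy S t) n = initial t n"
  using assms
proof (induction n)
  case (Suc n)
  then have "initial (greedy S t) n = initial t n" by simp
  moreover have "initial t n @ [t n] \<in> S"
    using Suc.prems[of "Suc n"] by (simp add: initial_Suc)
  ultimately show ?case by (simp add: greedy_Suc initial_Suc[of t])
qed simp

lemma greedy_id:
  assumes "t \<in> branches S"
  shows "greedy S t = t"
proof
  fix n
  have "initial (greedy S t) (Suc n) = initial t (Suc n)"
    using assms by (intro greedy_initial_eq) (auto simp: branches_def)
  then show "greedy S t n = t n" by (simp add: initial_eq_iff)
qed

text \<open>Each digit of \<open>greedy S t\<close> depends only on the digits of \<open>t\<close>
  up to the same place; this is the continuity of the retraction.\<close>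

lemma greedy_cong:
  assumes "initial t n = initial u n"
  shows "initial (greedy S t) n = initial (greedy S u) n"
  using assms
proof (induction n)
  case (Suc n)
  then have "initial t n = initial u n" "t n = u n" by (auto simp: initial_eq_iff)
  then show ?case using Suc.IH by (simp add: greedy_Suc)
qed simp

text \<open>Koenig's lemma. It trades a quantifier over branches for quantifiers over the countable
  set of strings, so that meeting a closed set becomes a Borel condition on its tree. As
  \<open>R\<close> may fail to be closed under prefixes, all prefixes of \<open>u\<close> are asked
  for.\<close>

lemma cylinder_meets_branches_iff:
  "cylinder s \<inter> branches R \<noteq> {} \<longleftrightarrow>
     (\<forall>m. \<exists>u. length u = length s + m \<and> prefix s u \<and> (\<forall>v. prefix v u \<longrightarrow> v \<in> R))"
  (is "?L \<longleftrightarrow> ?P s")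
proof
  assume ?L
  then obtain t where t: "t \<in> cylinder s" "t \<in> branches R" by auto
  show "?P s"
  proof
    fix m
    have "prefix s (initial t (length s + m))"
      using t(1) by (simp add: in_cylinder_prefix_initial)
    moreover have "v \<in> R" if "prefix v (initial t (length s + m))" for v
      using prefix_initialD[OF that] t(2) unfolding branches_def by simp metis
    ultimately show "\<exists>u. length u = length s + m \<and> prefix s u \<and> (\<forall>v. prefix v u \<longrightarrow> v \<in> R)"
      by (intro exI[of _ "initial t (length s + m)"]) auto
  qed
next
  assume s: "?P s"
  \<comment> \<open>The strings that extend inside the tree to every length. This part is closed
    under prefixes and pruned, so \<open>greedy\<close> finds a branch in it.\<close>
  define P where "P = {s. ?P s}"
  have sub: "w \<in> R" if "w \<in> P" for w
    using that[unfolded P_def mem_Collect_eq] by blast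
  have shorten: "\<exists>u. length u = length v + m \<and> prefix v u \<and> (\<forall>v. prefix v u \<longrightarrow> v \<in> R)"
    if "length u \<ge> length v + m" "prefix v u" "\<forall>v. prefix v u \<longrightarrow> v \<in> R" for u v m
  proof (intro exI[of _ "take (length v + m) u"] conjI allI impI)
    show "length (take (length v + m) u) = length v + m" using that(1) by simp
    show "prefix v (take (length v + m) u)"
      using that(2) by (auto simp: prefix_def)
    show "w \<in> R" if "prefix w (take (length v + m) u)" for w
      using that \<open>\<forall>v. prefix v u \<longrightarrow> v \<in> R\<close> by (meson prefix_order.trans take_is_prefix)
  qed
  have down: "v \<in> P" if "w \<in> P" "prefix v w" for v w
  proof -
    have "\<exists>u. length u = length v + m \<and> prefix v u \<and> (\<forall>v. prefix v u \<longrightarrow> v \<in> R)" for m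
    proof -
      obtain u where "length u = length w + m" "prefix w u" "\<forall>v. prefix v u \<longrightarrow> v \<in> R"
        using \<open>w \<in> P\<close> unfolding P_def by blast
      then show ?thesis
        using \<open>prefix v w\<close> by (intro shorten[of v m u]) (auto dest: prefix_length_le intro: prefix_order.trans)
    qed
    then show ?thesis by (simp add: P_def)
  qed
  have pruned: "w @ [True] \<in> P \<or> w @ [False] \<in> P" if w: "w \<in> P" for w
  proof (rule ccontr)
    assume "\<not> ?thesis"
    then have "w @ [b] \<notin> P" for b by (cases b) auto
    then have "\<exists>m. \<not> (\<exists>u. length u = length (w @ [b]) + m \<and> prefix (w @ [b]) u \<and> (\<forall>v. prefix v u \<longrightarrow> v \<in> R))" for b
      unfolding P_def by blast
    then obtain m where m: "\<And>b. \<not> (\<exists>u. length u = length (w @ [b]) + m b \<and> prefix (w @ [b]) u \<and> (\<forall>v. prefix v u \<longrightarrow> v \<in> R))"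
      by metis
    \<comment> \<open>Long enough for either child of \<open>w\<close>; cut back to the right
      length, it contradicts the failure recorded in \<open>m\<close> for the child it passes
      through.\<close>
    obtain u where u: "length u = length w + Suc (max (m True) (m False))" "prefix w u" "\<forall>v. prefix v u \<longrightarrow> v \<in> R"
      using w unfolding P_def by blast
    define b where "b = u ! length w"
    have "prefix (w @ [b]) u"
      using u(1,2) by (simp add: b_def append_one_prefix)
    moreover have "length u \<ge> length (w @ [b]) + m b"
      using u(1) by (cases b) auto
    ultimately show False
      using shorten[of "w @ [b]" "m b" u] u(3) m[of b] by blast
  qed
  have sP: "s \<in> P" using s by (simp add: P_def)
  have "greedy P (pad s) \<in> branches P"
    using pruned down[OF sP, of "[]"] by (intro greedy_in_branches) auto
  \<comment> \<open>Guided by \<open>pad s\<close>, the retraction does not leave \<open>s\<close>,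
    all of whose prefixes lie in \<open>P\<close>.\<close>
  moreover have "initial (greedy P (pad s)) (length s) = initial (pad s) (length s)"
    using down[OF sP] prefix_initial[of _ "length s" "pad s"]
    by (intro greedy_initial_eq) simp
  ultimately have "greedy P (pad s) \<in> cylinder s \<inter> branches R"
    using sub by (auto simp: cylinder_def branches_def)
  then show ?L by blast
qed

section \<open>Topology of the Cantor set in terms of cylinders\<close>

lemma cylinder_iff_nth: "t \<in> cylinder s \<longleftrightarrow> (\<forall>i<length s. t i = s ! i)"
proof
  assume "t \<in> cylinder s"
  then have "s ! i = initial t (length s) ! i" for i by (simp add: cylinder_def)
  then show "\<forall>i<length s. t i = s ! i" by (simp add: initial_def)
next
  assume "\<forall>i<length s. t i = s ! i"
  then have "initial t (length s) = s" by (intro nth_equalityI) (simp_all add: initial_def)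
  then show "t \<in> cylinder s" by (simp add: cylinder_def)
qed

lemma open_cylinder [simp]: "open (cylinder s)"
proof -
  have "open {t :: nat \<Rightarrow> bool. \<forall>i\<in>{..<length s}. t (id i) \<in> {s ! i}}"
    by (rule product_topology_basis') (auto intro: open_discrete)
  moreover have "{t :: nat \<Rightarrow> bool. \<forall>i\<in>{..<length s}. t (id i) \<in> {s ! i}} = cylinder s"
    by (auto simp: cylinder_iff_nth)
  ultimately show ?thesis by simp
qed

lemma open_cantor_iff:
  fixes U :: "(nat \<Rightarrow> bool) set"
  shows "open U \<longleftrightarrow> (\<forall>t\<in>U. \<exists>n. cylinder (initial t n) \<subseteq> U)"
proof
  assume U: "open U"
  show "\<forall>t\<in>U. \<exists>n. cylinder (initial t n) \<subseteq> U"
  proof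
    fix t assume "t \<in> U"
    then obtain X where X: "t \<in> Pi\<^sub>E UNIV X" "finite {i. X i \<noteq> UNIV}" "Pi\<^sub>E UNIV X \<subseteq> U"
      using product_topology_open_contains_basis[of "\<lambda>i. euclidean" UNIV U t] U[unfolded open_fun_def]
      by auto
    then obtain n where n: "{i. X i \<noteq> UNIV} \<subseteq> {..<n}"
      using finite_nat_iff_bounded by blast
    have "cylinder (initial t n) \<subseteq> Pi\<^sub>E UNIV X"
    proof
      fix u assume u: "u \<in> cylinder (initial t n)"
      have "u i \<in> X i" for i
      proof (cases "i < n")
        case True
        then show ?thesis using u X(1) by (auto simp: cylinder_initial_iff PiE_iff)
      next
        case False
        then have "X i = UNIV" using n by auto
        then show ?thesis by simp
      qed
      then show "u \<in> Pi\<^sub>E UNIV X" by (simp add: PiE_iff)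
    qed
    then show "\<exists>n. cylinder (initial t n) \<subseteq> U" using X(3) by blast
  qed
next
  assume *: "\<forall>t\<in>U. \<exists>n. cylinder (initial t n) \<subseteq> U"
  then have "\<forall>t\<in>U. \<exists>T. open T \<and> t \<in> T \<and> T \<subseteq> U"
    using in_cylinder_initial open_cylinder by meson
  then show "open U" by (rule open_subopen[THEN iffD2])
qed

lemma continuous_on_cantor_iff:
  fixes g :: "(nat \<Rightarrow> bool) \<Rightarrow> 'b::metric_space"
  shows "continuous_on UNIV g \<longleftrightarrow>
     (\<forall>t \<delta>. 0 < \<delta> \<longrightarrow> (\<exists>n. \<forall>u\<in>cylinder (initial t n). dist (g u) (g t) < \<delta>))"
proof
  assume g: "continuous_on UNIV g"
  show "\<forall>t \<delta>. 0 < \<delta> \<longrightarrow> (\<exists>n. \<forall>u\<in>cylinder (initial t n). dist (g u) (g t) < \<delta>)"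
  proof (intro allI impI)
    fix t :: "nat \<Rightarrow> bool" and \<delta> :: real assume \<delta>: "0 < \<delta>"
    have "open (g -` ball (g t) \<delta>)"
      using g by (intro open_vimage) auto
    moreover have "t \<in> g -` ball (g t) \<delta>" using \<delta> by simp
    ultimately obtain n where "cylinder (initial t n) \<subseteq> g -` ball (g t) \<delta>"
      unfolding open_cantor_iff by blast
    then show "\<exists>n. \<forall>u\<in>cylinder (initial t n). dist (g u) (g t) < \<delta>"
      by (intro exI[of _ n]) (auto simp: dist_commute)
  qed
next
  assume *: "\<forall>t \<delta>. 0 < \<delta> \<longrightarrow> (\<exists>n. \<forall>u\<in>cylinder (initial t n). dist (g u) (g t) < \<delta>)"
  have "open (g -` V)" if V: "open V" for V
    unfolding open_cantor_iff
  proof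
    fix t assume "t \<in> g -` V"
    then obtain \<delta> where \<delta>: "\<delta> > 0" "\<And>y. dist y (g t) < \<delta> \<Longrightarrow> y \<in> V"
      using V by (auto simp: open_dist)
    then show "\<exists>n. cylinder (initial t n) \<subseteq> g -` V"
      using *[rule_format, of \<delta> t] by (metis subsetI vimageI)
  qed
  then show "continuous_on UNIV g"
    by (simp add: continuous_on_open_vimage)
qed

text \<open>The strings on whose cylinders \<open>g\<close> oscillates by at least \<open>\<delta>\<close> form a tree without
  branches, which is finite by Koenig's lemma above.\<close>

lemma continuous_on_cantor_uniform:
  fixes g :: "(nat \<Rightarrow> bool) \<Rightarrow> 'b::metric_space"
  assumes g: "continuous_on UNIV g" and \<delta>: "0 < \<delta>"
  shows "\<exists>n. \<forall>t. \<forall>u\<in>cylinder (initial t n). dist (g u) (g t) < \<delta>"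
proof (rule ccontr)
  assume contr: "\<not> ?thesis"
  define R where "R = {s. \<exists>t\<in>cylinder s. \<exists>u\<in>cylinder s. dist (g u) (g t) \<ge> \<delta>}"
  have "\<exists>u. length u = length [] + m \<and> prefix [] u \<and> (\<forall>v. prefix v u \<longrightarrow> v \<in> R)" for m
  proof -
    obtain t u where "u \<in> cylinder (initial t m)" "\<not> dist (g u) (g t) < \<delta>"
      using contr by blast
    then have "v \<in> R" if "prefix v (initial t m)" for v
      using cylinder_mono[OF that] in_cylinder_initial[of t m] unfolding R_def
      by (smt (verit) mem_Collect_eq subsetD)
    then show ?thesis by (intro exI[of _ "initial t m"]) auto
  qed
  then have "cylinder [] \<inter> branches R \<noteq> {}"
    unfolding cylinder_meets_branches_iff by blast
  then obtain t where t: "\<And>n. initial t n \<in> R" by (auto simp: branches_def)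
  obtain n where n: "\<And>u. u \<in> cylinder (initial t n) \<Longrightarrow> dist (g u) (g t) < \<delta> / 2"
    using g \<delta> unfolding continuous_on_cantor_iff by (meson half_gt_zero)
  obtain u v where "u \<in> cylinder (initial t n)" "v \<in> cylinder (initial t n)" "dist (g u) (g v) \<ge> \<delta>"
    using t[of n] unfolding R_def by blast
  then show False
    using n[of u] n[of v] dist_triangle2[of "g u" "g v" "g t"] by simp
qed

section \<open>Continuous images of the Cantor set\<close>

text \<open>The dense functions take rational values and depend on finitely many digits: in a pair
  \<open>(n, l)\<close> the list \<open>l\<close> holds the value on each string of length
  \<open>n\<close> at the position given by the code of that string.\<close>

lemma C_cantor_separable: "\<exists>e :: nat \<Rightarrow> C_cantor. closure (range e) = UNIV"
proof -
  define st :: "nat \<times> rat list \<Rightarrow> cantor \<Rightarrow> real" where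
    "st = (\<lambda>(n, l) t. real_of_rat (nth_default 0 l (to_nat (initial t n))))"
  have cont: "continuous_on UNIV (st p)" for p
  proof -
    have "dist (st p u) (st p t) < \<delta>" if "u \<in> cylinder (initial t (fst p))" "0 < \<delta>" for t u \<delta>
      using that by (cases p) (simp add: st_def cylinder_def)
    then show ?thesis unfolding continuous_on_cantor_iff by blast
  qed
  have bdd: "norm (st p t) \<le> Max (insert 0 ((\<lambda>q. \<bar>real_of_rat q\<bar>) ` set (snd p)))" for p t
  proof -
    have "\<bar>real_of_rat (nth_default 0 l k)\<bar> \<in> insert 0 ((\<lambda>q. \<bar>real_of_rat q\<bar>) ` set l)" for l k
      by (auto simp: nth_default_def)
    then show ?thesis
      by (intro Max_ge) (auto simp: st_def split: prod.split)
  qed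
  define e :: "nat \<Rightarrow> C_cantor" where "e = (\<lambda>j. Bcontfun (st (from_nat j)))"
  have e: "apply_bcontfun (e j) = st (from_nat j)" for j
    unfolding e_def by (rule Bcontfun_inverse) (rule bcontfun_normI[OF cont bdd])
  have "\<exists>j. dist (e j) f < \<delta>" if \<delta>: "0 < \<delta>" for f :: C_cantor and \<delta>
  proof -
    obtain n where n: "\<And>t u. u \<in> cylinder (initial t n) \<Longrightarrow> dist (f u) (f t) < \<delta> / 4"
      using continuous_on_cantor_uniform[of f "\<delta> / 4"] \<delta> by auto
    have "\<exists>q. \<bar>real_of_rat q - f (pad w)\<bar> < \<delta> / 4" for w
    proof -
      have "f (pad w) - \<delta> / 4 < f (pad w) + \<delta> / 4" using \<delta> by simp
      then obtain q where "f (pad w) - \<delta> / 4 < real_of_rat q" "real_of_rat q < f (pad w) + \<delta> / 4"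
        using of_rat_dense by blast
      then show ?thesis by (intro exI[of _ q]) linarith
    qed
    then obtain q where q: "\<And>w. \<bar>real_of_rat (q w) - f (pad w)\<bar> < \<delta> / 4" by metis
    have fin: "finite {w :: bool list. length w = n}"
      using finite_lists_length_eq[of "UNIV :: bool set" n] by simp
    \<comment> \<open>\<open>N\<close> exceeds the codes of all strings of length \<open>n\<close>,
      so the list \<open>l\<close> below has an entry for each of them.\<close>
    define N where "N = Suc (Max (to_nat ` {w :: bool list. length w = n}))"
    have N: "to_nat (initial t n) < N" for t
      unfolding N_def using fin by (intro le_imp_less_Suc Max_ge) auto
    define l where "l = map (\<lambda>k. q (from_nat k)) [0..<N]"
    have "dist (e (to_nat (n, l)) t) (f t) \<le> \<delta> / 2" for t
    proof -
      have "e (to_nat (n, l)) t = real_of_rat (q (initial t n))"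
        using N[of t] by (simp add: e st_def l_def nth_default_def)
      moreover have "pad (initial t n) \<in> cylinder (initial t n)" by simp
      ultimately show ?thesis
        using q[of "initial t n"] n[of "pad (initial t n)" t] unfolding dist_real_def by linarith
    qed
    then have "dist (e (to_nat (n, l))) f \<le> \<delta> / 2" by (rule dist_bound)
    then show ?thesis using \<delta> by (intro exI[of _ "to_nat (n, l)"]) simp
  qed
  then have "closure (range e) = UNIV"
    by (auto simp: closure_approachable)
  then show ?thesis by blast
qed

section \<open>Binary expansions and codes for bounded real sequences\<close>

definition digit_sum :: "(nat \<Rightarrow> bool) \<Rightarrow> real" where
  "digit_sum t = (\<Sum>k. if t k then (1/2) ^ Suc k else 0)"

lemma summable_digits: "summable (\<lambda>k. if t k then (1/2::real) ^ Suc k else 0)"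
  by (rule summable_comparison_test'[of "\<lambda>k. (1/2) ^ Suc k" 0])
     (auto intro: summable_mult2 summable_geometric simp: summable_Suc_iff)

lemma digit_sum_nonneg: "0 \<le> digit_sum t"
  unfolding digit_sum_def by (intro suminf_nonneg summable_digits) auto

lemma digit_sum_le_1: "digit_sum t \<le> 1"
proof -
  have "digit_sum t \<le> (\<Sum>k. (1/2::real) ^ Suc k)"
    unfolding digit_sum_def
    by (intro suminf_le summable_digits) (auto simp: summable_Suc_iff summable_geometric)
  also have "\<dots> = 1" using power_half_series sums_unique by fastforce
  finally show ?thesis .
qed

lemma digit_sum_split:
  "digit_sum t = (\<Sum>k<n. if t k then (1/2) ^ Suc k else 0) + (1/2) ^ n * digit_sum (\<lambda>k. t (k + n))"
proof -
  have "digit_sum t = (\<Sum>k. if t (k + n) then (1/2) ^ Suc (k + n) else 0) + (\<Sum>k<n. if t k then (1/2) ^ Suc k else 0)"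
    unfolding digit_sum_def using suminf_split_initial_segment[OF summable_digits] .
  also have "(\<Sum>k. if t (k + n) then (1/2::real) ^ Suc (k + n) else 0) = (\<Sum>k. (1/2) ^ n * (if t (k + n) then (1/2) ^ Suc k else 0))"
    by (intro suminf_cong) (simp add: power_add)
  also have "\<dots> = (1/2) ^ n * digit_sum (\<lambda>k. t (k + n))"
    unfolding digit_sum_def by (rule suminf_mult) (rule summable_digits)
  finally show ?thesis by simp
qed

lemma digit_sum_close:
  assumes "\<And>k. k < n \<Longrightarrow> t k = u k"
  shows "\<bar>digit_sum t - digit_sum u\<bar> \<le> (1/2) ^ n"
proof -
  define p where "p = (\<Sum>k<n. if t k then (1/2::real) ^ Suc k else 0)"
  have p: "p = (\<Sum>k<n. if u k then (1/2) ^ Suc k else 0)"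
    unfolding p_def using assms by (intro sum.cong) auto
  have "digit_sum t = p + (1/2) ^ n * digit_sum (\<lambda>k. t (k + n))"
    unfolding p_def by (rule digit_sum_split)
  moreover have "digit_sum u = p + (1/2) ^ n * digit_sum (\<lambda>k. u (k + n))"
    unfolding p by (rule digit_sum_split)
  ultimately have "digit_sum t - digit_sum u = (1/2) ^ n * (digit_sum (\<lambda>k. t (k + n)) - digit_sum (\<lambda>k. u (k + n)))"
    unfolding right_diff_distrib by (metis add_diff_cancel_left)
  moreover have "\<bar>digit_sum (\<lambda>k. t (k + n)) - digit_sum (\<lambda>k. u (k + n))\<bar> \<le> 1"
    using digit_sum_nonneg[of "\<lambda>k. t (k + n)"] digit_sum_le_1[of "\<lambda>k. t (k + n)"]
      digit_sum_nonneg[of "\<lambda>k. u (k + n)"] digit_sum_le_1[of "\<lambda>k. u (k + n)"] by linarith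
  ultimately show ?thesis by (simp add: abs_mult mult_left_le)
qed

lemma digit_sum_surj:
  assumes "0 \<le> y" "y < 1"
  shows "\<exists>t. digit_sum t = y"
proof -
  \<comment> \<open>The parity of the floor is the binary digit in place \<open>k + 1\<close>. As
    \<open>0 \<le> y < 1\<close>, there is no integer part, and the partial sums are the truncations
    of \<open>y\<close>.\<close>
  define t where "t k = odd \<lfloor>2 ^ Suc k * y\<rfloor>" for k :: nat
  have step: "\<lfloor>2 ^ Suc n * y\<rfloor> = 2 * \<lfloor>2 ^ n * y\<rfloor> + of_bool (t n)" for n
  proof -
    have "\<lfloor>2 * z\<rfloor> = 2 * \<lfloor>z\<rfloor> \<or> \<lfloor>2 * z\<rfloor> = 2 * \<lfloor>z\<rfloor> + 1" for z :: real
      by linarith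
    from this[of "2 ^ n * y"] have "\<lfloor>2 ^ Suc n * y\<rfloor> = 2 * \<lfloor>2 ^ n * y\<rfloor> \<or> \<lfloor>2 ^ Suc n * y\<rfloor> = 2 * \<lfloor>2 ^ n * y\<rfloor> + 1"
      by (simp add: mult.assoc)
    then show ?thesis by (auto simp: t_def)
  qed
  have part: "(\<Sum>k<n. if t k then (1/2::real) ^ Suc k else 0) = of_int \<lfloor>2 ^ n * y\<rfloor> / 2 ^ n" for n
  proof (induction n)
    case 0
    have "\<lfloor>y\<rfloor> = 0" using assms by (simp add: floor_eq_iff)
    then show ?case by simp
  next
    case (Suc n)
    have "real_of_int \<lfloor>2 ^ Suc n * y\<rfloor> = 2 * of_int \<lfloor>2 ^ n * y\<rfloor> + (if t n then 1 else 0)"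
      by (simp add: step del: power_Suc)
    then show ?case using Suc by (simp add: field_simps power_divide)
  qed
  have "\<bar>digit_sum t - y\<bar> \<le> 2 * (1/2) ^ n" for n
  proof -
    have "\<bar>of_int \<lfloor>2 ^ n * y\<rfloor> / 2 ^ n - y\<bar> \<le> (1/2) ^ n"
    proof -
      have "\<bar>of_int \<lfloor>2 ^ n * y\<rfloor> - 2 ^ n * y\<bar> \<le> 1" by linarith
      moreover have "of_int \<lfloor>2 ^ n * y\<rfloor> / 2 ^ n - y = (of_int \<lfloor>2 ^ n * y\<rfloor> - 2 ^ n * y) / 2 ^ n"
        by (simp add: diff_divide_distrib)
      ultimately show ?thesis by (simp add: abs_divide power_one_over divide_right_mono)
    qed
    moreover have "0 \<le> (1/2) ^ n * digit_sum (\<lambda>k. t (k + n))" "(1/2) ^ n * digit_sum (\<lambda>k. t (k + n)) \<le> (1/2) ^ n"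
      using digit_sum_nonneg digit_sum_le_1 by (auto simp: mult_left_le)
    ultimately show ?thesis
      unfolding digit_sum_split[of t n] part by linarith
  qed
  moreover have "(\<lambda>n. 2 * (1/2::real) ^ n) \<longlonglongrightarrow> 2 * 0"
    by (intro tendsto_intros LIMSEQ_power_zero) simp
  ultimately have "\<bar>digit_sum t - y\<bar> \<le> 2 * 0"
    using LIMSEQ_le_const by blast
  then show ?thesis by auto
qed

text \<open>The Cantor set is split into countably many copies of itself; the factor 4 keeps the bounds
  \<open>m i\<close> away from the end points, where binary expansions are not available.\<close>

definition decode :: "(nat \<Rightarrow> real) \<Rightarrow> nat \<Rightarrow> (nat \<Rightarrow> bool) \<Rightarrow> real" where
  "decode m i t = m i * (4 * digit_sum (\<lambda>k. t (prod_encode (i, k))) - 2)"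

lemma decode_bound: "\<bar>decode m i t\<bar> \<le> 2 * \<bar>m i\<bar>"
proof -
  have "\<bar>4 * digit_sum (\<lambda>k. t (prod_encode (i, k))) - 2\<bar> \<le> 2"
    using digit_sum_nonneg[of "\<lambda>k. t (prod_encode (i, k))"] digit_sum_le_1[of "\<lambda>k. t (prod_encode (i, k))"] by linarith
  then show ?thesis
    unfolding decode_def abs_mult by (metis abs_ge_zero mult.commute mult_right_mono)
qed

lemma continuous_on_decode: "continuous_on UNIV (decode m i)"
proof -
  have "continuous_on UNIV digit_sum"
    unfolding continuous_on_cantor_iff
  proof (intro allI impI)
    fix t :: "nat \<Rightarrow> bool" and \<delta> :: real assume "0 < \<delta>"
    then obtain n where "(1/2) ^ n < \<delta>" using real_arch_pow_inv[of \<delta> "1/2"] by auto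
    moreover have "dist (digit_sum u) (digit_sum t) \<le> (1/2) ^ n" if "u \<in> cylinder (initial t n)" for u
      using that digit_sum_close[of n u t] by (simp add: cylinder_initial_iff dist_real_def)
    ultimately show "\<exists>n. \<forall>u\<in>cylinder (initial t n). dist (digit_sum u) (digit_sum t) < \<delta>"
      by (meson le_less_trans)
  qed
  moreover have "continuous_on UNIV (\<lambda>(t :: nat \<Rightarrow> bool) k. t (prod_encode (i, k)))"
    by (intro continuous_on_coordinatewise_then_product continuous_on_product_coordinates)
  ultimately have "continuous_on UNIV (\<lambda>t. digit_sum (\<lambda>k. t (prod_encode (i, k))))"
    by (rule continuous_on_compose2) simp
  then have "continuous_on UNIV (\<lambda>t. m i * (4 * digit_sum (\<lambda>k. t (prod_encode (i, k))) - 2))"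
    by (intro continuous_on_mult_left continuous_on_diff continuous_on_const)
  then show ?thesis
    by (simp add: decode_def[abs_def])
qed

lemma decode_surj:
  assumes "\<And>i. \<bar>a i\<bar> \<le> m i"
  shows "\<exists>t. \<forall>i. decode m i t = a i"
proof -
  have "\<exists>t. m i * (4 * digit_sum t - 2) = a i" for i
  proof (cases "m i = 0")
    case True
    then show ?thesis using assms[of i] by simp
  next
    case False
    then have m: "m i > 0" using assms[of i] by linarith
    define x where "x = a i / m i"
    have "\<bar>x\<bar> \<le> 1" using assms[of i] m by (simp add: x_def abs_divide)
    \<comment> \<open>The interval from -1 to 1 goes to the one from 1/4 to 3/4, away from the
      excluded value 1.\<close>
    then have "0 \<le> (x + 2) / 4 \<and> (x + 2) / 4 < 1" by auto
    then obtain t where "digit_sum t = (x + 2) / 4"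
      using digit_sum_surj by blast
    then show ?thesis using m by (intro exI[of _ t]) (simp add: x_def field_simps)
  qed
  then obtain T where T: "\<And>i. m i * (4 * digit_sum (T i) - 2) = a i" by metis
  define t where "t j = (case prod_decode j of (i, k) \<Rightarrow> T i k)" for j
  have "decode m i t = a i" for i
    using T[of i] by (simp add: decode_def t_def)
  then show ?thesis by blast
qed

text \<open>The branches of this tree are the codes of the points in the closure of \<open>A\<close>. Only the
  countably many codes \<open>pad u\<close> occur, so that membership is a Borel condition when \<open>A\<close> varies.\<close>

definition code_tree :: "(nat \<Rightarrow> real) \<Rightarrow> (nat \<Rightarrow> real) set \<Rightarrow> bool list set" where
  "code_tree m A = {s. \<forall>k. \<exists>u. prefix s u \<and> (\<exists>a\<in>A. \<forall>i<k. \<bar>a i - decode m i (pad u)\<bar> < 1 / real (Suc k))}"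

text \<open>For nonempty \<open>A\<close> with entries bounded by \<open>m\<close>, the range
  contains \<open>A\<close> and lies in its closure for the product topology: \<open>greedy\<close>
  moves \<open>t\<close> to a code of a point of the closure and \<open>decode\<close> evaluates
  this code.\<close>

definition parametrization :: "(nat \<Rightarrow> real) \<Rightarrow> (nat \<Rightarrow> real) set \<Rightarrow> (nat \<Rightarrow> bool) \<Rightarrow> nat \<Rightarrow> real" where
  "parametrization m A t i = decode m i (greedy (code_tree m A) t)"

lemma parametrization_bound: "\<bar>parametrization m A t i\<bar> \<le> 2 * \<bar>m i\<bar>"
  by (simp add: parametrization_def decode_bound)

lemma continuous_on_parametrization: "continuous_on UNIV (\<lambda>t. parametrization m A t i)"
  unfolding continuous_on_cantor_iff
proof (intro allI impI)
  fix t :: "nat \<Rightarrow> bool" and \<delta> :: real assume "0 < \<delta>"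
  then obtain n where n: "\<And>u. u \<in> cylinder (initial (greedy (code_tree m A) t) n) \<Longrightarrow>
      dist (decode m i u) (decode m i (greedy (code_tree m A) t)) < \<delta>"
    using continuous_on_decode[of m i] unfolding continuous_on_cantor_iff by meson
  then show "\<exists>n. \<forall>u\<in>cylinder (initial t n). dist (parametrization m A u i) (parametrization m A t i) < \<delta>"
    unfolding parametrization_def
    by (intro exI[of _ n] ballI n) (auto simp: cylinder_def intro: greedy_cong)
qed

lemma decode_uniform:
  assumes "0 < \<delta>"
  shows "\<exists>n. \<forall>u\<in>cylinder (initial t n). \<forall>i<k. \<bar>decode m i u - decode m i t\<bar> < \<delta>"
proof (induction k)
  case (Suc k)
  then obtain n where n: "\<forall>u\<in>cylinder (initial t n). \<forall>i<k. \<bar>decode m i u - decode m i t\<bar> < \<delta>" by blast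
  obtain n' where n': "\<forall>u\<in>cylinder (initial t n'). \<bar>decode m k u - decode m k t\<bar> < \<delta>"
    using continuous_on_decode[of m k] assms unfolding continuous_on_cantor_iff dist_real_def by meson
  have "cylinder (initial t (max n n')) \<subseteq> cylinder (initial t n) \<inter> cylinder (initial t n')"
    by (auto simp: cylinder_initial_iff)
  then show ?case using n n' by (intro exI[of _ "max n n'"]) (auto simp: less_Suc_eq)
qed auto

text \<open>Any code \<open>t\<close> of \<open>a\<close> is a branch of the code tree, because the
  padded initial segments of \<open>t\<close> decode to approximations of \<open>a\<close>; hence
  \<open>greedy\<close> fixes \<open>t\<close>.\<close>

lemma parametrization_surj:
  assumes "a \<in> A" and "\<And>i. \<bar>a i\<bar> \<le> m i"
  shows "\<exists>t. parametrization m A t = a"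
proof -
  obtain t where t: "\<And>i. decode m i t = a i" using decode_surj[of a m] assms(2) by blast
  have "initial t n \<in> code_tree m A" for n
    unfolding code_tree_def
  proof (intro CollectI allI)
    fix k
    obtain n' where n': "\<And>u i. u \<in> cylinder (initial t n') \<Longrightarrow> i < k \<Longrightarrow> \<bar>decode m i u - decode m i t\<bar> < 1 / real (Suc k)"
      using decode_uniform[of "1 / real (Suc k)" t k m] by auto
    define u where "u = initial t (max n n')"
    have "prefix (initial t n) u" "prefix (initial t n') u" by (simp_all add: u_def prefix_initial)
    then have "pad u \<in> cylinder (initial t n')" using cylinder_mono pad_in_cylinder by blast
    then have "\<bar>a i - decode m i (pad u)\<bar> < 1 / real (Suc k)" if "i < k" for i
      using n'[of "pad u" i] that t[of i] by (simp add: abs_minus_commute)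
    then show "\<exists>u. prefix (initial t n) u \<and> (\<exists>a\<in>A. \<forall>i<k. \<bar>a i - decode m i (pad u)\<bar> < 1 / real (Suc k))"
      using \<open>prefix (initial t n) u\<close> assms(1) by blast
  qed
  then have "greedy (code_tree m A) t = t" by (intro greedy_id) (simp add: branches_def)
  then show ?thesis using t by (intro exI[of _ t]) (auto simp: parametrization_def)
qed

lemma parametrization_approx:
  assumes a0: "a0 \<in> A" "\<And>i. \<bar>a0 i\<bar> \<le> m i" and \<delta>: "0 < \<delta>"
  shows "\<exists>a\<in>A. \<forall>i<k. \<bar>a i - parametrization m A t i\<bar> < \<delta>"
proof -
  define S where "S = code_tree m A"
  let ?Q = "\<lambda>k s. \<exists>u. prefix s u \<and> (\<exists>a\<in>A. \<forall>i<k. \<bar>a i - decode m i (pad u)\<bar> < 1 / real (Suc k))"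
  have mono: "?Q k s" if "?Q k' s" "k \<le> k'" for k k' s
  proof -
    have "1 / real (Suc k') \<le> 1 / real (Suc k)" using that(2) by (simp add: frac_le)
    then show ?thesis using that by (meson less_le_trans)
  qed
  have S_iff: "s \<in> S \<longleftrightarrow> (\<forall>k. ?Q k s)" for s by (simp add: S_def code_tree_def)
  have nil: "[] \<in> S"
  proof -
    obtain t where t: "\<And>i. decode m i t = a0 i" using decode_surj[of a0 m] a0(2) by blast
    have "?Q k []" for k
    proof -
      obtain n where n: "\<forall>u\<in>cylinder (initial t n). \<forall>i<k. \<bar>decode m i u - decode m i t\<bar> < 1 / real (Suc k)"
        using decode_uniform[of "1 / real (Suc k)" t k m] by auto
      have "\<forall>i<k. \<bar>a0 i - decode m i (pad (initial t n))\<bar> < 1 / real (Suc k)"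
        using n[rule_format, of "pad (initial t n)"] t by (simp add: abs_minus_commute)
      then show ?thesis using a0(1) by (intro exI[of _ "initial t n"] conjI bexI[of _ a0]) simp_all
    qed
    then show ?thesis by (simp add: S_iff)
  qed
  have pruned: "w @ [True] \<in> S \<or> w @ [False] \<in> S" if w: "w \<in> S" for w
  proof (rule ccontr)
    assume "\<not> ?thesis"
    then have "w @ [b] \<notin> S" for b by (cases b) auto
    then have "\<exists>k. \<not> ?Q k (w @ [b])" for b unfolding S_iff by blast
    then obtain K where K: "\<And>b. \<not> ?Q (K b) (w @ [b])" by metis
    \<comment> \<open>\<open>?Q\<close> grows stronger with \<open>k\<close>, so both children of
      \<open>w\<close> fail at this common level.\<close>
    define k where "k = max (K True) (K False)"
    have k: "K b \<le> k" for b by (cases b) (auto simp: k_def)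
    obtain u a where u: "prefix w u" "a \<in> A" "\<forall>i<k. \<bar>a i - decode m i (pad u)\<bar> < 1 / real (Suc k)"
      using w unfolding S_iff by blast
    \<comment> \<open>If \<open>u\<close> is \<open>w\<close> itself, appending \<open>False\<close>
      does not change the padded point, so a proper extension of \<open>w\<close> is available in
      any case.\<close>
    have "\<exists>b u'. prefix (w @ [b]) u' \<and> pad u' = pad u"
    proof (cases "u = w")
      case True
      have "pad (w @ [False]) = pad w" by (auto simp: fun_eq_iff pad_def nth_append less_Suc_eq)
      then show ?thesis using True by blast
    next
      case False
      then obtain b ws where "u = w @ b # ws" using u(1) by (cases "drop (length w) u") (auto simp: prefix_def)
      then have "prefix (w @ [b]) u" by simp
      then show ?thesis by blast
    qed
    then obtain b u' where "prefix (w @ [b]) u'" "pad u' = pad u" by blast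
    then have "?Q k (w @ [b])" using u(2,3) by (intro exI[of _ u'] conjI bexI[of _ a]) simp_all
    then show False using mono[OF _ k] K by blast
  qed
  define \<tau> where "\<tau> = greedy S t"
  have \<tau>: "\<tau> \<in> branches S" unfolding \<tau>_def by (rule greedy_in_branches[OF nil pruned])
  obtain n where n: "\<forall>u\<in>cylinder (initial \<tau> n). \<forall>i<k. \<bar>decode m i u - decode m i \<tau>\<bar> < \<delta> / 2"
    using decode_uniform[of "\<delta> / 2" \<tau> k m] \<delta> by auto
  obtain K where K: "1 / real (Suc K) < \<delta> / 2" using \<delta> nat_approx_posE half_gt_zero by metis
  have small: "1 / real (Suc (max k K)) \<le> 1 / real (Suc K)" by (simp add: frac_le)
  have "initial \<tau> n \<in> S" using \<tau> by (simp add: branches_def)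
  then obtain u a where u: "prefix (initial \<tau> n) u" "a \<in> A"
    "\<And>i. i < max k K \<Longrightarrow> \<bar>a i - decode m i (pad u)\<bar> < 1 / real (Suc (max k K))"
    unfolding S_iff by blast
  have "pad u \<in> cylinder (initial \<tau> n)" using cylinder_mono[OF u(1)] pad_in_cylinder by blast
  then have "\<bar>a i - decode m i \<tau>\<bar> < \<delta>" if "i < k" for i
  proof -
    have "\<bar>decode m i (pad u) - decode m i \<tau>\<bar> < \<delta> / 2" using n that \<open>pad u \<in> _\<close> by blast
    moreover have "\<bar>a i - decode m i (pad u)\<bar> < 1 / real (Suc (max k K))" using that by (intro u(3)) simp
    ultimately show ?thesis using small K by linarith
  qed
  then show ?thesis using u(2) by (auto simp: parametrization_def \<tau>_def S_def)
qed

section \<open>Extension of functionals\<close>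

definition approx_index :: "(nat \<Rightarrow> 'a::real_normed_vector) \<Rightarrow> 'a \<Rightarrow> nat \<Rightarrow> nat" where
  "approx_index a g k = (LEAST n. norm (g - a n) \<le> (1/2) ^ k)"

text \<open>The continuous extension of the map \<open>a n \<mapsto> b n\<close>. It is meaningful only for \<open>g\<close> in the
  closure of the sequence \<open>a\<close>; the least indices make it a Borel function of all its arguments.\<close>

definition extend :: "(nat \<Rightarrow> 'a::real_normed_vector) \<Rightarrow> (nat \<Rightarrow> real) \<Rightarrow> 'a \<Rightarrow> real" where
  "extend a b g = lim (\<lambda>k. b (approx_index a g k))"

lemma approx_index:
  assumes "g \<in> closure (range a)"
  shows "norm (g - a (approx_index a g k)) \<le> (1/2) ^ k"
proof -
  obtain n where "dist (a n) g < (1/2) ^ k"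
    using assms unfolding closure_approachable by (metis rangeE zero_less_power half_gt_zero zero_less_one)
  then have "norm (g - a n) \<le> (1/2) ^ k" by (simp add: dist_norm norm_minus_commute)
  then show ?thesis unfolding approx_index_def by (rule LeastI)
qed

lemma tendsto_approx_index:
  assumes "g \<in> closure (range a)"
  shows "(\<lambda>k. a (approx_index a g k)) \<longlonglongrightarrow> g"
proof (rule metric_LIMSEQ_I)
  fix r :: real assume "0 < r"
  then obtain K where K: "(1/2) ^ K < r" using real_arch_pow_inv[of r "1/2"] by auto
  have "dist (a (approx_index a g k)) g < r" if "k \<ge> K" for k
  proof -
    have "dist (a (approx_index a g k)) g \<le> (1/2) ^ k"
      using approx_index[OF assms, of k] by (simp add: dist_norm norm_minus_commute)
    also have "\<dots> \<le> (1/2) ^ K" using that by (intro power_decreasing) auto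
    finally show ?thesis using K by simp
  qed
  then show "\<exists>K. \<forall>k\<ge>K. dist (a (approx_index a g k)) g < r" by blast
qed

text \<open>The three-term inequality says at once that \<open>b\<close> is Lipschitz along \<open>a\<close> and that it respects
  those linear relations which are approximately realised in the range of \<open>a\<close>.\<close>

context
  fixes a :: "nat \<Rightarrow> 'a::real_normed_vector" and b :: "nat \<Rightarrow> real" and L :: real
  assumes L: "0 \<le> L"
    and ineq: "\<And>\<alpha> \<beta> n m k. \<bar>\<alpha> * b n + \<beta> * b m - b k\<bar> \<le> L * norm (\<alpha> *\<^sub>R a n + \<beta> *\<^sub>R a m - a k)"
begin

lemma tendsto_extend:
  assumes g: "g \<in> closure (range a)"
  shows "(\<lambda>k. b (approx_index a g k)) \<longlonglongrightarrow> extend a b g"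
proof -
  have "Cauchy (\<lambda>k. b (approx_index a g k))"
  proof (rule metric_CauchyI)
    fix r :: real assume r: "0 < r"
    have "Cauchy (\<lambda>k. a (approx_index a g k))"
      using tendsto_approx_index[OF g] by (rule LIMSEQ_imp_Cauchy)
    moreover have "0 < r / (L + 1)" using r L by simp
    ultimately obtain K where K: "\<And>i j. i \<ge> K \<Longrightarrow> j \<ge> K \<Longrightarrow>
        dist (a (approx_index a g i)) (a (approx_index a g j)) < r / (L + 1)"
      unfolding Cauchy_def by blast
    have "dist (b (approx_index a g i)) (b (approx_index a g j)) < r" if "i \<ge> K" "j \<ge> K" for i j
    proof -
      let ?d = "dist (a (approx_index a g i)) (a (approx_index a g j))"
      have "dist (b (approx_index a g i)) (b (approx_index a g j)) \<le> L * ?d"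
        using ineq[of 1 "approx_index a g i" 0 0 "approx_index a g j"] by (simp add: dist_norm)
      also have "\<dots> \<le> (L + 1) * ?d" by (simp add: mult_right_mono)
      also have "\<dots> < (L + 1) * (r / (L + 1))"
        using K[OF that] L by (intro mult_strict_left_mono) auto
      also have "\<dots> = r" using L by simp
      finally show ?thesis .
    qed
    then show "\<exists>K. \<forall>i\<ge>K. \<forall>j\<ge>K. dist (b (approx_index a g i)) (b (approx_index a g j)) < r" by blast
  qed
  then show ?thesis
    unfolding extend_def by (simp add: Cauchy_convergent_iff convergent_LIMSEQ_iff)
qed

lemma extend_ineq:
  assumes "g \<in> closure (range a)" "g' \<in> closure (range a)" "g'' \<in> closure (range a)"
  shows "\<bar>\<alpha> * extend a b g + \<beta> * extend a b g' - extend a b g''\<bar> \<le> L * norm (\<alpha> *\<^sub>R g + \<beta> *\<^sub>R g' - g'')"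
proof (rule LIMSEQ_le)
  show "(\<lambda>k. \<bar>\<alpha> * b (approx_index a g k) + \<beta> * b (approx_index a g' k) - b (approx_index a g'' k)\<bar>)
      \<longlonglongrightarrow> \<bar>\<alpha> * extend a b g + \<beta> * extend a b g' - extend a b g''\<bar>"
    by (intro tendsto_intros tendsto_extend assms)
  show "\<exists>N. \<forall>k\<ge>N. \<bar>\<alpha> * b (approx_index a g k) + \<beta> * b (approx_index a g' k) - b (approx_index a g'' k)\<bar>
      \<le> L * norm (\<alpha> *\<^sub>R a (approx_index a g k) + \<beta> *\<^sub>R a (approx_index a g' k) - a (approx_index a g'' k))"
    by (intro exI allI impI ineq)
  show "(\<lambda>k. L * norm (\<alpha> *\<^sub>R a (approx_index a g k) + \<beta> *\<^sub>R a (approx_index a g' k) - a (approx_index a g'' k)))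
      \<longlonglongrightarrow> L * norm (\<alpha> *\<^sub>R g + \<beta> *\<^sub>R g' - g'')"
    by (intro tendsto_intros tendsto_approx_index assms)
qed

text \<open>The indices chosen for the point \<open>a n\<close> need not be \<open>n\<close>; the
  values still converge to \<open>b n\<close>, since \<open>b\<close> is Lipschitz along
  \<open>a\<close>.\<close>

lemma extend_base: "extend a b (a n) = b n"
proof -
  have mem: "a n \<in> closure (range a)" by (rule closure_subset[THEN subsetD]) simp
  have "(\<lambda>k. b (approx_index a (a n) k) - b n) \<longlonglongrightarrow> 0"
  proof (rule tendsto_rabs_zero_cancel, rule tendsto_sandwich[of "\<lambda>_. 0"])
    show "\<forall>\<^sub>F k in sequentially. \<bar>b (approx_index a (a n) k) - b n\<bar> \<le> L * norm (a (approx_index a (a n) k) - a n)"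
      using ineq[of 1 _ 0 0] by (intro always_eventually) simp
    show "(\<lambda>k. L * norm (a (approx_index a (a n) k) - a n)) \<longlonglongrightarrow> 0"
      using tendsto_approx_index[OF mem] by (auto intro!: tendsto_eq_intros)
  qed auto
  then have "(\<lambda>k. b (approx_index a (a n) k)) \<longlonglongrightarrow> b n" using Lim_null by blast
  then show ?thesis using tendsto_extend[OF mem] LIMSEQ_unique by blast
qed

end

section \<open>The Hahn-Banach theorem through minimal sublinear functionals\<close>

definition sublinear :: "('a::real_vector \<Rightarrow> real) \<Rightarrow> bool" where
  "sublinear q \<longleftrightarrow> (\<forall>x y. q (x + y) \<le> q x + q y) \<and> (\<forall>c x. 0 < c \<longrightarrow> q (c *\<^sub>R x) \<le> c * q x)"

lemma sublinear_add: "sublinear q \<Longrightarrow> q (x + y) \<le> q x + q y"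
  by (simp add: sublinear_def)

text \<open>The defining inequality for the factor \<open>1 / c\<close> gives the converse one. Thus
  only one direction has to be checked when functionals are built as infima.\<close>

lemma sublinear_scale:
  assumes "sublinear q" "0 < c"
  shows "q (c *\<^sub>R x) = c * q x"
proof (rule antisym)
  show "q (c *\<^sub>R x) \<le> c * q x" using assms by (simp add: sublinear_def)
  have "q ((1 / c) *\<^sub>R (c *\<^sub>R x)) \<le> (1 / c) * q (c *\<^sub>R x)"
    using assms unfolding sublinear_def by (metis zero_less_divide_1_iff)
  then show "c * q x \<le> q (c *\<^sub>R x)" using assms(2) by (simp add: field_simps)
qed

lemma sublinear_0: "sublinear q \<Longrightarrow> q 0 = 0"
  using sublinear_scale[of q 2 0] by simp

lemma sublinear_minus: "sublinear q \<Longrightarrow> - q (- x) \<le> q x"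
  using sublinear_add[of q x "- x"] by (simp add: sublinear_0)

text \<open>For fixed \<open>z\<close>, the infimum over \<open>t \<ge> 0\<close> of
  \<open>q (x + t *\<^sub>R z) - t * q z\<close> is sublinear in \<open>x\<close> and below
  \<open>q\<close>, hence equal to \<open>q\<close> by minimality. The choice \<open>t = 1\<close>
  then gives superadditivity.\<close>

lemma minimal_sublinear_linear:
  assumes q: "sublinear q" and min: "\<And>r. sublinear r \<Longrightarrow> (\<And>x. r x \<le> q x) \<Longrightarrow> r = q"
  shows "linear q"
proof -
  have super: "q x + q z \<le> q (x + z)" for x z
  proof -
    define r where "r x = (INF t\<in>{0..}. q (x + t *\<^sub>R z) - t * q z)" for x
    have below: "- q (- x) \<le> q (x + t *\<^sub>R z) - t * q z" if "t \<ge> 0" for x t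
    proof -
      have "t * q z = q (t *\<^sub>R z)"
        using that q by (cases "t = 0") (simp_all add: sublinear_0 sublinear_scale)
      also have "\<dots> \<le> q (x + t *\<^sub>R z) + q (- x)"
        using sublinear_add[OF q, of "x + t *\<^sub>R z" "- x"] by simp
      finally show ?thesis by simp
    qed
    then have bdd: "bdd_below ((\<lambda>t. q (x + t *\<^sub>R z) - t * q z) ` {0..})" for x
      by (intro bdd_belowI2[of _ "- q (- x)"]) auto
    have le: "r x \<le> q (x + t *\<^sub>R z) - t * q z" if "t \<ge> 0" for x t
      unfolding r_def using that by (intro cINF_lower bdd) auto
    have "sublinear r"
      unfolding sublinear_def
    proof (intro conjI allI impI)
      fix x y
      have "r (x + y) - (q (x + t *\<^sub>R z) - t * q z) \<le> q (y + s *\<^sub>R z) - s * q z" if "t \<ge> 0" "s \<ge> 0" for s t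
        using le[of "t + s" "x + y"] sublinear_add[OF q, of "x + t *\<^sub>R z" "y + s *\<^sub>R z"] that
        by (simp add: algebra_simps)
      then have "r (x + y) - (q (x + t *\<^sub>R z) - t * q z) \<le> r y" if "t \<ge> 0" for t
        unfolding r_def[of y] using that by (intro cINF_greatest) auto
      then have "r (x + y) - r y \<le> q (x + t *\<^sub>R z) - t * q z" if "t \<ge> 0" for t
        using that by (smt (verit))
      then have "r (x + y) - r y \<le> r x"
        unfolding r_def[of x] by (intro cINF_greatest) auto
      then show "r (x + y) \<le> r x + r y" by simp
    next
      fix c :: real and x assume c: "0 < c"
      have "r (c *\<^sub>R x) / c \<le> q (x + t *\<^sub>R z) - t * q z" if "t \<ge> 0" for t
      proof -
        have "r (c *\<^sub>R x) \<le> q (c *\<^sub>R (x + t *\<^sub>R z)) - (c * t) * q z"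
          using le[of "c * t" "c *\<^sub>R x"] that c by (simp add: algebra_simps)
        also have "\<dots> = c * (q (x + t *\<^sub>R z) - t * q z)"
          by (simp only: sublinear_scale[OF q c]) (simp add: algebra_simps)
        finally show ?thesis using c by (simp add: field_simps)
      qed
      then have "r (c *\<^sub>R x) / c \<le> r x"
        unfolding r_def[of x] by (intro cINF_greatest) auto
      then show "r (c *\<^sub>R x) \<le> c * r x" using c by (simp add: field_simps)
    qed
    moreover have "r x \<le> q x" for x using le[of 0 x] by simp
    ultimately have "r = q" by (rule min)
    then show ?thesis using le[of 1 x] by simp
  qed
  have add: "q (x + y) = q x + q y" for x y
    using super sublinear_add[OF q] by (simp add: antisym)
  have neg: "q (- x) = - q x" for x
    using add[of x "- x"] sublinear_0[OF q] by simp
  have "q (c *\<^sub>R x) = c * q x" for c x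
  proof (cases c "0 :: real" rule: linorder_cases)
    case less
    then show ?thesis using sublinear_scale[OF q, of "- c" x] neg[of "c *\<^sub>R x"] by simp
  qed (simp_all add: sublinear_0[OF q] sublinear_scale[OF q])
  then show ?thesis using add by (intro linearI) auto
qed

lemma ex_linear_below_sublinear:
  assumes p: "sublinear p"
  shows "\<exists>F. linear F \<and> (\<forall>x. F x \<le> p x)"
proof -
  define A where "A = {q. sublinear q \<and> (\<forall>x. q x \<le> p x)}"
  \<comment> \<open>The pointwise order is reversed, so that the maximal elements from Zorn's lemma
    are the minimal sublinear functionals.\<close>
  define P where "P = (\<lambda>q q' :: 'a \<Rightarrow> real. \<forall>x. q' x \<le> q x)"
  have "\<exists>m\<in>A. \<forall>a\<in>A. P m a \<longrightarrow> a = m"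
  proof (rule predicate_Zorn)
    show "partial_order_on A (relation_of P A)"
      by (rule partial_order_on_relation_ofI) (auto simp: P_def fun_eq_iff intro: order_trans antisym)
  next
    fix C assume C: "C \<in> Chains (relation_of P A)"
    then have CA: "C \<subseteq> A" and tot: "\<And>q r. q \<in> C \<Longrightarrow> r \<in> C \<Longrightarrow> P q r \<or> P r q"
      by (auto simp: Chains_def relation_of_def)
    show "\<exists>u\<in>A. \<forall>a\<in>C. P a u"
    proof (cases "C = {}")
      case True
      then show ?thesis using p by (intro bexI[of _ p]) (auto simp: A_def)
    next
      case False
      define u where "u x = (INF q\<in>C. q x)" for x
      have bdd: "bdd_below ((\<lambda>q. q x) ` C)" for x
      proof (rule bdd_belowI2)
        fix q assume "q \<in> C"
        then have "sublinear q" "q (- x) \<le> p (- x)" using CA by (auto simp: A_def)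
        then show "- p (- x) \<le> q x" using sublinear_minus[of q x] by linarith
      qed
      have le: "u x \<le> q x" if "q \<in> C" for q x
        unfolding u_def using that by (intro cINF_lower bdd)
      have "sublinear u"
        unfolding sublinear_def
      proof (intro conjI allI impI)
        fix x y
        have *: "u (x + y) \<le> q x + r y" if qr: "q \<in> C" "r \<in> C" for q r
        proof -
          \<comment> \<open>The smaller of two members of a chain serves both arguments.\<close>
          obtain s where s: "s \<in> C" "s x \<le> q x" "s y \<le> r y"
            using tot[OF qr] qr by (auto simp: P_def)
          have "u (x + y) \<le> s x + s y"
            using le[OF s(1), of "x + y"] sublinear_add[of s x y] s(1) CA by (force simp: A_def)
          then show ?thesis using s by linarith
        qed
        have "u (x + y) - q x \<le> u y" if "q \<in> C" for q
          unfolding u_def[of y] using False *[OF that] by (intro cINF_greatest) (auto simp: algebra_simps)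
        then have "u (x + y) - u y \<le> q x" if "q \<in> C" for q
          using that by (smt (verit))
        then have "u (x + y) - u y \<le> u x"
          unfolding u_def[of x] using False by (intro cINF_greatest) auto
        then show "u (x + y) \<le> u x + u y" by simp
      next
        fix c :: real and x assume c: "0 < c"
        have "u (c *\<^sub>R x) / c \<le> q x" if "q \<in> C" for q
          using le[OF that, of "c *\<^sub>R x"] sublinear_scale[of q c x] that CA c
          by (auto simp: A_def field_simps)
        then have "u (c *\<^sub>R x) / c \<le> u x"
          unfolding u_def[of x] using False by (intro cINF_greatest) auto
        then show "u (c *\<^sub>R x) \<le> c * u x" using c by (simp add: field_simps)
      qed
      moreover obtain q where q: "q \<in> C" using False by blast
      have "u x \<le> p x" for x
      proof -
        have "q x \<le> p x" using q CA by (auto simp: A_def)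
        then show ?thesis using le[OF q, of x] by linarith
      qed
      ultimately have "u \<in> A" by (simp add: A_def)
      then show ?thesis using le by (auto simp: P_def)
    qed
  qed
  then obtain q where q: "q \<in> A" "\<And>r. r \<in> A \<Longrightarrow> P q r \<Longrightarrow> r = q" by blast
  have "linear q"
  proof (rule minimal_sublinear_linear)
    show "sublinear q" using q(1) by (simp add: A_def)
    fix r assume "sublinear r" "\<And>x. r x \<le> q x"
    moreover from this have "r x \<le> p x" for x using q(1) order_trans unfolding A_def by blast
    ultimately show "r = q" by (intro q(2)) (auto simp: A_def P_def)
  qed
  then show ?thesis using q(1) by (auto simp: A_def)
qed

theorem hahn_banach_norm:
  fixes X :: "'a::real_normed_vector set"
  assumes X: "subspace X" and f: "linear_functional_on X f" and bound: "\<And>x. x \<in> X \<Longrightarrow> \<bar>f x\<bar> \<le> norm x"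
  shows "\<exists>F. linear F \<and> (\<forall>x\<in>X. F x = f x) \<and> (\<forall>x. \<bar>F x\<bar> \<le> norm x)"
proof -
  have fadd: "f (x + y) = f x + f y" if "x \<in> X" "y \<in> X" for x y
    using f that by (simp add: linear_functional_on_def)
  have fscale: "f (c *\<^sub>R x) = c * f x" if "x \<in> X" for c x
    using f that by (simp add: linear_functional_on_def)
  have zero: "0 \<in> X" using X by (rule subspace_0)
  have f0: "f 0 = 0" using fscale[OF zero, of 0] by simp
  \<comment> \<open>The largest sublinear functional below the norm everywhere and below
    \<open>f\<close> on \<open>X\<close>. A linear \<open>F\<close> below it equals \<open>f\<close>
    on \<open>X\<close>, by comparing at \<open>x\<close> and \<open>- x\<close>, and is below the
    norm, by taking \<open>y = 0\<close>.\<close>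
  define p where "p x = (INF y\<in>X. norm (x - y) + f y)" for x
  have bdd: "bdd_below ((\<lambda>y. norm (x - y) + f y) ` X)" for x
  proof (rule bdd_belowI2)
    fix y assume "y \<in> X"
    then show "- norm x \<le> norm (x - y) + f y"
      using bound[of y] norm_triangle_ineq2[of y x] by (simp add: norm_minus_commute)
  qed
  have le: "p x \<le> norm (x - y) + f y" if "y \<in> X" for x y
    unfolding p_def using that by (intro cINF_lower bdd)
  have ne: "X \<noteq> {}" using zero by blast
  have "sublinear p"
    unfolding sublinear_def
  proof (intro conjI allI impI)
    fix x x' :: 'a
    have *: "p (x + x') \<le> (norm (x - y) + f y) + (norm (x' - y') + f y')" if "y \<in> X" "y' \<in> X" for y y'
      using le[OF subspace_add[OF X that], of "x + x'"] fadd[OF that] norm_triangle_ineq[of "x - y" "x' - y'"]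
      by (simp add: algebra_simps)
    have "p (x + x') - (norm (x - y) + f y) \<le> p x'" if "y \<in> X" for y
      unfolding p_def[of x'] using ne *[OF that] by (intro cINF_greatest) (auto simp: algebra_simps)
    then have "p (x + x') - p x' \<le> norm (x - y) + f y" if "y \<in> X" for y
      using that by (smt (verit))
    then have "p (x + x') - p x' \<le> p x"
      unfolding p_def[of x] using ne by (intro cINF_greatest) auto
    then show "p (x + x') \<le> p x + p x'" by simp
  next
    fix c :: real and x :: 'a assume c: "0 < c"
    have "p (c *\<^sub>R x) / c \<le> norm (x - y) + f y" if "y \<in> X" for y
    proof -
      have "p (c *\<^sub>R x) \<le> norm (c *\<^sub>R (x - y)) + f (c *\<^sub>R y)"
        using le[OF subspace_scale[OF X that], of "c *\<^sub>R x" c] by (simp add: scaleR_right_diff_distrib)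
      also have "\<dots> = c * (norm (x - y) + f y)"
        using fscale[OF that, of c] c by (simp only: norm_scaleR distrib_left abs_of_pos)
      finally show ?thesis using c by (simp add: field_simps)
    qed
    then have "p (c *\<^sub>R x) / c \<le> p x"
      unfolding p_def[of x] using ne by (intro cINF_greatest) auto
    then show "p (c *\<^sub>R x) \<le> c * p x" using c by (simp add: field_simps)
  qed
  then obtain F where F: "linear F" "\<And>x. F x \<le> p x" using ex_linear_below_sublinear by blast
  have Fneg: "F (- x) = - F x" for x using F(1) by (rule linear_neg)
  have "F x = f x" if "x \<in> X" for x
  proof -
    have "F x \<le> f x" if "x \<in> X" for x using F(2)[of x] le[OF that, of x] by simp
    from this[OF that] this[OF subspace_neg[OF X that]] show ?thesis
      using fscale[OF that, of "-1"] Fneg[of x] by simp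
  qed
  moreover have "\<bar>F x\<bar> \<le> norm x" for x
  proof -
    have "F x \<le> norm x" for x using F(2)[of x] le[OF zero, of x] f0 by simp
    from this[of x] this[of "- x"] show ?thesis using Fneg[of x] by simp
  qed
  ultimately show ?thesis using F(1) by blast
qed

section \<open>The unit ball of the dual as a continuous image of the Cantor set\<close>

locale dense_sequence =
  fixes e :: "nat \<Rightarrow> 'a::real_normed_vector"
  assumes dense: "closure (range e) = UNIV"
begin

lemma dense_approx:
  assumes "0 < \<delta>"
  obtains n where "norm (x - e n) < \<delta>"
proof -
  have "x \<in> closure (range e)" by (simp add: dense)
  then obtain n where "dist (e n) x < \<delta>"
    using assms unfolding closure_approachable by blast
  then show ?thesis by (intro that[of n]) (simp add: dist_norm norm_minus_commute)
qed

definition unit_functionals :: "(nat \<Rightarrow> real) set" where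
  "unit_functionals = {(\<lambda>i. F (e i)) | F. linear F \<and> (\<forall>x. \<bar>F x\<bar> \<le> norm x)}"

text \<open>A continuous map of the Cantor set onto the unit ball of the dual with its weak* topology.\<close>

definition dual_ball :: "(nat \<Rightarrow> bool) \<Rightarrow> 'a \<Rightarrow> real" where
  "dual_ball c = extend e (parametrization (\<lambda>i. norm (e i)) unit_functionals c)"

text \<open>The inequality holds for the values of a genuine functional of norm at most 1, and it
  involves three coordinates only, so it survives in the closure of \<open>unit_functionals\<close>,
  where \<open>v\<close> lies.\<close>

lemma parametrization_ineq:
  fixes c
  defines "v \<equiv> parametrization (\<lambda>i. norm (e i)) unit_functionals c"
  shows "\<bar>\<alpha> * v n + \<beta> * v m - v k\<bar> \<le> 1 * norm (\<alpha> *\<^sub>R e n + \<beta> *\<^sub>R e m - e k)"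
proof (rule field_le_epsilon)
  fix \<epsilon> :: real assume \<epsilon>: "0 < \<epsilon>"
  \<comment> \<open>The total weight with which the errors of the three coordinates enter.\<close>
  define C where "C = \<bar>\<alpha>\<bar> + \<bar>\<beta>\<bar> + 1"
  have C: "C > 0" by (simp add: C_def)
  have z: "(\<lambda>i. 0) \<in> unit_functionals"
    unfolding unit_functionals_def by (intro CollectI exI[of _ "\<lambda>x. 0"]) (auto intro: linear_zero)
  obtain a where a: "a \<in> unit_functionals" "\<And>i. i < Suc (max n (max m k)) \<Longrightarrow> \<bar>a i - v i\<bar> < \<epsilon> / C"
    using parametrization_approx[OF z, of "\<lambda>i. norm (e i)" "\<epsilon> / C" "Suc (max n (max m k))" c] \<epsilon> C
    by (auto simp: v_def)
  obtain F where F: "linear F" "\<And>x. \<bar>F x\<bar> \<le> norm x" "a = (\<lambda>i. F (e i))"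
    using a(1) by (auto simp: unit_functionals_def)
  have *: "\<alpha> * a n + \<beta> * a m - a k = F (\<alpha> *\<^sub>R e n + \<beta> *\<^sub>R e m - e k)"
    using F(1,3) by (simp add: linear_add linear_diff linear_cmul)
  have an: "\<bar>a n - v n\<bar> \<le> \<epsilon> / C" and am: "\<bar>a m - v m\<bar> \<le> \<epsilon> / C" and ak: "\<bar>a k - v k\<bar> \<le> \<epsilon> / C"
    by (auto intro!: less_imp_le[OF a(2)] simp: less_Suc_eq_le)
  have "\<bar>\<alpha> * v n + \<beta> * v m - v k\<bar>
      \<le> \<bar>\<alpha> * a n + \<beta> * a m - a k\<bar> + (\<bar>\<alpha> * (a n - v n)\<bar> + \<bar>\<beta> * (a m - v m)\<bar> + \<bar>a k - v k\<bar>)"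
    unfolding right_diff_distrib by linarith
  also have "\<dots> \<le> norm (\<alpha> *\<^sub>R e n + \<beta> *\<^sub>R e m - e k) + (\<bar>\<alpha>\<bar> * (\<epsilon> / C) + \<bar>\<beta>\<bar> * (\<epsilon> / C) + \<epsilon> / C)"
    unfolding * abs_mult by (intro add_mono mult_left_mono F(2) an am ak) auto
  also have "\<bar>\<alpha>\<bar> * (\<epsilon> / C) + \<bar>\<beta>\<bar> * (\<epsilon> / C) + \<epsilon> / C = C * (\<epsilon> / C)"
    by (simp add: C_def distrib_right add_divide_distrib)
  finally show "\<bar>\<alpha> * v n + \<beta> * v m - v k\<bar> \<le> 1 * norm (\<alpha> *\<^sub>R e n + \<beta> *\<^sub>R e m - e k) + \<epsilon>"
    using C by simp
qed

lemma dual_ball_ineq: "\<bar>\<alpha> * dual_ball c x + \<beta> * dual_ball c y - dual_ball c z\<bar> \<le> norm (\<alpha> *\<^sub>R x + \<beta> *\<^sub>R y - z)"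
  using extend_ineq[of 1 "parametrization (\<lambda>i. norm (e i)) unit_functionals c" e x y z \<alpha> \<beta>]
    parametrization_ineq[of _ c]
  by (simp add: dual_ball_def dense)

text \<open>Both laws are instances of the three-term inequality whose right-hand side is 0.\<close>

lemma linear_dual_ball: "linear (dual_ball c)"
proof (rule linearI)
  show "dual_ball c (x + y) = dual_ball c x + dual_ball c y" for x y
    using dual_ball_ineq[of 1 c x 1 y "x + y"] by simp
  show "dual_ball c (r *\<^sub>R x) = r *\<^sub>R dual_ball c x" for r x
    using dual_ball_ineq[of r c x 0 x "r *\<^sub>R x"] by simp
qed

lemma dual_ball_diff: "\<bar>dual_ball c x - dual_ball c y\<bar> \<le> norm (x - y)"
  using dual_ball_ineq[of 1 c x 0 x y] by simp

lemma dual_ball_le: "\<bar>dual_ball c x\<bar> \<le> norm x"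
  using dual_ball_ineq[of 0 c x 0 x x] by simp

lemma dual_ball_base: "dual_ball c (e n) = parametrization (\<lambda>i. norm (e i)) unit_functionals c n"
  unfolding dual_ball_def by (rule extend_base[of 1]) (use parametrization_ineq in auto)

lemma continuous_on_dual_ball: "continuous_on UNIV (\<lambda>c. dual_ball c x)"
  unfolding continuous_on_cantor_iff
proof (intro allI impI)
  fix c :: "nat \<Rightarrow> bool" and \<delta> :: real assume \<delta>: "0 < \<delta>"
  obtain n where n: "norm (x - e n) < \<delta> / 3" by (rule dense_approx[of "\<delta> / 3" x]) (use \<delta> in simp)
  have "continuous_on UNIV (\<lambda>c. dual_ball c (e n))"
    unfolding dual_ball_base by (rule continuous_on_parametrization)
  then obtain k where k: "\<And>d. d \<in> cylinder (initial c k) \<Longrightarrow> dist (dual_ball d (e n)) (dual_ball c (e n)) < \<delta> / 3"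
    using \<delta> unfolding continuous_on_cantor_iff by (meson divide_pos_pos zero_less_numeral)
  have "dist (dual_ball d x) (dual_ball c x) < \<delta>" if "d \<in> cylinder (initial c k)" for d
    using k[OF that] dual_ball_diff[of d x "e n"] dual_ball_diff[of c x "e n"] n
    unfolding dist_real_def by linarith
  then show "\<exists>n. \<forall>d\<in>cylinder (initial c n). dist (dual_ball d x) (dual_ball c x) < \<delta>" by blast
qed

lemma ex_dual_ball_eq:
  assumes F: "linear F" "\<And>x. \<bar>F x\<bar> \<le> norm x"
  shows "\<exists>c. dual_ball c = F"
proof -
  have "(\<lambda>i. F (e i)) \<in> unit_functionals" using F by (auto simp: unit_functionals_def)
  then obtain c where c: "parametrization (\<lambda>i. norm (e i)) unit_functionals c = (\<lambda>i. F (e i))"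
    using parametrization_surj[of "\<lambda>i. F (e i)" unit_functionals "\<lambda>i. norm (e i)"] F(2) by blast
  have "dual_ball c x = F x" for x
  proof -
    have "\<bar>dual_ball c x - F x\<bar> \<le> 0 + \<delta>" if \<delta>: "0 < \<delta>" for \<delta>
    proof -
      obtain n where n: "norm (x - e n) < \<delta> / 2" by (rule dense_approx[of "\<delta> / 2" x]) (use \<delta> in simp)
      have "F (x - e n) = F x - F (e n)" using F(1) by (simp add: linear_diff)
      then show ?thesis
        using n dual_ball_diff[of c x "e n"] F(2)[of "x - e n"] dual_ball_base[of c n] c by simp
    qed
    then have "\<bar>dual_ball c x - F x\<bar> \<le> 0" by (rule field_le_epsilon)
    then show ?thesis by simp
  qed
  then show ?thesis by blast
qed

lemma ex_dual_ball_eq_on: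
  assumes "subspace X" "linear_functional_on X f" "\<And>x. x \<in> X \<Longrightarrow> \<bar>f x\<bar> \<le> norm x"
  shows "\<exists>c. \<forall>x\<in>X. dual_ball c x = f x"
proof -
  obtain F where "linear F" "\<forall>x\<in>X. F x = f x" "\<forall>x. \<bar>F x\<bar> \<le> norm x"
    using hahn_banach_norm[OF assms] by blast
  then show ?thesis using ex_dual_ball_eq[of F] by metis
qed

end

section \<open>Borel sets as projections of closed sets\<close>

text \<open>Real sequences take the place of the Baire space here, since the type \<open>nat\<close> is not an
  instance of \<open>metric_space\<close>; their first entry is forced into the naturals.\<close>

lemma projection_closed_Union:
  fixes H :: "nat \<Rightarrow> ((nat \<Rightarrow> real) \<times> 'z::topological_space) set"
  assumes H: "\<And>n. closed (H n)"
  shows "\<exists>K :: ((nat \<Rightarrow> real) \<times> 'z) set. closed K \<and> snd ` K = (\<Union>n. snd ` H n)"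
proof -
  define \<phi> :: "(nat \<Rightarrow> real) \<times> 'z \<Rightarrow> (nat \<Rightarrow> real) \<times> 'z" where "\<phi> w = (\<lambda>i. fst w (Suc i), snd w)" for w
  have \<phi>: "continuous_on UNIV \<phi>"
    unfolding \<phi>_def
    by (intro continuous_on_Pair continuous_on_coordinatewise_then_product
        continuous_on_product_then_coordinatewise[OF continuous_on_fst] continuous_on_snd continuous_on_id)
  have p0: "continuous_on UNIV (\<lambda>w :: (nat \<Rightarrow> real) \<times> 'z. fst w 0)"
    by (intro continuous_on_product_then_coordinatewise[OF continuous_on_fst] continuous_on_id)
  \<comment> \<open>The first entry names some \<open>n\<close> and the shifted sequence must be a
    parameter in \<open>H n\<close>. The implication for each \<open>n\<close> is written as a union
    with the closed set of first entries at distance at least 1 from \<open>n\<close>, which keeps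
    \<open>K\<close> closed.\<close>
  define K where "K = (\<lambda>w. fst w 0) -` \<nat> \<inter> (\<Inter>n. (\<lambda>w. fst w 0) -` (- ball (real n) 1) \<union> \<phi> -` H n)"
  have "closed K"
    unfolding K_def
    by (intro closed_Int closed_INT ballI closed_Un closed_vimage \<phi> p0 H) (simp_all add: closed_def closed_Nats[unfolded closed_def])
  moreover have "snd ` K = (\<Union>n. snd ` H n)"
  proof
    show "snd ` K \<subseteq> (\<Union>n. snd ` H n)"
    proof
      fix z assume "z \<in> snd ` K"
      then obtain w where w: "w \<in> K" "z = snd w" by blast
      then obtain n where "fst w 0 = real n" by (auto simp: K_def Nats_def)
      then have "\<phi> w \<in> H n" using w(1) by (auto simp: K_def)
      then show "z \<in> (\<Union>n. snd ` H n)" using w by (auto simp: \<phi>_def image_iff intro!: bexI[of _ "\<phi> w"])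
    qed
    show "(\<Union>n. snd ` H n) \<subseteq> snd ` K"
    proof
      fix z assume "z \<in> (\<Union>n. snd ` H n)"
      then obtain n p where p: "(p, z) \<in> H n" by force
      have "m = n" if "dist (real m) (real n) < 1" for m using that by (simp add: dist_real_def)
      then have "(case_nat (real n) p, z) \<in> K" using p by (auto simp: K_def \<phi>_def)
      then show "z \<in> snd ` K" by force
    qed
  qed
  ultimately show ?thesis by blast
qed

lemma projection_closed_Inter:
  fixes H :: "nat \<Rightarrow> ((nat \<Rightarrow> real) \<times> 'z::topological_space) set"
  assumes H: "\<And>n. closed (H n)"
  shows "\<exists>K :: ((nat \<Rightarrow> real) \<times> 'z) set. closed K \<and> snd ` K = (\<Inter>n. snd ` H n)"
proof -
  define \<phi> :: "nat \<Rightarrow> (nat \<Rightarrow> real) \<times> 'z \<Rightarrow> (nat \<Rightarrow> real) \<times> 'z"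
    where "\<phi> n w = (\<lambda>i. fst w (prod_encode (n, i)), snd w)" for n w
  have \<phi>: "continuous_on UNIV (\<phi> n)" for n
    unfolding \<phi>_def
    by (intro continuous_on_Pair continuous_on_coordinatewise_then_product
        continuous_on_product_then_coordinatewise[OF continuous_on_fst] continuous_on_snd continuous_on_id)
  \<comment> \<open>One sequence stores a parameter for every \<open>H n\<close>, the
    \<open>n\<close>-th in the row of indices \<open>prod_encode (n, i)\<close>.\<close>
  define K where "K = (\<Inter>n. \<phi> n -` H n)"
  have "closed K"
    unfolding K_def by (intro closed_INT ballI closed_vimage \<phi> H)
  moreover have "snd ` K = (\<Inter>n. snd ` H n)"
  proof
    show "snd ` K \<subseteq> (\<Inter>n. snd ` H n)"
    proof
      fix z assume "z \<in> snd ` K"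
      then obtain w where w: "w \<in> K" "z = snd w" by blast
      have "z \<in> snd ` H n" for n
        using w by (intro image_eqI[of _ _ "\<phi> n w"]) (auto simp: K_def \<phi>_def)
      then show "z \<in> (\<Inter>n. snd ` H n)" by blast
    qed
    show "(\<Inter>n. snd ` H n) \<subseteq> snd ` K"
    proof
      fix z assume "z \<in> (\<Inter>n. snd ` H n)"
      then have "\<exists>p. (p, z) \<in> H n" for n by force
      then obtain p where p: "\<And>n. (p n, z) \<in> H n" by metis
      have "((\<lambda>j. case prod_decode j of (n, i) \<Rightarrow> p n i), z) \<in> K" using p by (auto simp: K_def \<phi>_def)
      then show "z \<in> snd ` K" by force
    qed
  qed
  ultimately show ?thesis by blast
qed

lemma projection_closed_if_closed:
  fixes Q :: "'z::topological_space set"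
  assumes "closed Q"
  shows "\<exists>K :: ((nat \<Rightarrow> real) \<times> 'z) set. closed K \<and> snd ` K = Q"
  using assms by (intro exI[of _ "UNIV \<times> Q"]) (auto intro: closed_Times)

lemma projection_closed_if_open:
  fixes Q :: "'z::metric_space set"
  assumes Q: "open Q"
  shows "\<exists>K :: ((nat \<Rightarrow> real) \<times> 'z) set. closed K \<and> snd ` K = Q"
\<comment> \<open>By convention \<open>infdist\<close> to the empty set is 0, so the closed sets
  used below would be empty for \<open>Q = UNIV\<close>.\<close>
proof (cases "Q = UNIV")
  case True
  then show ?thesis by (intro projection_closed_if_closed) simp
next
  case False
  define C where "C n = {x. 1 / real (Suc n) \<le> infdist x (- Q)}" for n
  have "closed (C n)" for n
    unfolding C_def by (intro closed_Collect_le continuous_intros)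
  then have "\<exists>K :: ((nat \<Rightarrow> real) \<times> 'z) set. closed K \<and> snd ` K = C n" for n
    by (rule projection_closed_if_closed)
  then obtain H :: "nat \<Rightarrow> ((nat \<Rightarrow> real) \<times> 'z) set" where H: "\<And>n. closed (H n)" "\<And>n. snd ` H n = C n"
    by metis
  have "Q = (\<Union>n. C n)"
  proof (intro equalityI subsetI)
    fix x assume "x \<in> Q"
    then have "infdist x (- Q) > 0"
      using Q False infdist_pos_not_in_closed[of "- Q" x] by auto
    then obtain n where "1 / real (Suc n) < infdist x (- Q)" using nat_approx_posE by metis
    then show "x \<in> (\<Union>n. C n)" by (auto simp: C_def intro!: exI[of _ n])
  next
    fix x assume "x \<in> (\<Union>n. C n)"
    then obtain n where "1 / real (Suc n) \<le> infdist x (- Q)" by (auto simp: C_def)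
    moreover have "0 < 1 / real (Suc n)" by simp
    ultimately have "infdist x (- Q) \<noteq> 0" by linarith
    then show "x \<in> Q" using infdist_zero[of x "- Q"] by blast
  qed
  then show ?thesis using projection_closed_Union[of H] H by simp
qed

text \<open>Projections are not stable under complements, so the induction over the Borel sets
  carries a set together with its complement.\<close>

theorem borel_projection_closed:
  fixes Q :: "'z::metric_space set"
  assumes "Q \<in> sets borel"
  shows "\<exists>K :: ((nat \<Rightarrow> real) \<times> 'z) set. closed K \<and> snd ` K = Q"
proof -
  let ?P = "\<lambda>Q :: 'z set. \<exists>K :: ((nat \<Rightarrow> real) \<times> 'z) set. closed K \<and> snd ` K = Q"
  have "Q \<in> sigma_sets UNIV {S. open S}"
    using assms by (simp add: borel_def)
  then have "?P Q \<and> ?P (- Q)"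
  proof induction
    case (Basic a)
    then have "open a" by simp
    then show ?case
      by (intro conjI projection_closed_if_open projection_closed_if_closed closed_Compl)
  next
    case Empty
    show ?case using projection_closed_if_closed[of "{}"] projection_closed_if_closed[of UNIV] by simp
  next
    case (Compl a)
    then show ?case by (simp add: Compl_eq_Diff_UNIV[symmetric])
  next
    case (Union a)
    have "\<exists>K :: ((nat \<Rightarrow> real) \<times> 'z) set. closed K \<and> snd ` K = a n" for n
      using Union.IH by blast
    then obtain H where H: "\<And>n. closed (H n :: ((nat \<Rightarrow> real) \<times> 'z) set)" "\<And>n. snd ` H n = a n" by metis
    have "\<exists>K :: ((nat \<Rightarrow> real) \<times> 'z) set. closed K \<and> snd ` K = - a n" for n
      using Union.IH by blast
    then obtain H' where H': "\<And>n. closed (H' n :: ((nat \<Rightarrow> real) \<times> 'z) set)" "\<And>n. snd ` H' n = - a n" by metis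
    have "- (\<Union>n. a n) = (\<Inter>n. - a n)" by blast
    then show ?case
      using projection_closed_Union[of H] projection_closed_Inter[of H'] H H' by simp
  qed
  then show ?thesis by blast
qed

section \<open>Closed subspaces as closed spans of sequences\<close>

lemma subspace_closure:
  fixes S :: "'a::real_normed_vector set"
  assumes S: "subspace S"
  shows "subspace (closure S)"
proof (rule subspaceI)
  show "0 \<in> closure S" using subspace_0[OF S] closure_subset by blast
next
  fix x y assume "x \<in> closure S" "y \<in> closure S"
  then obtain a b where "\<And>n. a n \<in> S" "a \<longlonglongrightarrow> x" "\<And>n. b n \<in> S" "b \<longlonglongrightarrow> y"
    unfolding closure_sequential by blast
  then show "x + y \<in> closure S"
    unfolding closure_sequential by (intro exI[of _ "\<lambda>n. a n + b n"]) (auto intro: tendsto_add subspace_add[OF S])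
next
  fix c :: real and x assume "x \<in> closure S"
  then obtain a where "\<And>n. a n \<in> S" "a \<longlonglongrightarrow> x"
    unfolding closure_sequential by blast
  then show "c *\<^sub>R x \<in> closure S"
    unfolding closure_sequential
    by (intro exI[of _ "\<lambda>n. c *\<^sub>R a n"]) (auto intro: tendsto_scaleR subspace_scale[OF S])
qed

text \<open>Sequences serve as parameters for closed subspaces: they form a metrizable space, so a
  Borel family of subspaces turns into a Borel set to which \<open>borel_projection_closed\<close>
  applies.\<close>

definition closed_span :: "(nat \<Rightarrow> 'a::real_normed_vector) \<Rightarrow> 'a set" where
  "closed_span z = closure (span (range z))"

lemma closed_closed_span [simp]: "closed (closed_span z)"
  by (simp add: closed_span_def)

lemma subspace_closed_span [simp]: "subspace (closed_span z)"
  by (simp add: closed_span_def subspace_closure)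

text \<open>The coefficients that produce \<open>x\<close> from \<open>z\<close> are kept and
  applied to every other sequence.\<close>

lemma span_range_continuous_family:
  fixes z :: "nat \<Rightarrow> 'a::real_normed_vector"
  assumes "x \<in> span (range z)"
  shows "\<exists>\<phi>. continuous_on UNIV \<phi> \<and> (\<forall>y. \<phi> y \<in> span (range y)) \<and> \<phi> z = x"
  using assms
proof (induction rule: span_induct_alt)
  case base
  show ?case by (intro exI[of _ "\<lambda>_. 0"]) (auto simp: span_zero)
next
  case (step c x y)
  then obtain i \<phi> where "x = z i" and \<phi>: "continuous_on UNIV \<phi>" "\<And>y. \<phi> y \<in> span (range y)" "\<phi> z = y"
    by blast
  then show ?case
    by (intro exI[of _ "\<lambda>y. c *\<^sub>R y i + \<phi> y"])
       (auto intro!: continuous_intros span_add span_scale intro: span_base)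
qed

text \<open>An open set that meets the closure already meets the span, and a fixed linear
  combination of the entries stays in \<open>U\<close> when the sequence is perturbed.\<close>

lemma open_closed_span_meets:
  fixes U :: "'a::real_normed_vector set"
  assumes U: "open U"
  shows "open {z :: nat \<Rightarrow> 'a. closed_span z \<inter> U \<noteq> {}}"
proof -
  have "\<exists>T. open T \<and> z \<in> T \<and> T \<subseteq> {z. closed_span z \<inter> U \<noteq> {}}" if "closed_span z \<inter> U \<noteq> {}" for z :: "nat \<Rightarrow> 'a"
  proof -
    have "span (range z) \<inter> U \<noteq> {}"
      using that U open_Int_closure_eq_empty[of U "span (range z)"] by (auto simp: closed_span_def)
    then obtain x where x: "x \<in> span (range z)" "x \<in> U" by blast
    obtain \<phi> where \<phi>: "continuous_on UNIV \<phi>" "\<And>y. \<phi> y \<in> span (range y)" "\<phi> z = x"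
      using span_range_continuous_family[OF x(1)] by blast
    have "\<phi> y \<in> closed_span y" for y
      using \<phi>(2) closure_subset by (force simp: closed_span_def)
    then have "\<phi> -` U \<subseteq> {z. closed_span z \<inter> U \<noteq> {}}" by blast
    moreover have "open (\<phi> -` U)" using \<phi>(1) U by (simp add: open_vimage)
    ultimately show ?thesis using \<phi>(3) x(2) by blast
  qed
  then show ?thesis by (subst open_subopen) simp
qed

lemma (in dense_sequence) ex_closed_span:
  fixes X :: "'a set"
  assumes X: "closed X" "subspace X"
  shows "\<exists>z. closed_span z = X"
proof -
  \<comment> \<open>For each \<open>n\<close> and each precision, a point of \<open>X\<close> that
    close to \<open>e n\<close> is chosen if there is one. The default 0 keeps the sequence inside
    \<open>X\<close>.\<close>
  define z where "z j = (case prod_decode j of (n, k) \<Rightarrow>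
      if \<exists>x\<in>X. norm (x - e n) < (1/2) ^ k then SOME x. x \<in> X \<and> norm (x - e n) < (1/2) ^ k else 0)" for j
  have z_X: "z j \<in> X" for j
  proof -
    obtain n k where j: "prod_decode j = (n, k)" by (cases "prod_decode j")
    show ?thesis
    proof (cases "\<exists>x\<in>X. norm (x - e n) < (1/2) ^ k")
      case True
      then have "\<exists>x. x \<in> X \<and> norm (x - e n) < (1/2) ^ k" by blast
      from someI_ex[OF this] True show ?thesis by (simp add: z_def j)
    qed (simp add: z_def j subspace_0 X)
  qed
  have "x \<in> closed_span z" if "x \<in> X" for x
    unfolding closed_span_def closure_approachable
  proof (intro allI impI)
    fix r :: real assume "0 < r"
    then obtain k where k: "(1/2) ^ k < r / 2" using real_arch_pow_inv[of "r / 2" "1/2"] by auto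
    obtain n where n: "norm (x - e n) < (1/2) ^ k" by (rule dense_approx[of "(1/2) ^ k" x]) simp
    then have ex: "\<exists>x. x \<in> X \<and> norm (x - e n) < (1/2) ^ k" using that by blast
    define y where "y = z (prod_encode (n, k))"
    have "norm (y - e n) < (1/2) ^ k"
      using someI_ex[OF ex] ex by (auto simp: y_def z_def)
    then have "dist y x < r"
      using n k norm_triangle_ineq4[of "y - e n" "x - e n"] by (simp add: dist_norm)
    moreover have "y \<in> span (range z)" by (simp add: y_def span_base)
    ultimately show "\<exists>y\<in>span (range z). dist y x < r" by blast
  qed
  moreover have "closed_span z \<subseteq> X"
    unfolding closed_span_def
    using X z_X by (intro closure_minimal span_minimal) auto
  ultimately show ?thesis by blast
qed

lemma tendsto_coordinatewise:
  fixes l :: "nat \<Rightarrow> 'b::topological_space"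
  assumes "\<And>i. ((\<lambda>x. f x i) \<longlongrightarrow> l i) F"
  shows "(f \<longlongrightarrow> l) F"
proof -
  have "limitin (product_topology (\<lambda>i. euclidean) UNIV) f l F"
    using assms by (subst limitin_componentwise) simp
  then show ?thesis by (simp add: euclidean_product_topology)
qed

text \<open>Finite lists padded with zeros suffice, since convergence is coordinatewise and each
  coordinate is eventually covered by the lists.\<close>

lemma (in dense_sequence) dense_parameters:
  "\<exists>D :: ((nat \<Rightarrow> real) \<times> (nat \<Rightarrow> 'a)) set. countable D \<and> closure D = UNIV"
proof -
  define \<psi> :: "rat list \<times> nat list \<Rightarrow> (nat \<Rightarrow> real) \<times> (nat \<Rightarrow> 'a)" where
    "\<psi> = (\<lambda>(l, k). (\<lambda>i. if i < length l then real_of_rat (l ! i) else 0, \<lambda>i. if i < length k then e (k ! i) else 0))"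
  have "w \<in> closure (range \<psi>)" for w
  proof -
    obtain p z where w: "w = (p, z)" by fastforce
    define J where "J n i = (SOME j. norm (z i - e j) < (1/2) ^ n)" for n i :: nat
    have J: "norm (z i - e (J n i)) < (1/2) ^ n" for n i
      unfolding J_def by (rule someI_ex) (rule dense_approx[of "(1/2) ^ n" "z i"], auto)
    define r where "r n i = (SOME q. norm (real_of_rat q - p i) < (1/2) ^ n)" for n i :: nat
    have r: "norm (real_of_rat (r n i) - p i) < (1/2) ^ n" for n i
      unfolding r_def
    proof (rule someI_ex)
      have "p i < p i + (1/2) ^ n" by simp
      then obtain q where "p i < real_of_rat q" "real_of_rat q < p i + (1/2) ^ n" using of_rat_dense by blast
      then show "\<exists>q. norm (real_of_rat q - p i) < (1/2) ^ n" by (intro exI[of _ q]) simp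
    qed
    define x where "x n = \<psi> (map (r n) [0..<n], map (J n) [0..<n])" for n
    have "(\<lambda>n. fst (x n)) \<longlonglongrightarrow> p"
    proof (rule tendsto_coordinatewise)
      fix i
      have "(\<lambda>n. fst (x n) i - p i) \<longlonglongrightarrow> 0"
      proof (rule Lim_null_comparison)
        show "\<forall>\<^sub>F n in sequentially. norm (fst (x n) i - p i) \<le> (1/2) ^ n"
          using eventually_gt_at_top[of i]
        proof eventually_elim
          case (elim n)
          then show ?case
            using r[of n i] by (simp add: x_def \<psi>_def less_imp_le)
        qed
      qed (simp add: LIMSEQ_power_zero)
      then show "(\<lambda>n. fst (x n) i) \<longlonglongrightarrow> p i" using Lim_null by blast
    qed
    moreover have "(\<lambda>n. snd (x n)) \<longlonglongrightarrow> z"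
    proof (rule tendsto_coordinatewise)
      fix i
      have "(\<lambda>n. snd (x n) i - z i) \<longlonglongrightarrow> 0"
      proof (rule Lim_null_comparison)
        show "\<forall>\<^sub>F n in sequentially. norm (snd (x n) i - z i) \<le> (1/2) ^ n"
          using eventually_gt_at_top[of i]
        proof eventually_elim
          case (elim n)
          then show ?case
            using J[of i n] by (simp add: x_def \<psi>_def norm_minus_commute less_imp_le)
        qed
      qed (simp add: LIMSEQ_power_zero)
      then show "(\<lambda>n. snd (x n) i) \<longlonglongrightarrow> z i" using Lim_null by blast
    qed
    ultimately have "(\<lambda>n. (fst (x n), snd (x n))) \<longlonglongrightarrow> (p, z)" by (rule tendsto_Pair)
    then have "x \<longlonglongrightarrow> w" by (simp add: w)
    moreover have "x n \<in> range \<psi>" for n by (simp add: x_def)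
    ultimately show ?thesis using closure_sequential by blast
  qed
  then show ?thesis by (intro exI[of _ "range \<psi>"]) auto
qed

section \<open>Derivatives of families of trees\<close>

text \<open>Each new digit is decided by the membership of a single string, so by induction every
  possible initial segment \<open>w\<close> occurs on a measurable set of \<open>X\<close>.\<close>

lemma pred_initial_greedy:
  assumes [measurable]: "\<And>s. Measurable.pred M (\<lambda>X. s \<in> S X)"
  shows "Measurable.pred M (\<lambda>X. initial (greedy (S X) t) n = w)"
proof (induction n arbitrary: w)
  case (Suc n)
  note [measurable] = Suc.IH
  have eq: "initial (greedy (S X) t) (Suc n) = w \<longleftrightarrow>
      w \<noteq> [] \<and> initial (greedy (S X) t) n = butlast w \<and>
      last w = (if butlast w @ [t n] \<in> S X then t n else \<not> t n)" for X
    unfolding greedy_Suc by (cases w rule: rev_cases) auto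
  show ?case unfolding eq by measurable
qed simp

lemma pred_greedy:
  assumes [measurable]: "\<And>s. Measurable.pred M (\<lambda>X. s \<in> S X)"
  shows "Measurable.pred M (\<lambda>X. greedy (S X) t k)"
proof -
  have eq: "greedy (S X) t k \<longleftrightarrow> (\<exists>w. initial (greedy (S X) t) (Suc k) = w \<and> last w)" for X
    by (simp add: initial_Suc)
  note [measurable] = pred_initial_greedy[where S = S and t = t, OF assms]
  show ?thesis unfolding eq by measurable
qed

lemma pred_meets_branches:
  assumes [measurable]: "\<And>s. Measurable.pred M (\<lambda>X. s \<in> R X)"
  shows "Measurable.pred M (\<lambda>X. cylinder s \<inter> branches (R X) \<noteq> {})"
  unfolding cylinder_meets_branches_iff by measurable

text \<open>The strings whose cylinders meet \<open>branches (R X)\<close> form a pruned tree,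
  measurable in \<open>X\<close> by Koenig's lemma; the choice is its greedy branch along
  \<open>pad s\<close>.\<close>

lemma measurable_branch_selection:
  assumes R: "\<And>s. Measurable.pred M (\<lambda>X. s \<in> R X)"
  shows "\<exists>h. (\<forall>k. Measurable.pred M (\<lambda>X. h X k)) \<and>
    (\<forall>X. cylinder s \<inter> branches (R X) \<noteq> {} \<longrightarrow> h X \<in> cylinder s \<inter> branches (R X))"
proof -
  define S where "S X = {t. cylinder t \<inter> branches (R X) \<noteq> {}}" for X
  have "Measurable.pred M (\<lambda>X. greedy (S X) (pad s) k)" for k
    by (rule pred_greedy) (simp add: S_def pred_meets_branches[OF R])
  moreover have "greedy (S X) (pad s) \<in> cylinder s \<inter> branches (R X)" if "cylinder s \<inter> branches (R X) \<noteq> {}" for X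
  proof -
    have down: "v \<in> S X" if "prefix v u" "u \<in> S X" for u v
      using that cylinder_mono unfolding S_def by blast
    have s: "s \<in> S X" using that by (simp add: S_def)
    have "w @ [True] \<in> S X \<or> w @ [False] \<in> S X" if w: "w \<in> S X" for w
    proof -
      obtain c where c: "c \<in> cylinder w" "c \<in> branches (R X)" using w by (auto simp: S_def)
      then have "c \<in> cylinder (w @ [c (length w)])" by (simp add: cylinder_def initial_Suc)
      then have "w @ [c (length w)] \<in> S X" using c by (auto simp: S_def)
      then show ?thesis by (cases "c (length w)") auto
    qed
    then have br: "greedy (S X) (pad s) \<in> branches (S X)"
      using down[OF _ s, of "[]"] by (intro greedy_in_branches) auto
    have "initial (greedy (S X) (pad s)) (length s) = initial (pad s) (length s)"
      using down[OF _ s] prefix_initial[of _ "length s" "pad s"] by (intro greedy_initial_eq) simp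
    then have "greedy (S X) (pad s) \<in> cylinder s" by (simp add: cylinder_def)
    moreover have "initial (greedy (S X) (pad s)) n \<in> R X" for n
    proof -
      obtain c where "c \<in> cylinder (initial (greedy (S X) (pad s)) n)" "c \<in> branches (R X)"
        using br by (auto simp: branches_def S_def)
      then have "initial c n = initial (greedy (S X) (pad s)) n" and "\<forall>m. initial c m \<in> R X"
        by (auto dest: cylinderD simp: branches_def)
      then show ?thesis by metis
    qed
    ultimately show ?thesis by (simp add: branches_def)
  qed
  ultimately show ?thesis by (intro exI[of _ "\<lambda>X. greedy (S X) (pad s)"]) blast
qed

context dense_sequence
begin

text \<open>For a subspace \<open>X\<close> and \<open>\<epsilon> \<ge> 0\<close>, the restrictions
  to \<open>X\<close> differ by more than \<open>\<epsilon>\<close> in the norm of the dual of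
  \<open>X\<close>. The strict inequality at a witness makes this an open condition.\<close>

definition far :: "'a set \<Rightarrow> real \<Rightarrow> (nat \<Rightarrow> bool) \<Rightarrow> (nat \<Rightarrow> bool) \<Rightarrow> bool" where
  "far X \<epsilon> c d \<longleftrightarrow> (\<exists>x\<in>X. \<epsilon> * norm x < \<bar>dual_ball c x - dual_ball d x\<bar>)"

lemma far_sym: "far X \<epsilon> c d \<longleftrightarrow> far X \<epsilon> d c"
  by (simp add: far_def abs_minus_commute)

lemma separation_stable:
  assumes x: "\<epsilon> * norm x < \<bar>dual_ball c x - dual_ball d x\<bar>"
  shows "\<exists>\<eta>>0. \<exists>n. \<forall>y\<in>ball x \<eta>. \<forall>c'\<in>cylinder (initial c n). \<forall>d'\<in>cylinder (initial d n).
    \<epsilon> * norm y < \<bar>dual_ball c' y - dual_ball d' y\<bar>"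
proof -
  define \<gamma> where "\<gamma> = \<bar>dual_ball c x - dual_ball d x\<bar> - \<epsilon> * norm x"
  have \<gamma>: "\<gamma> > 0" using x by (simp add: \<gamma>_def)
  \<comment> \<open>Replacing \<open>x\<close> by \<open>y\<close> in the two functionals and in
    \<open>\<epsilon> * norm x\<close> then costs at most \<open>\<gamma> / 2\<close>; the other
    half pays for changing the codes \<open>c\<close> and \<open>d\<close>, a quarter each.\<close>
  define \<eta> where "\<eta> = \<gamma> / 2 / (2 + \<bar>\<epsilon>\<bar>)"
  have pos: "2 + \<bar>\<epsilon>\<bar> > 0" by simp
  then have "(2 + \<bar>\<epsilon>\<bar>) * \<eta> = \<gamma> / 2"
    unfolding \<eta>_def by (metis less_numeral_extra(3) nonzero_mult_div_cancel_left times_divide_eq_right)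
  then have \<eta>_eq: "2 * \<eta> + \<bar>\<epsilon>\<bar> * \<eta> = \<gamma> / 2" by (simp only: distrib_right)
  have \<eta>: "\<eta> > 0" using \<gamma> pos by (simp add: \<eta>_def)
  have "\<exists>n. \<forall>c'\<in>cylinder (initial c n). dist (dual_ball c' x) (dual_ball c x) < \<gamma> / 4" for c
    using continuous_on_dual_ball[of x] \<gamma> unfolding continuous_on_cantor_iff
    by (meson divide_pos_pos zero_less_numeral)
  then obtain N where N: "\<And>c c'. c' \<in> cylinder (initial c (N c)) \<Longrightarrow> dist (dual_ball c' x) (dual_ball c x) < \<gamma> / 4"
    by metis
  have "\<epsilon> * norm y < \<bar>dual_ball c' y - dual_ball d' y\<bar>"
    if y: "y \<in> ball x \<eta>" and c': "c' \<in> cylinder (initial c (max (N c) (N d)))"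
      and d': "d' \<in> cylinder (initial d (max (N c) (N d)))" for y c' d'
  proof -
    have "\<bar>dual_ball c' x - dual_ball c x\<bar> < \<gamma> / 4" "\<bar>dual_ball d' x - dual_ball d x\<bar> < \<gamma> / 4"
      using N[of c' c] N[of d' d] c' d' by (auto simp: cylinder_initial_iff dist_real_def)
    moreover have xy: "norm (x - y) < \<eta>" using y by (simp add: dist_norm)
    moreover have "\<bar>dual_ball c' x - dual_ball c' y\<bar> < \<eta>" "\<bar>dual_ball d' x - dual_ball d' y\<bar> < \<eta>"
      using dual_ball_diff xy le_less_trans by blast+
    moreover have "\<epsilon> * norm y \<le> \<epsilon> * norm x + \<bar>\<epsilon>\<bar> * \<eta>"
    proof -
      have "\<epsilon> * (norm y - norm x) \<le> \<bar>\<epsilon>\<bar> * \<bar>norm y - norm x\<bar>"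
        by (metis abs_ge_self abs_mult)
      also have "\<dots> \<le> \<bar>\<epsilon>\<bar> * \<eta>"
        using xy norm_triangle_ineq3[of x y] by (intro mult_left_mono) (auto simp: abs_minus_commute)
      finally show ?thesis by (simp add: right_diff_distrib)
    qed
    ultimately show ?thesis using \<eta>_eq \<gamma>_def \<gamma> by linarith
  qed
  then show ?thesis using \<eta> by blast
qed

text \<open>A condition free of \<open>X\<close>: once \<open>X\<close> meets the ball, all pairs
  from the two cylinders are far apart. There are countably many such boxes, and by
  \<open>far_box\<close> they exhaust the relation \<open>far\<close>.\<close>

definition box_far :: "real \<Rightarrow> nat \<Rightarrow> nat \<Rightarrow> bool list \<Rightarrow> bool list \<Rightarrow> bool" where
  "box_far \<epsilon> l j s t \<longleftrightarrow> (\<forall>x\<in>ball (e l) (1 / real (Suc j)). \<forall>c\<in>cylinder s. \<forall>d\<in>cylinder t.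
     \<epsilon> * norm x < \<bar>dual_ball c x - dual_ball d x\<bar>)"

lemma ex_small_ball:
  assumes "0 < \<eta>"
  shows "\<exists>l j. x \<in> ball (e l) (1 / real (Suc j)) \<and> ball (e l) (1 / real (Suc j)) \<subseteq> ball x \<eta>"
proof -
  obtain j where j: "1 / real (Suc j) < \<eta> / 2"
    using assms nat_approx_posE half_gt_zero by metis
  obtain l where l: "norm (x - e l) < 1 / real (Suc j)" by (rule dense_approx[of "1 / real (Suc j)" x]) simp
  have "ball (e l) (1 / real (Suc j)) \<subseteq> ball x \<eta>"
  proof
    fix y assume "y \<in> ball (e l) (1 / real (Suc j))"
    then have "dist x y < 1 / real (Suc j) + 1 / real (Suc j)"
      using l dist_triangle[of x y "e l"] by (simp add: dist_norm del: of_nat_Suc)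
    then show "y \<in> ball x \<eta>" using j by simp
  qed
  moreover have "x \<in> ball (e l) (1 / real (Suc j))"
    using l by (simp add: dist_norm norm_minus_commute)
  ultimately show ?thesis by blast
qed

text \<open>Stability of the separation allows rounding to a box; the bound \<open>m\<close> makes
  the strings long enough to extend prescribed ones.\<close>

lemma far_box:
  assumes "far X \<epsilon> c d"
  shows "\<exists>l j n. m \<le> n \<and> X \<inter> ball (e l) (1 / real (Suc j)) \<noteq> {} \<and> box_far \<epsilon> l j (initial c n) (initial d n)"
proof -
  obtain x where x: "x \<in> X" "\<epsilon> * norm x < \<bar>dual_ball c x - dual_ball d x\<bar>"
    using assms by (auto simp: far_def)
  obtain \<eta> n where n: "\<eta> > 0" "\<And>y c' d'. y \<in> ball x \<eta> \<Longrightarrow> c' \<in> cylinder (initial c n) \<Longrightarrow>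
      d' \<in> cylinder (initial d n) \<Longrightarrow> \<epsilon> * norm y < \<bar>dual_ball c' y - dual_ball d' y\<bar>"
    using separation_stable[OF x(2)] by blast
  obtain l j where l: "x \<in> ball (e l) (1 / real (Suc j))" "ball (e l) (1 / real (Suc j)) \<subseteq> ball x \<eta>"
    using ex_small_ball[OF n(1)] by blast
  have "box_far \<epsilon> l j (initial c (max m n)) (initial d (max m n))"
    unfolding box_far_def
  proof (intro ballI)
    fix y c' d' assume "y \<in> ball (e l) (1 / real (Suc j))"
      "c' \<in> cylinder (initial c (max m n))" "d' \<in> cylinder (initial d (max m n))"
    then show "\<epsilon> * norm y < \<bar>dual_ball c' y - dual_ball d' y\<bar>"
      using l(2) by (intro n(2)) (auto simp: cylinder_initial_iff)
  qed
  moreover have "X \<inter> ball (e l) (1 / real (Suc j)) \<noteq> {}" using x(1) l(1) by blast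
  ultimately show ?thesis by (intro exI[of _ l] exI[of _ j] exI[of _ "max m n"]) simp
qed

lemma box_farD:
  assumes "X \<inter> ball (e l) (1 / real (Suc j)) \<noteq> {}" "box_far \<epsilon> l j s t" "c \<in> cylinder s" "d \<in> cylinder t"
  shows "far X \<epsilon> c d"
  using assms unfolding far_def box_far_def by blast

text \<open>The Szlenk-type derivative: it removes from the closed set \<open>branches R\<close> all relatively
  open pieces on which the norm of the dual of \<open>X\<close> oscillates by at most \<open>\<epsilon>\<close>.\<close>

definition derivative :: "real \<Rightarrow> 'a set \<Rightarrow> bool list set \<Rightarrow> bool list set" where
  "derivative \<epsilon> X R = {s \<in> R. \<exists>c\<in>cylinder s \<inter> branches R. \<exists>d\<in>cylinder s \<inter> branches R. far X \<epsilon> c d}"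

end

lemma ex_cylinder_chain:
  fixes f :: "nat \<Rightarrow> bool list"
  assumes f: "\<And>n. prefix (f n) (f (Suc n))"
  shows "\<exists>c. \<forall>n. c \<in> cylinder (f n)"
proof -
  have mono: "prefix (f m) (f n)" if "m \<le> n" for m n
    using that by (induction rule: dec_induct) (auto intro: prefix_order.trans f)
  \<comment> \<open>The union of the chain; places that no string of the chain reaches get
    \<open>False\<close>.\<close>
  define c where "c i = (\<exists>n. i < length (f n) \<and> f n ! i)" for i
  have nth: "ys ! i = xs ! i" if "prefix xs ys" "i < length xs" for xs ys :: "bool list" and i
    using that by (elim prefixE) (simp add: nth_append)
  have c: "c i = f n ! i" if n: "i < length (f n)" for i n
  proof -
    have "f m ! i = f n ! i" if m: "i < length (f m)" for m
    proof (cases "m \<le> n")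
      case True
      then show ?thesis using nth[OF mono[of m n] m] by metis
    next
      case False
      then show ?thesis using nth[OF mono[of n m] n] by simp
    qed
    then show ?thesis using n unfolding c_def by blast
  qed
  show ?thesis by (intro exI[of _ c]) (simp add: cylinder_iff_nth c)
qed

text \<open>The set \<open>H\<close> below codes the analytic set of all sequences which span a member of the family;
  the last assumption is what remains of the separability of the duals.\<close>

locale dual_separable_family = dense_sequence e
  for e :: "nat \<Rightarrow> 'a::banach" +
  fixes M :: "'a set measure"
  assumes closed_member: "X \<in> space M \<Longrightarrow> closed X"
    and subspace_member: "X \<in> space M \<Longrightarrow> subspace X"
    and pred_hits: "open U \<Longrightarrow> Measurable.pred M (\<lambda>X. X \<inter> U \<noteq> {})"
    and analytic: "\<exists>H :: ((nat \<Rightarrow> real) \<times> (nat \<Rightarrow> 'a)) set. closed H \<and> snd ` H = {z. closed_span z \<in> space M}"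
    and no_separated_cantor_set: "X \<in> space M \<Longrightarrow> 0 < \<epsilon> \<Longrightarrow>
      \<not> (\<exists>c :: (nat \<Rightarrow> bool) \<Rightarrow> nat \<Rightarrow> bool. \<forall>\<alpha> \<beta>. \<alpha> \<noteq> \<beta> \<longrightarrow> far X \<epsilon> (c \<alpha>) (c \<beta>))"
begin

text \<open>In the dual norm of \<open>X\<close>, every functional outside
  \<open>branches (R X)\<close> is within \<open>\<epsilon>\<close> of one of countably many
  measurable choices. How \<open>R\<close> arose from derivatives is deliberately forgotten.\<close>

definition covered :: "real \<Rightarrow> ('a set \<Rightarrow> bool list set) \<Rightarrow> bool" where
  "covered \<epsilon> R \<longleftrightarrow> (\<exists>h :: nat \<Rightarrow> 'a set \<Rightarrow> nat \<Rightarrow> bool. (\<forall>n k. Measurable.pred M (\<lambda>X. h n X k)) \<and>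
     (\<forall>X\<in>space M. \<forall>c. c \<notin> branches (R X) \<longrightarrow> (\<exists>n. \<not> far X \<epsilon> c (h n X))))"

text \<open>A point outside the intersection is outside one \<open>R k\<close>, whose own choices
  cover it.\<close>

lemma covered_INT:
  fixes R :: "'k::countable \<Rightarrow> 'a set \<Rightarrow> bool list set"
  assumes "\<And>k. covered \<epsilon> (R k)"
  shows "covered \<epsilon> (\<lambda>X. \<Inter>k. R k X)"
proof -
  have "\<forall>k. \<exists>h :: nat \<Rightarrow> 'a set \<Rightarrow> nat \<Rightarrow> bool. (\<forall>n i. Measurable.pred M (\<lambda>X. h n X i)) \<and>
     (\<forall>X\<in>space M. \<forall>c. c \<notin> branches (R k X) \<longrightarrow> (\<exists>n. \<not> far X \<epsilon> c (h n X)))"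
    using assms unfolding covered_def by simp
  from choice[OF this] obtain h :: "'k \<Rightarrow> nat \<Rightarrow> 'a set \<Rightarrow> nat \<Rightarrow> bool" where
    h: "\<And>k n i. Measurable.pred M (\<lambda>X. h k n X i)"
      "\<And>k X c. X \<in> space M \<Longrightarrow> c \<notin> branches (R k X) \<Longrightarrow> \<exists>n. \<not> far X \<epsilon> c (h k n X)"
    by blast
  define h' where "h' n = (case from_nat n of (k, m) \<Rightarrow> h k m)" for n
  have "Measurable.pred M (\<lambda>X. h' n X i)" for n i
    unfolding h'_def by (simp add: h(1) split: prod.split)
  moreover have "\<exists>n. \<not> far X \<epsilon> c (h' n X)" if X: "X \<in> space M" and c: "c \<notin> branches (\<Inter>k. R k X)" for X c
  proof -
    obtain k where "c \<notin> branches (R k X)" using c by (auto simp: branches_def)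
    then obtain m where "\<not> far X \<epsilon> c (h k m X)" using h(2)[OF X] by blast
    then show ?thesis by (intro exI[of _ "to_nat (k, m)"]) (simp add: h'_def)
  qed
  ultimately show ?thesis unfolding covered_def by blast
qed

text \<open>The pair of far branches is rounded to a box. What remains is a countable union over
  boxes of conditions that cylinders meet \<open>branches (R X)\<close> and that \<open>X\<close>
  meets a ball.\<close>

lemma pred_derivative:
  assumes [measurable]: "\<And>s. Measurable.pred M (\<lambda>X. s \<in> R X)"
  shows "Measurable.pred M (\<lambda>X. s \<in> derivative \<epsilon> X (R X))"
proof -
  have eq: "s \<in> derivative \<epsilon> X (R X) \<longleftrightarrow> s \<in> R X \<and> (\<exists>t u l j. prefix s t \<and> prefix s u \<and> box_far \<epsilon> l j t u \<and>
      cylinder t \<inter> branches (R X) \<noteq> {} \<and> cylinder u \<inter> branches (R X) \<noteq> {} \<and>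
      X \<inter> ball (e l) (1 / real (Suc j)) \<noteq> {})" (is "_ \<longleftrightarrow> _ \<and> ?Q X") for X
  proof -
    have "(\<exists>c\<in>cylinder s \<inter> branches (R X). \<exists>d\<in>cylinder s \<inter> branches (R X). far X \<epsilon> c d) \<longleftrightarrow> ?Q X"
    proof
      assume "\<exists>c\<in>cylinder s \<inter> branches (R X). \<exists>d\<in>cylinder s \<inter> branches (R X). far X \<epsilon> c d"
      then obtain c d where c: "c \<in> cylinder s" "c \<in> branches (R X)"
        and d: "d \<in> cylinder s" "d \<in> branches (R X)" and far: "far X \<epsilon> c d" by blast
      obtain l j n where "length s \<le> n" "X \<inter> ball (e l) (1 / real (Suc j)) \<noteq> {}"
          "box_far \<epsilon> l j (initial c n) (initial d n)"
        using far_box[OF far] by blast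
      moreover from this have "prefix s (initial c n)" "prefix s (initial d n)"
        using c d by (simp_all add: in_cylinder_prefix_initial)
      moreover have "cylinder (initial c n) \<inter> branches (R X) \<noteq> {}" "cylinder (initial d n) \<inter> branches (R X) \<noteq> {}"
        using c(2) d(2) in_cylinder_initial by blast+
      ultimately show "?Q X" by meson
    next
      assume "?Q X"
      then obtain t u l j where tu: "prefix s t" "prefix s u" "box_far \<epsilon> l j t u"
        "cylinder t \<inter> branches (R X) \<noteq> {}" "cylinder u \<inter> branches (R X) \<noteq> {}"
        "X \<inter> ball (e l) (1 / real (Suc j)) \<noteq> {}" by blast
      then obtain c d where "c \<in> cylinder t" "c \<in> branches (R X)" "d \<in> cylinder u" "d \<in> branches (R X)" by blast
      moreover from this have "far X \<epsilon> c d" using box_farD tu(3,6) by blast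
      ultimately show "\<exists>c\<in>cylinder s \<inter> branches (R X). \<exists>d\<in>cylinder s \<inter> branches (R X). far X \<epsilon> c d"
        using cylinder_mono[OF tu(1)] cylinder_mono[OF tu(2)] by blast
    qed
    then show ?thesis by (simp add: derivative_def)
  qed
  note [measurable] = pred_meets_branches[where R = R, OF assms] pred_hits[OF open_ball]
  show ?thesis unfolding eq by measurable
qed

text \<open>A branch of \<open>R X\<close> that is newly removed lies in a cylinder in which no two
  branches of \<open>R X\<close> are far apart, so one selected branch per string covers all of
  them.\<close>

lemma covered_derivative:
  assumes R: "\<And>s. Measurable.pred M (\<lambda>X. s \<in> R X)" and cov: "covered \<epsilon> R"
  shows "covered \<epsilon> (\<lambda>X. derivative \<epsilon> X (R X))"
proof -
  obtain h :: "nat \<Rightarrow> 'a set \<Rightarrow> nat \<Rightarrow> bool" where h: "\<And>n k. Measurable.pred M (\<lambda>X. h n X k)"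
    "\<And>X c. X \<in> space M \<Longrightarrow> c \<notin> branches (R X) \<Longrightarrow> \<exists>n. \<not> far X \<epsilon> c (h n X)"
    using cov unfolding covered_def by blast
  obtain g :: "bool list \<Rightarrow> 'a set \<Rightarrow> nat \<Rightarrow> bool" where g: "\<And>s k. Measurable.pred M (\<lambda>X. g s X k)"
    "\<And>s X. cylinder s \<inter> branches (R X) \<noteq> {} \<Longrightarrow> g s X \<in> cylinder s \<inter> branches (R X)"
    using measurable_branch_selection[OF R] by metis
  define h' where "h' n = (case from_nat n of Inl m \<Rightarrow> h m | Inr s \<Rightarrow> g s)" for n
  have "Measurable.pred M (\<lambda>X. h' n X i)" for n i
    unfolding h'_def by (cases "from_nat n :: nat + bool list") (simp_all add: h(1) g(1))
  moreover have "\<exists>n. \<not> far X \<epsilon> c (h' n X)" if X: "X \<in> space M" and c: "c \<notin> branches (derivative \<epsilon> X (R X))" for X c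
  proof (cases "c \<in> branches (R X)")
    case False
    then obtain m where "\<not> far X \<epsilon> c (h m X)" using h(2)[OF X] by blast
    then show ?thesis by (intro exI[of _ "to_nat (Inl m :: nat + bool list)"]) (simp add: h'_def)
  next
    case True
    then obtain n where n: "initial c n \<notin> derivative \<epsilon> X (R X)" "initial c n \<in> R X"
      using c by (auto simp: branches_def)
    have "g (initial c n) X \<in> cylinder (initial c n) \<inter> branches (R X)"
      using True in_cylinder_initial by (intro g(2)) blast
    then have "\<not> far X \<epsilon> c (g (initial c n) X)"
      using n True in_cylinder_initial[of c n] unfolding derivative_def by blast
    then show ?thesis by (intro exI[of _ "to_nat (Inr (initial c n) :: nat + bool list)"]) (simp add: h'_def)
  qed
  ultimately show ?thesis unfolding covered_def by blast
qed

end

section \<open>Boundedness of the derivation process\<close>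

context dual_separable_family
begin

lemma ex_covering_sequence:
  assumes \<epsilon>: "0 < \<epsilon>"
  shows "\<exists>h :: nat \<Rightarrow> 'a set \<Rightarrow> nat \<Rightarrow> bool. (\<forall>n k. Measurable.pred M (\<lambda>X. h n X k)) \<and>
     (\<forall>X\<in>space M. \<forall>c. \<exists>n. \<not> far X \<epsilon> c (h n X))"
proof -
  obtain H :: "((nat \<Rightarrow> real) \<times> (nat \<Rightarrow> 'a)) set"
    where H: "closed H" "snd ` H = {z. closed_span z \<in> space M}"
    using analytic by blast
  obtain D :: "((nat \<Rightarrow> real) \<times> (nat \<Rightarrow> 'a)) set" where D: "countable D" "closure D = UNIV"
    using dense_parameters by blast
  define d where "d = from_nat_into D"
  have "D \<noteq> {}" using D(2) by auto
  then have d: "closure (range d) = UNIV" using D by (simp add: d_def range_from_nat_into)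

  text \<open>A pair of an open set \<open>W\<close> and a list \<open>us\<close> of cylinders is good if the iterated derivative
    eventually leaves one of the cylinders, uniformly for the parameters in \<open>W \<inter> H\<close>.\<close>
  define good where "good W us \<longleftrightarrow> (\<exists>R. (\<forall>s. Measurable.pred M (\<lambda>X. s \<in> R X)) \<and> covered \<epsilon> R \<and>
      (\<forall>w\<in>W \<inter> H. \<exists>u\<in>set us. cylinder u \<inter> branches (R (closed_span (snd w))) = {}))"
    for W :: "((nat \<Rightarrow> real) \<times> (nat \<Rightarrow> 'a)) set" and us
  \<comment> \<open>Each string gets two extensions, in places \<open>2 * k\<close> and
    \<open>2 * k + 1\<close>, that are far apart for all parameters in the ball. The lists double
    along a chain, so \<open>length us' \<le> Suc j\<close> makes the radii tend to 0; the closed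
    ball inside \<open>W\<close> gives nested closed sets.\<close>
  define child where "child W us i j us' \<longleftrightarrow>
      length us' = 2 * length us \<and> cball (d i) (1 / real (Suc j)) \<subseteq> W \<and> length us' \<le> Suc j \<and>
      (\<forall>k<length us. prefix (us ! k) (us' ! (2 * k)) \<and> prefix (us ! k) (us' ! (2 * k + 1)) \<and>
        (\<forall>w\<in>ball (d i) (1 / real (Suc j)). \<forall>c\<in>cylinder (us' ! (2 * k)). \<forall>c'\<in>cylinder (us' ! (2 * k + 1)).
           far (closed_span (snd w)) \<epsilon> c c'))"
    for W us i j us'

  have step: "\<exists>i j us'. child W us i j us' \<and> \<not> good (ball (d i) (1 / real (Suc j))) us'"
    if W: "open W" and bad: "\<not> good W us" for W us
  proof (rule ccontr)
    assume contr: "\<not> ?thesis"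
    \<comment> \<open>Every triple, a child or not, receives a covered family, the whole tree being
      the default. One intersection over the countable type of triples then handles all
      children.\<close>
    define \<Phi> where "\<Phi> k R \<longleftrightarrow> (\<forall>s. Measurable.pred M (\<lambda>X. s \<in> R X)) \<and> covered \<epsilon> R \<and>
        (\<forall>i j us'. k = (i, j, us') \<longrightarrow> child W us i j us' \<longrightarrow>
          (\<forall>w\<in>ball (d i) (1 / real (Suc j)) \<inter> H. \<exists>u\<in>set us'. cylinder u \<inter> branches (R (closed_span (snd w))) = {}))"
      for k :: "nat \<times> nat \<times> bool list list" and R
    have "\<exists>R. \<Phi> k R" for k
    proof -
      obtain i j us' where k: "k = (i, j, us')" by (cases k) auto
      show ?thesis
      proof (cases "child W us i j us'")
        case True
        then have "good (ball (d i) (1 / real (Suc j))) us'" using contr by blast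
        then show ?thesis using True unfolding good_def \<Phi>_def k by simp
      next
        case False
        have "covered \<epsilon> (\<lambda>X. UNIV)"
          unfolding covered_def by (intro exI[of _ "\<lambda>n X k. True"]) (simp add: branches_def)
        then show ?thesis using False unfolding \<Phi>_def k by (intro exI[of _ "\<lambda>X. UNIV"]) simp
      qed
    qed
    then have "\<forall>k. \<exists>R. \<Phi> k R" by (rule allI)
    from choice[OF this] obtain R :: "nat \<times> nat \<times> bool list list \<Rightarrow> 'a set \<Rightarrow> bool list set"
      where \<Phi>: "\<And>k. \<Phi> k (R k)" by (elim exE) (rule that, erule spec)
    have R: "Measurable.pred M (\<lambda>X. s \<in> R k X)" "covered \<epsilon> (R k)" for k s
      using \<Phi>[of k] unfolding \<Phi>_def by simp_all
    have R_child: "\<exists>u\<in>set us'. cylinder u \<inter> branches (R (i, j, us') (closed_span (snd w))) = {}"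
      if "child W us i j us'" "w \<in> ball (d i) (1 / real (Suc j))" "w \<in> H" for i j us' w
      using \<Phi>[of "(i, j, us')"] that unfolding \<Phi>_def by simp
    define R0 where "R0 X = (\<Inter>k. R k X)" for X
    have R0_pred: "Measurable.pred M (\<lambda>X. s \<in> R0 X)" for s
    proof -
      note [measurable] = R(1)
      have "s \<in> R0 X \<longleftrightarrow> (\<forall>k. s \<in> R k X)" for X by (simp add: R0_def)
      then show ?thesis by simp
    qed
    have cov: "covered \<epsilon> (\<lambda>X. derivative \<epsilon> X (R0 X))"
      using covered_INT[OF R(2)] by (intro covered_derivative R0_pred) (simp add: R0_def[abs_def])
    \<comment> \<open>The derivative of \<open>R0\<close> is covered, so badness of the pair yields
      one parameter at which it still meets all the cylinders. In each of them \<open>R0\<close>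
      then has two far branches, from which a child is built.\<close>
    have "\<not> (\<forall>w\<in>W \<inter> H. \<exists>u\<in>set us. cylinder u \<inter> branches (derivative \<epsilon> (closed_span (snd w)) (R0 (closed_span (snd w)))) = {})"
    proof
      assume *: "\<forall>w\<in>W \<inter> H. \<exists>u\<in>set us. cylinder u \<inter> branches (derivative \<epsilon> (closed_span (snd w)) (R0 (closed_span (snd w)))) = {}"
      have "good W us" unfolding good_def
        by (intro exI[of _ "\<lambda>X. derivative \<epsilon> X (R0 X)"] conjI allI pred_derivative R0_pred cov *)
      then show False using bad by blast
    qed
    then obtain w where w: "w \<in> W" "w \<in> H"
      and meets: "\<And>u. u \<in> set us \<Longrightarrow> cylinder u \<inter> branches (derivative \<epsilon> (closed_span (snd w)) (R0 (closed_span (snd w)))) \<noteq> {}"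
      by blast
    define X where "X = closed_span (snd w)"
    have "\<exists>c c'. c \<in> cylinder (us ! k) \<inter> branches (R0 X) \<and> c' \<in> cylinder (us ! k) \<inter> branches (R0 X) \<and> far X \<epsilon> c c'"
      if k: "k < length us" for k
    proof -
      obtain b where "b \<in> cylinder (us ! k)" "b \<in> branches (derivative \<epsilon> X (R0 X))"
        using meets[of "us ! k"] k by (auto simp: X_def)
      then have "us ! k \<in> derivative \<epsilon> X (R0 X)"
        unfolding cylinder_def branches_def by (metis (mono_tags) mem_Collect_eq)
      then show ?thesis unfolding derivative_def by blast
    qed
    then obtain c c' where c: "\<And>k. k < length us \<Longrightarrow> c k \<in> cylinder (us ! k)" "\<And>k. k < length us \<Longrightarrow> c k \<in> branches (R0 X)"
      and c': "\<And>k. k < length us \<Longrightarrow> c' k \<in> cylinder (us ! k)" "\<And>k. k < length us \<Longrightarrow> c' k \<in> branches (R0 X)"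
      and far: "\<And>k. k < length us \<Longrightarrow> far X \<epsilon> (c k) (c' k)"
      by (metis IntD1 IntD2)
    have "\<exists>T m. open T \<and> w \<in> T \<and> length (us ! k) \<le> m \<and>
        (\<forall>w'\<in>T. \<forall>b\<in>cylinder (initial (c k) m). \<forall>b'\<in>cylinder (initial (c' k) m). far (closed_span (snd w')) \<epsilon> b b')"
      if k: "k < length us" for k
    proof -
      obtain l j m where m: "length (us ! k) \<le> m" "X \<inter> ball (e l) (1 / real (Suc j)) \<noteq> {}"
        "box_far \<epsilon> l j (initial (c k) m) (initial (c' k) m)"
        using far_box[OF far[OF k]] by blast
      define T :: "((nat \<Rightarrow> real) \<times> (nat \<Rightarrow> 'a)) set" where "T = snd -` {z. closed_span z \<inter> ball (e l) (1 / real (Suc j)) \<noteq> {}}"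
      have "open T" unfolding T_def
        by (intro open_vimage open_closed_span_meets open_ball continuous_on_snd continuous_on_id)
      moreover have "w \<in> T" using m(2) by (simp add: T_def X_def)
      moreover have "far (closed_span (snd w')) \<epsilon> b b'" if "w' \<in> T"
        "b \<in> cylinder (initial (c k) m)" "b' \<in> cylinder (initial (c' k) m)" for w' b b'
        using that m(3) by (intro box_farD[of _ l j]) (auto simp: T_def)
      ultimately show ?thesis using m(1) by blast
    qed
    then obtain T m where T: "\<And>k. k < length us \<Longrightarrow> open (T k)" "\<And>k. k < length us \<Longrightarrow> w \<in> T k"
      and m: "\<And>k. k < length us \<Longrightarrow> length (us ! k) \<le> m k"
      and sep: "\<And>k w' b b'. k < length us \<Longrightarrow> w' \<in> T k \<Longrightarrow> b \<in> cylinder (initial (c k) (m k)) \<Longrightarrow>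
         b' \<in> cylinder (initial (c' k) (m k)) \<Longrightarrow> far (closed_span (snd w')) \<epsilon> b b'"
      by metis
    define us' where "us' = map (\<lambda>q. if even q then initial (c (q div 2)) (m (q div 2)) else initial (c' (q div 2)) (m (q div 2)))
        [0..<2 * length us]"
    have len': "length us' = 2 * length us" by (simp add: us'_def)
    have us'_nth: "us' ! (2 * k) = initial (c k) (m k)" "us' ! (2 * k + 1) = initial (c' k) (m k)" if "k < length us" for k
      using that by (auto simp: us'_def)
    have "open (W \<inter> (\<Inter>k<length us. T k))" using W T(1) by (intro open_Int open_INT) auto
    moreover have "w \<in> W \<inter> (\<Inter>k<length us. T k)" using w(1) T(2) by auto
    ultimately obtain r where r: "r > 0" "ball w r \<subseteq> W \<inter> (\<Inter>k<length us. T k)"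
      unfolding open_contains_ball by blast
    obtain j0 where j0: "1 / real (Suc j0) < r / 2" using r(1) nat_approx_posE half_gt_zero by metis
    define j where "j = max j0 (length us')"
    have j: "1 / real (Suc j) < r / 2"
    proof -
      have "1 / real (Suc j) \<le> 1 / real (Suc j0)" by (simp add: j_def frac_le)
      then show ?thesis using j0 by linarith
    qed
    have "w \<in> closure (range d)" by (simp add: d)
    then obtain i where i: "dist (d i) w < 1 / real (Suc j)"
      unfolding closure_approachable by (metis rangeE of_nat_0_less_iff zero_less_Suc zero_less_divide_1_iff)
    have sub: "cball (d i) (1 / real (Suc j)) \<subseteq> ball w r"
    proof
      fix y assume "y \<in> cball (d i) (1 / real (Suc j))"
      then show "y \<in> ball w r"
        using i j dist_triangle[of w y "d i"] by (simp add: dist_commute del: of_nat_Suc)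
    qed
    have "child W us i j us'"
      unfolding child_def
    proof (intro conjI allI impI ballI)
      show "length us' = 2 * length us" by (rule len')
      show "cball (d i) (1 / real (Suc j)) \<subseteq> W" using sub r(2) by blast
      show "length us' \<le> Suc j" by (simp add: j_def)
      fix k assume k: "k < length us"
      show "prefix (us ! k) (us' ! (2 * k))" "prefix (us ! k) (us' ! (2 * k + 1))"
        using c(1)[OF k] c'(1)[OF k] m[OF k] unfolding us'_nth[OF k] by (simp_all add: in_cylinder_prefix_initial)
      fix w' b b' assume w': "w' \<in> ball (d i) (1 / real (Suc j))"
        and b: "b \<in> cylinder (us' ! (2 * k))" "b' \<in> cylinder (us' ! (2 * k + 1))"
      have "w' \<in> T k" using w' sub r(2) k ball_subset_cball[of "d i" "1 / real (Suc j)"] by blast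
      then show "far (closed_span (snd w')) \<epsilon> b b'"
        using b k unfolding us'_nth[OF k] by (intro sep)
    qed
    moreover have "w \<in> ball (d i) (1 / real (Suc j))" using i by simp
    \<comment> \<open>The contradiction: the family assigned to this child leaves one of its
      cylinders, although each contains a branch \<open>c k\<close> or \<open>c' k\<close> of the
      smaller tree \<open>R0 X\<close>.\<close>
    ultimately obtain u where u: "u \<in> set us'" "cylinder u \<inter> branches (R (i, j, us') X) = {}"
      using R_child[of i j us' w] w(2) unfolding X_def by blast
    have "branches (R0 X) \<subseteq> branches (R (i, j, us') X)" by (auto simp: branches_def R0_def)
    moreover obtain q where q: "q < 2 * length us" "u = us' ! q"
      using u(1) by (auto simp: in_set_conv_nth len')
    then have "q div 2 < length us" by simp
    then have "\<exists>b. b \<in> cylinder u \<inter> branches (R0 X)"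
      using q c(2)[of "q div 2"] c'(2)[of "q div 2"] by (auto simp: us'_def intro: in_cylinder_initial)
    ultimately show False using u(2) by blast
  qed

  \<comment> \<open>The root: all parameters and a single cylinder, the whole Cantor set.\<close>
  have "good UNIV [[]]"
  proof (rule ccontr)
    assume bad: "\<not> good UNIV [[]]"
    define Q where "Q n C C' \<longleftrightarrow> (\<exists>i j. child (fst C) (snd C) i j (snd C') \<and> fst C' = ball (d i) (1 / real (Suc j)))"
      for n :: nat and C C' :: "((nat \<Rightarrow> real) \<times> (nat \<Rightarrow> 'a)) set \<times> bool list list"
    have "\<exists>f. \<forall>n. (open (fst (f n)) \<and> \<not> good (fst (f n)) (snd (f n)) \<and> (n = 0 \<longrightarrow> f n = (UNIV, [[]]))) \<and> Q n (f n) (f (Suc n))"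
    proof (rule dependent_nat_choice)
      show "\<exists>C. open (fst C) \<and> \<not> good (fst C) (snd C) \<and> ((0::nat) = 0 \<longrightarrow> C = (UNIV, [[]]))"
        using bad by (intro exI[of _ "(UNIV, [[]])"]) simp
      fix C and n :: nat
      assume "open (fst C) \<and> \<not> good (fst C) (snd C) \<and> (n = 0 \<longrightarrow> C = (UNIV, [[]]))"
      then obtain i j us' where "child (fst C) (snd C) i j us'" "\<not> good (ball (d i) (1 / real (Suc j))) us'"
        using step[of "fst C" "snd C"] by blast
      then show "\<exists>C'. (open (fst C') \<and> \<not> good (fst C') (snd C') \<and> (Suc n = 0 \<longrightarrow> C' = (UNIV, [[]]))) \<and> Q n C C'"
        unfolding Q_def by (intro exI[of _ "(ball (d i) (1 / real (Suc j)), us')"]) auto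
    qed
    then obtain f where f: "\<And>n. \<not> good (fst (f n)) (snd (f n))" "f 0 = (UNIV, [[]])" "\<And>n. Q n (f n) (f (Suc n))"
      by blast
    define W where "W n = fst (f n)" for n
    define us where "us n = snd (f n)" for n
    obtain I J where IJ: "\<And>n. child (W n) (us n) (I n) (J n) (us (Suc n))"
      "\<And>n. W (Suc n) = ball (d (I n)) (1 / real (Suc (J n)))"
      using f(3) unfolding Q_def W_def us_def by metis
    have len: "length (us n) = 2 ^ n" for n
    proof (induction n)
      case (Suc n)
      then show ?case using IJ(1)[of n] by (simp add: child_def)
    qed (simp add: us_def f)
    define C where "C n = cball (d (I n)) (1 / real (Suc (J n)))" for n
    have C_sub: "C n \<subseteq> W n" and W_sub: "W (Suc n) \<subseteq> C n" for n
      using IJ(1)[of n] by (auto simp: child_def C_def IJ(2))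
    have C_small: "dist x y \<le> 2 * (1/2) ^ n" if x: "x \<in> C n" and y: "y \<in> C n" for x y n
    proof -
      have "2 ^ Suc n \<le> Suc (J n)" using IJ(1)[of n] len[of "Suc n"] by (simp add: child_def)
      then have "(2::real) ^ Suc n \<le> real (Suc (J n))" by (metis of_nat_le_iff of_nat_numeral of_nat_power)
      then have "1 / real (Suc (J n)) \<le> 1 / 2 ^ Suc n" by (intro divide_left_mono) auto
      also have "\<dots> = (1/2) ^ Suc n" by (simp add: power_one_over)
      finally have J: "1 / real (Suc (J n)) \<le> (1/2) ^ Suc n" .
      have "dist x y \<le> dist (d (I n)) x + dist (d (I n)) y" by (rule dist_triangle3)
      also have "\<dots> \<le> (1/2) ^ Suc n + (1/2) ^ Suc n"
        using x y J unfolding C_def mem_cball by (intro add_mono) linarith+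
      also have "\<dots> \<le> 2 * (1/2) ^ n" by simp
      finally show ?thesis .
    qed
    have C_mono: "C n \<subseteq> C m" if "m \<le> n" for m n
      using that by (induction rule: dec_induct) (use C_sub W_sub in blast)+
    obtain a where a: "\<And>n. a \<in> C n"
    proof (rule decreasing_closed_nest[of C])
      show "closed (C n)" for n by (simp add: C_def)
      show "C n \<noteq> {}" for n by (simp add: C_def)
      show "m \<le> n \<Longrightarrow> C n \<subseteq> C m" for m n by (rule C_mono)
      show "\<exists>n. \<forall>x\<in>C n. \<forall>y\<in>C n. dist x y < r" if r: "0 < r" for r
      proof -
        obtain n where "(1/2) ^ n < r / 2" using real_arch_pow_inv[of "r / 2" "1/2"] r by auto
        then have "2 * (1/2) ^ n < r" by simp
        then show ?thesis using C_small le_less_trans by blast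
      qed
    qed blast
    \<comment> \<open>A set of parameters disjoint from \<open>H\<close> is vacuously good, so every
      bad set in the chain meets \<open>H\<close>. As the balls shrink to \<open>a\<close> and
      \<open>H\<close> is closed, the limit stays in \<open>H\<close>.\<close>
    have "a \<in> H"
    proof (rule ccontr)
      assume "a \<notin> H"
      then obtain r where r: "r > 0" "ball a r \<subseteq> - H"
        using H(1) by (metis open_Compl open_contains_ball ComplI)
      obtain n where "(1/2) ^ n < r / 2" using real_arch_pow_inv[of "r / 2" "1/2"] r by auto
      then have n: "2 * (1/2) ^ n < r" by simp
      have "W (Suc n) \<inter> H \<noteq> {}"
      proof
        assume "W (Suc n) \<inter> H = {}"
        moreover have "covered \<epsilon> (\<lambda>X. UNIV)"
          unfolding covered_def by (intro exI[of _ "\<lambda>n X k. True"]) (simp add: branches_def)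
        ultimately have "good (W (Suc n)) (us (Suc n))"
          unfolding good_def by (intro exI[of _ "\<lambda>X. UNIV"]) simp
        then show False using f(1) by (simp add: W_def us_def)
      qed
      then obtain y where y: "y \<in> C n" "y \<in> H" using W_sub by blast
      then have "dist a y < r" using C_small[OF a y(1)] n by linarith
      then show False using r(2) y(2) by auto
    qed
    define X where "X = closed_span (snd a)"
    have X: "X \<in> space M" using \<open>a \<in> H\<close> H(2) unfolding X_def by blast
    \<comment> \<open>The position in \<open>us n\<close> reached along \<open>\<alpha>\<close>: its
      first \<open>n\<close> digits read as a binary number, most significant digit first.\<close>
    define idx :: "(nat \<Rightarrow> bool) \<Rightarrow> nat \<Rightarrow> nat"
      where "idx \<alpha> = rec_nat 0 (\<lambda>n q. 2 * q + (if \<alpha> n then 1 else 0))" for \<alpha>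
    have idx0: "idx \<alpha> 0 = 0" and idxS: "idx \<alpha> (Suc n) = 2 * idx \<alpha> n + (if \<alpha> n then 1 else 0)" for \<alpha> n
      by (simp_all add: idx_def)
    have idx_less: "idx \<alpha> n < length (us n)" for \<alpha> n
      unfolding len by (induction n) (auto simp: idx0 idxS)
    have "prefix (us n ! idx \<alpha> n) (us (Suc n) ! idx \<alpha> (Suc n))" for \<alpha> n
      using IJ(1)[of n] idx_less[of \<alpha> n] by (auto simp: child_def idxS)
    then have "\<exists>c. \<forall>n. c \<in> cylinder (us n ! idx \<alpha> n)" for \<alpha>
      by (rule ex_cylinder_chain)
    then obtain c where c: "\<And>\<alpha> n. c \<alpha> \<in> cylinder (us n ! idx \<alpha> n)" by metis
    \<comment> \<open>At the first difference of \<open>\<alpha>\<close> and \<open>\<beta>\<close>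
      the two paths enter the two extensions of one string, which were chosen far apart for all
      parameters near \<open>a\<close>.\<close>
    have far: "far X \<epsilon> (c \<alpha>) (c \<beta>)" if n: "\<And>m. m < n \<Longrightarrow> \<alpha> m = \<beta> m" "\<not> \<alpha> n" "\<beta> n" for \<alpha> \<beta> n
    proof -
      have "idx \<alpha> m = idx \<beta> m" if "m \<le> n" for m
        using that n(1) by (induction m) (auto simp: idx0 idxS)
      then have eq: "idx \<beta> n = idx \<alpha> n" by simp
      have "a \<in> ball (d (I n)) (1 / real (Suc (J n)))"
        using a[of "Suc n"] C_sub[of "Suc n"] IJ(2)[of n] by blast
      moreover have "c \<alpha> \<in> cylinder (us (Suc n) ! (2 * idx \<alpha> n))" "c \<beta> \<in> cylinder (us (Suc n) ! (2 * idx \<alpha> n + 1))"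
        using c[of \<alpha> "Suc n"] c[of \<beta> "Suc n"] n(2,3) by (simp_all add: idxS eq)
      ultimately show ?thesis
        using IJ(1)[of n] idx_less[of \<alpha> n] unfolding child_def X_def by blast
    qed
    have "far X \<epsilon> (c \<alpha>) (c \<beta>)" if "\<alpha> \<noteq> \<beta>" for \<alpha> \<beta>
    proof -
      define n where "n = (LEAST n. \<alpha> n \<noteq> \<beta> n)"
      have "\<exists>n. \<alpha> n \<noteq> \<beta> n" using that by blast
      then have "\<alpha> n \<noteq> \<beta> n" unfolding n_def by (rule LeastI_ex)
      moreover have "\<alpha> m = \<beta> m" if "m < n" for m using that not_less_Least unfolding n_def by blast
      ultimately show ?thesis
        using far[of n \<alpha> \<beta>] far[of n \<beta> \<alpha>] far_sym by (cases "\<alpha> n") auto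
    qed
    then show False using no_separated_cantor_set[OF X \<epsilon>] by blast
  qed
  then obtain R where R: "covered \<epsilon> R" "\<And>w. w \<in> H \<Longrightarrow> branches (R (closed_span (snd w))) = {}"
    unfolding good_def by auto
  \<comment> \<open>For the list \<open>[[]]\<close>, goodness says that nothing is left. This holds
    at all parameters in \<open>H\<close>, hence for all members, each being a closed span.\<close>
  have "branches (R X) = {}" if X: "X \<in> space M" for X
  proof -
    obtain z where z: "closed_span z = X"
      using ex_closed_span[OF closed_member[OF X] subspace_member[OF X]] by blast
    then have "z \<in> snd ` H" using H(2) X by simp
    then show ?thesis using R(2) z by auto
  qed
  then show ?thesis using R(1) unfolding covered_def by simp
qed

end

section \<open>Embedding the duals into the continuous functions on the Cantor set\<close>

text \<open>The library proves completeness of \<open>bcontfun\<close> only over metric domains. With this metric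
  on \<open>bool\<close>, the type \<open>C_cantor\<close> becomes an instance of \<open>banach\<close>.\<close>

instantiation bool :: metric_space
begin

definition dist_bool :: "bool \<Rightarrow> bool \<Rightarrow> real" where
  "dist_bool x y = of_bool (x \<noteq> y)"

definition uniformity_bool :: "(bool \<times> bool) filter" where
  "uniformity_bool = (INF e\<in>{0<..}. principal {(x, y). dist x y < e})"

instance
proof
  fix U :: "bool set"
  have "\<forall>\<^sub>F (x', y) in uniformity. x' = x \<longrightarrow> y \<in> U" if "x \<in> U" for x
  proof -
    have "\<forall>\<^sub>F (x', y) in principal {(x, y). dist x y < (1::real)}. x' = x \<longrightarrow> y \<in> U"
      using that by (auto simp: eventually_principal dist_bool_def)
    moreover have "(uniformity :: (bool \<times> bool) filter) \<le> principal {(x, y). dist x y < 1}"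
      unfolding uniformity_bool_def by (rule INF_lower) simp
    ultimately show ?thesis by (meson filter_leD)
  qed
  then show "open U \<longleftrightarrow> (\<forall>x\<in>U. \<forall>\<^sub>F (x', y) in uniformity. x' = x \<longrightarrow> y \<in> U)"
    by (simp add: open_discrete)
qed (auto simp: dist_bool_def uniformity_bool_def)

end

instance bcontfun :: (metric_space, banach) banach ..

text \<open>The open set \<open>{t. g t < r}\<close> is a union of cylinders, of which there are
  countably many, and lying in a cylinder is a condition on finitely many digits.\<close>

lemma borel_measurable_continuous_cantor:
  fixes g :: "(nat \<Rightarrow> bool) \<Rightarrow> real"
  assumes g: "continuous_on UNIV g" and h: "\<And>k. Measurable.pred M (\<lambda>X. h X k)"
  shows "(\<lambda>X. g (h X)) \<in> borel_measurable M"
  unfolding borel_measurable_iff_less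
proof
  fix r
  note [measurable] = h
  have "open {t. g t < r}" using g by (intro open_Collect_less continuous_on_const)
  then have "\<exists>n. cylinder (initial t n) \<subseteq> {t. g t < r}" if "g t < r" for t
    using that unfolding open_cantor_iff by blast
  then have eq: "g (h X) < r \<longleftrightarrow> (\<exists>s. cylinder s \<subseteq> {t. g t < r} \<and> (\<forall>i<length s. h X i = s ! i))" for X
    unfolding cylinder_iff_nth[symmetric] using in_cylinder_initial by blast
  show "{X \<in> space M. g (h X) < r} \<in> sets M"
    unfolding eq by measurable
qed

text \<open>The functionals live on the whole space, so that measurability in \<open>X\<close> makes
  sense at a fixed \<open>x\<close>; only their restrictions to \<open>X\<close> are dense in the
  dual. The bounds \<open>a\<close> are independent of \<open>X\<close>, hence one coding serves all
  members.\<close>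

locale functional_family = dense_sequence e
  for e :: "nat \<Rightarrow> 'a::real_normed_vector" +
  fixes M :: "'a set measure" and f :: "nat \<Rightarrow> 'a set \<Rightarrow> 'a \<Rightarrow> real" and a :: "nat \<Rightarrow> real"
  assumes subspace_member: "X \<in> space M \<Longrightarrow> subspace X"
    and pred_hits: "open U \<Longrightarrow> Measurable.pred M (\<lambda>X. X \<inter> U \<noteq> {})"
    and linear_f: "linear (f n X)"
    and a_nonneg: "0 \<le> a n"
    and f_bound: "\<bar>f n X x\<bar> \<le> a n * norm x"
    and f_measurable: "(\<lambda>X. f n X x) \<in> borel_measurable M"
    and f_dense: "X \<in> space M \<Longrightarrow> \<phi> \<in> dual_space X \<Longrightarrow> 0 < \<delta> \<Longrightarrow> \<exists>n. \<forall>x\<in>X. \<bar>\<phi> x - f n X x\<bar> \<le> \<delta> * norm x"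
begin

text \<open>The open ball is used so that approximation by a point of it can be tested by
  \<open>X\<close> meeting small balls contained in it.\<close>

definition coordinates :: "'a set \<Rightarrow> (nat \<Rightarrow> real) set" where
  "coordinates X = {(\<lambda>i. f i X x) | x. x \<in> X \<and> norm x < 1}"

lemma value_bound:
  assumes "norm x < 1"
  shows "\<bar>f i X x\<bar> \<le> a i"
  using f_bound[of i X x] mult_left_le[of "norm x" "a i"] assms a_nonneg[of i] by linarith

text \<open>The points of the Cantor set parametrise the unit ball of the bidual of \<open>X\<close>, which is the
  closure of the coordinate sequences \<open>coordinates X\<close>; the dual is embedded by evaluation.\<close>

definition evaluation :: "nat \<Rightarrow> 'a set \<Rightarrow> C_cantor" where
  "evaluation n X = Bcontfun (\<lambda>t. parametrization a (coordinates X) t n)"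

lemma apply_evaluation: "apply_bcontfun (evaluation n X) t = parametrization a (coordinates X) t n"
proof -
  have "(\<lambda>t. parametrization a (coordinates X) t n) \<in> bcontfun"
    using parametrization_bound
    by (intro bcontfun_normI[of _ "2 * \<bar>a n\<bar>"] continuous_on_parametrization) simp
  then show ?thesis unfolding evaluation_def by (simp add: Bcontfun_inverse)
qed

text \<open>This makes the evaluations isometric: every value of the parametrization is approximated
  by points of the unit ball of \<open>X\<close>, and every such point is attained.\<close>

lemma norm_evaluation_le_iff:
  assumes X: "X \<in> space M" and K: "0 \<le> K"
  shows "norm (\<alpha> *\<^sub>R evaluation n X + \<beta> *\<^sub>R evaluation m X - evaluation k X) \<le> K \<longleftrightarrow>
    (\<forall>x\<in>X. \<bar>\<alpha> * f n X x + \<beta> * f m X x - f k X x\<bar> \<le> K * norm x)" (is "norm ?v \<le> K \<longleftrightarrow> _")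
proof
  have v: "apply_bcontfun ?v t = \<alpha> * parametrization a (coordinates X) t n +
      \<beta> * parametrization a (coordinates X) t m - parametrization a (coordinates X) t k" for t
    by (simp add: apply_evaluation)
  show "norm ?v \<le> K" if *: "\<forall>x\<in>X. \<bar>\<alpha> * f n X x + \<beta> * f m X x - f k X x\<bar> \<le> K * norm x"
  proof (rule norm_bound)
    fix t
    show "norm (apply_bcontfun ?v t) \<le> K"
    proof (rule field_le_epsilon)
      fix \<epsilon> :: real assume \<epsilon>: "0 < \<epsilon>"
      define C where "C = \<bar>\<alpha>\<bar> + \<bar>\<beta>\<bar> + 1"
      have C: "C > 0" by (simp add: C_def)
      have zero: "(\<lambda>i. f i X 0) \<in> coordinates X"
        using subspace_0[OF subspace_member[OF X]] unfolding coordinates_def by (intro CollectI exI[of _ 0]) simp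
      obtain b where b: "b \<in> coordinates X"
        "\<And>i. i < Suc (max n (max m k)) \<Longrightarrow> \<bar>b i - parametrization a (coordinates X) t i\<bar> < \<epsilon> / C"
        using parametrization_approx[OF zero, of a "\<epsilon> / C" "Suc (max n (max m k))" t] value_bound[of 0] \<epsilon> C
        by auto
      obtain x where x: "x \<in> X" "norm x < 1" "b = (\<lambda>i. f i X x)"
        using b(1) by (auto simp: coordinates_def)
      let ?p = "parametrization a (coordinates X) t"
      have bn: "\<bar>b n - ?p n\<bar> \<le> \<epsilon> / C" and bm: "\<bar>b m - ?p m\<bar> \<le> \<epsilon> / C" and bk: "\<bar>b k - ?p k\<bar> \<le> \<epsilon> / C"
        by (auto intro!: less_imp_le[OF b(2)] simp: less_Suc_eq_le)
      have "\<bar>\<alpha> * ?p n + \<beta> * ?p m - ?p k\<bar>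
          \<le> \<bar>\<alpha> * b n + \<beta> * b m - b k\<bar> + (\<bar>\<alpha> * (b n - ?p n)\<bar> + \<bar>\<beta> * (b m - ?p m)\<bar> + \<bar>b k - ?p k\<bar>)"
        unfolding right_diff_distrib by linarith
      also have "\<dots> \<le> K + (\<bar>\<alpha>\<bar> * (\<epsilon> / C) + \<bar>\<beta>\<bar> * (\<epsilon> / C) + \<epsilon> / C)"
      proof -
        have "\<bar>\<alpha> * b n + \<beta> * b m - b k\<bar> \<le> K * norm x" using * x(1,3) by simp
        also have "\<dots> \<le> K" using x(2) K by (intro mult_left_le) auto
        finally show ?thesis
          unfolding abs_mult by (intro add_mono mult_left_mono bn bm bk) auto
      qed
      also have "\<bar>\<alpha>\<bar> * (\<epsilon> / C) + \<bar>\<beta>\<bar> * (\<epsilon> / C) + \<epsilon> / C = C * (\<epsilon> / C)"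
        by (simp add: C_def distrib_right add_divide_distrib)
      finally show "norm (apply_bcontfun ?v t) \<le> K + \<epsilon>"
        unfolding v using C by simp
    qed
  qed
  show "\<forall>x\<in>X. \<bar>\<alpha> * f n X x + \<beta> * f m X x - f k X x\<bar> \<le> K * norm x" if *: "norm ?v \<le> K"
  proof
    fix x assume x: "x \<in> X"
    \<comment> \<open>As only the open ball is parametrised, \<open>x\<close> is divided by some
      \<open>r\<close> larger than its norm, which is let decrease to the norm afterwards.\<close>
    have scaled: "\<bar>\<alpha> * f n X x + \<beta> * f m X x - f k X x\<bar> \<le> K * r" if r: "norm x < r" for r
    proof -
      have r0: "r > 0" using r norm_ge_zero[of x] by linarith
      define y where "y = (1 / r) *\<^sub>R x"
      have y: "y \<in> X" "norm y < 1"
        using x r r0 subspace_scale[OF subspace_member[OF X]] by (auto simp: y_def)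
      have fy: "f i X y = f i X x / r" for i
        using linear_f by (simp add: y_def linear_cmul)
      have "(\<lambda>i. f i X y) \<in> coordinates X" using y by (auto simp: coordinates_def)
      then obtain t where t: "parametrization a (coordinates X) t = (\<lambda>i. f i X y)"
        using parametrization_surj[of "\<lambda>i. f i X y" "coordinates X" a] value_bound[OF y(2)] by blast
      have "\<bar>apply_bcontfun ?v t\<bar> \<le> K" using norm_bounded[of ?v t] * by simp
      then have "\<bar>(\<alpha> * f n X x + \<beta> * f m X x - f k X x) / r\<bar> \<le> K"
        unfolding v t fy by (simp add: add_divide_distrib diff_divide_distrib)
      then show ?thesis using r0 by (simp add: abs_divide pos_divide_le_eq)
    qed
    show "\<bar>\<alpha> * f n X x + \<beta> * f m X x - f k X x\<bar> \<le> K * norm x"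
    proof (rule field_le_epsilon)
      fix \<epsilon> :: real assume \<epsilon>: "0 < \<epsilon>"
      have "K * (\<epsilon> / (K + 1)) \<le> (K + 1) * (\<epsilon> / (K + 1))"
        using \<epsilon> K by (intro mult_right_mono) auto
      also have "\<dots> = \<epsilon>" using K by simp
      finally show "\<bar>\<alpha> * f n X x + \<beta> * f m X x - f k X x\<bar> \<le> K * norm x + \<epsilon>"
        using scaled[of "norm x + \<epsilon> / (K + 1)"] \<epsilon> K by (simp add: distrib_left add_pos_nonneg)
    qed
  qed
qed

text \<open>The point of \<open>X\<close> is replaced by a center \<open>e l\<close> whose ball
  meets \<open>X\<close>; the Lipschitz constants \<open>a i\<close> control the change of the
  values, so \<open>f i X\<close> is needed at countably many fixed points only.\<close>

lemma pred_coordinates_near: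
  "Measurable.pred M (\<lambda>X. \<exists>b\<in>coordinates X. \<forall>i<k. \<bar>b i - y i\<bar> < \<delta>)"
proof -
  have eq: "(\<exists>b\<in>coordinates X. \<forall>i<k. \<bar>b i - y i\<bar> < \<delta>) \<longleftrightarrow>
      (\<exists>l j. X \<inter> ball (e l) (1 / real (Suc j)) \<noteq> {} \<and> norm (e l) + 1 / real (Suc j) \<le> 1 \<and>
        (\<forall>i<k. \<bar>f i X (e l) - y i\<bar> + a i * (1 / real (Suc j)) < \<delta>))" (is "?L X \<longleftrightarrow> ?R X") for X
  proof
    assume "?L X"
    then obtain x where x: "x \<in> X" "norm x < 1" "\<And>i. i < k \<Longrightarrow> \<bar>f i X x - y i\<bar> < \<delta>"
      by (auto simp: coordinates_def)
    have inv0: "(\<lambda>j. 1 / real (Suc j)) \<longlonglongrightarrow> 0" by (rule LIMSEQ_Suc[OF lim_1_over_n])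
    \<comment> \<open>Room is needed for two errors: one for passing from \<open>x\<close> to
      \<open>e l\<close>, one for the radius of the ball around \<open>e l\<close>.\<close>
    have lim1: "(\<lambda>j. norm x + 2 * (1 / real (Suc j))) \<longlonglongrightarrow> norm x + 2 * 0"
      by (intro tendsto_intros inv0)
    have lim2: "(\<lambda>j. \<bar>f i X x - y i\<bar> + a i * (1 / real (Suc j)) + a i * (1 / real (Suc j)))
        \<longlonglongrightarrow> \<bar>f i X x - y i\<bar> + a i * 0 + a i * 0" for i
      by (intro tendsto_intros inv0)
    have "\<forall>\<^sub>F j in sequentially. norm x + 2 * (1 / real (Suc j)) < 1"
      using order_tendstoD(2)[OF lim1, of 1] x(2) by simp
    moreover have "\<forall>\<^sub>F j in sequentially. \<forall>i\<in>{..<k}. \<bar>f i X x - y i\<bar> + a i * (1 / real (Suc j)) + a i * (1 / real (Suc j)) < \<delta>"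
    proof (rule eventually_ball_finite)
      show "\<forall>i\<in>{..<k}. \<forall>\<^sub>F j in sequentially. \<bar>f i X x - y i\<bar> + a i * (1 / real (Suc j)) + a i * (1 / real (Suc j)) < \<delta>"
        using order_tendstoD(2)[OF lim2] x(3) by simp
    qed simp
    ultimately have "\<forall>\<^sub>F j in sequentially. norm x + 2 * (1 / real (Suc j)) < 1 \<and>
        (\<forall>i\<in>{..<k}. \<bar>f i X x - y i\<bar> + a i * (1 / real (Suc j)) + a i * (1 / real (Suc j)) < \<delta>)"
      by (rule eventually_conj)
    from eventually_happens'[OF sequentially_bot this] obtain j where
      J: "norm x + 2 * (1 / real (Suc j)) < 1 \<and>
        (\<forall>i\<in>{..<k}. \<bar>f i X x - y i\<bar> + a i * (1 / real (Suc j)) + a i * (1 / real (Suc j)) < \<delta>)"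
      by (rule exE)
    have j: "\<bar>f i X x - y i\<bar> + a i * (1 / real (Suc j)) + a i * (1 / real (Suc j)) < \<delta>" if "i < k" for i
      using J that by simp
    have j1: "norm x + 2 * (1 / real (Suc j)) < 1" using J by (rule conjunct1)
    obtain l where l: "norm (x - e l) < 1 / real (Suc j)" by (rule dense_approx[of "1 / real (Suc j)" x]) simp
    have "norm (e l) \<le> norm x + norm (x - e l)" by (metis norm_minus_commute norm_triangle_sub)
    then have "norm (e l) + 1 / real (Suc j) \<le> 1" using j1 l by linarith
    moreover have "\<bar>f i X (e l) - y i\<bar> + a i * (1 / real (Suc j)) < \<delta>" if i: "i < k" for i
    proof -
      have "f i X (x - e l) = f i X x - f i X (e l)" using linear_f by (rule linear_diff)
      moreover have "\<bar>f i X (x - e l)\<bar> \<le> a i * (1 / real (Suc j))"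
        using f_bound[of i X "x - e l"] mult_left_mono[OF less_imp_le[OF l] a_nonneg[of i]] by linarith
      ultimately show ?thesis using j[OF i] by linarith
    qed
    moreover have "X \<inter> ball (e l) (1 / real (Suc j)) \<noteq> {}"
      using x(1) l by (auto simp: dist_norm norm_minus_commute)
    ultimately show "?R X" by (intro exI[of _ l] exI[of _ j] conjI allI impI)
  next
    assume "?R X"
    then obtain l j where ne: "X \<inter> ball (e l) (1 / real (Suc j)) \<noteq> {}" and l: "norm (e l) + 1 / real (Suc j) \<le> 1"
      and near: "\<And>i. i < k \<Longrightarrow> \<bar>f i X (e l) - y i\<bar> + a i * (1 / real (Suc j)) < \<delta>" by (elim exE conjE) simp
    from ne obtain x where x: "x \<in> X" "x \<in> ball (e l) (1 / real (Suc j))" by blast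
    have lx: "norm (x - e l) < 1 / real (Suc j)" using x(2) by (simp add: dist_norm norm_minus_commute)
    then have "norm x < 1" using l norm_triangle_sub[of x "e l"] by linarith
    moreover have "\<bar>f i X x - y i\<bar> < \<delta>" if i: "i < k" for i
    proof -
      have "f i X (x - e l) = f i X x - f i X (e l)" using linear_f by (rule linear_diff)
      moreover have "\<bar>f i X (x - e l)\<bar> \<le> a i * (1 / real (Suc j))"
        using f_bound[of i X "x - e l"] mult_left_mono[OF less_imp_le[OF lx] a_nonneg[of i]] by linarith
      ultimately show ?thesis using near[OF i] by linarith
    qed
    moreover have "norm x < 1 \<Longrightarrow> (\<lambda>i. f i X x) \<in> coordinates X" using x(1) by (auto simp: coordinates_def)
    ultimately show "?L X" by (intro bexI[of _ "\<lambda>i. f i X x"]) simp_all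
  qed
  note [measurable] = f_measurable pred_hits[OF open_ball]
  show ?thesis unfolding eq by measurable
qed

lemma evaluation_measurable: "(\<lambda>X. apply_bcontfun (evaluation n X) t) \<in> borel_measurable M"
proof -
  have "Measurable.pred M (\<lambda>X. s \<in> code_tree a (coordinates X))" for s
  proof -
    note [measurable] = pred_coordinates_near
    show ?thesis unfolding code_tree_def mem_Collect_eq by measurable
  qed
  then have "Measurable.pred M (\<lambda>X. greedy (code_tree a (coordinates X)) t k)" for k
    by (rule pred_greedy)
  then show ?thesis
    unfolding apply_evaluation parametrization_def
    by (intro borel_measurable_continuous_cantor continuous_on_decode)
qed

text \<open>The closure of a sequence, not of its span: hitting an open set is then a condition on
  single evaluations. It is a subspace nevertheless, because the functionals are dense in the
  dual.\<close>

definition bullet :: "'a set \<Rightarrow> C_cantor set" where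
  "bullet X = closure (range (\<lambda>n. evaluation n X))"

definition pairing :: "'a set \<Rightarrow> C_cantor \<Rightarrow> 'a \<Rightarrow> real" where
  "pairing X g x = extend (\<lambda>n. evaluation n X) (\<lambda>n. f n X x) g"

text \<open>\<open>norm_evaluation_le_iff\<close> with the norm itself as bound; this is the
  hypothesis for \<open>extend\<close> with constant \<open>norm x\<close>.\<close>

lemma f_ineq:
  assumes "X \<in> space M" "x \<in> X"
  shows "\<bar>\<alpha> * f n X x + \<beta> * f m X x - f k X x\<bar> \<le> norm x * norm (\<alpha> *\<^sub>R evaluation n X + \<beta> *\<^sub>R evaluation m X - evaluation k X)"
  using norm_evaluation_le_iff[OF assms(1), of "norm (\<alpha> *\<^sub>R evaluation n X + \<beta> *\<^sub>R evaluation m X - evaluation k X)" \<alpha> n \<beta> m k] assms(2)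
  by (simp add: mult.commute)

lemma evaluation_in_bullet: "evaluation n X \<in> bullet X"
  unfolding bullet_def by (rule closure_subset[THEN subsetD]) simp

lemma tendsto_pairing:
  assumes "X \<in> space M" "x \<in> X" "g \<in> bullet X"
  shows "(\<lambda>k. f (approx_index (\<lambda>n. evaluation n X) g k) X x) \<longlonglongrightarrow> pairing X g x"
  unfolding pairing_def
  by (rule tendsto_extend[of "norm x"]) (use f_ineq assms in \<open>auto simp: bullet_def\<close>)

lemma pairing_ineq:
  assumes "X \<in> space M" "x \<in> X" "g \<in> bullet X" "g' \<in> bullet X" "g'' \<in> bullet X"
  shows "\<bar>\<alpha> * pairing X g x + \<beta> * pairing X g' x - pairing X g'' x\<bar> \<le> norm x * norm (\<alpha> *\<^sub>R g + \<beta> *\<^sub>R g' - g'')"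
  unfolding pairing_def
  by (rule extend_ineq[of "norm x"]) (use f_ineq assms in \<open>auto simp: bullet_def\<close>)

lemma pairing_evaluation:
  assumes "X \<in> space M" "x \<in> X"
  shows "pairing X (evaluation n X) x = f n X x"
  unfolding pairing_def
  by (rule extend_base[of "norm x" _ "\<lambda>n. evaluation n X"]) (use f_ineq assms in auto)

lemma pairing_bound:
  assumes "X \<in> space M" "x \<in> X" "g \<in> bullet X"
  shows "\<bar>pairing X g x\<bar> \<le> norm x * norm g"
  using pairing_ineq[OF assms(1,2,3,3,3), of 0 0] by simp

lemma pairing_dist:
  assumes "X \<in> space M" "x \<in> X" "g \<in> bullet X" "g' \<in> bullet X"
  shows "\<bar>pairing X g x - pairing X g' x\<bar> \<le> norm x * norm (g - g')"
  using pairing_ineq[OF assms(1,2,3,3,4), of 1 0] by simp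

text \<open>The converse of \<open>pairing_ineq\<close>. The points are replaced by evaluations at
  distance at most \<open>(1/2) ^ k\<close>, where norms are known exactly, and the error
  \<open>C * (1/2) ^ k\<close> vanishes in the limit.\<close>

lemma norm_le_if_pairing_le:
  assumes X: "X \<in> space M" and g: "g \<in> bullet X" "g' \<in> bullet X" "g'' \<in> bullet X" and K: "0 \<le> K"
    and le: "\<And>x. x \<in> X \<Longrightarrow> \<bar>\<alpha> * pairing X g x + \<beta> * pairing X g' x - pairing X g'' x\<bar> \<le> K * norm x"
  shows "norm (\<alpha> *\<^sub>R g + \<beta> *\<^sub>R g' - g'') \<le> K"
proof -
  define I where "I = approx_index (\<lambda>n. evaluation n X)"
  define C where "C = \<bar>\<alpha>\<bar> + \<bar>\<beta>\<bar> + 1"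
  have close: "\<bar>pairing X h x - f (I h k) X x\<bar> \<le> norm x * (1/2) ^ k" if h: "h \<in> bullet X" and x: "x \<in> X" for h x k
  proof -
    have "\<bar>pairing X h x - f (I h k) X x\<bar> \<le> norm x * norm (h - evaluation (I h k) X)"
      using pairing_dist[OF X x h evaluation_in_bullet] by (simp add: pairing_evaluation[OF X x])
    also have "\<dots> \<le> norm x * (1/2) ^ k"
      using approx_index[of h "\<lambda>n. evaluation n X" k] h by (intro mult_left_mono) (auto simp: bullet_def I_def)
    finally show ?thesis .
  qed
  have "norm (\<alpha> *\<^sub>R evaluation (I g k) X + \<beta> *\<^sub>R evaluation (I g' k) X - evaluation (I g'' k) X) \<le> K + C * (1/2) ^ k" for k
  proof (rule norm_evaluation_le_iff[THEN iffD2, OF X])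
    show "0 \<le> K + C * (1/2) ^ k" using K by (simp add: C_def)
    show "\<forall>x\<in>X. \<bar>\<alpha> * f (I g k) X x + \<beta> * f (I g' k) X x - f (I g'' k) X x\<bar> \<le> (K + C * (1/2) ^ k) * norm x"
    proof
      fix x assume x: "x \<in> X"
      let ?d = "\<lambda>h. pairing X h x - f (I h k) X x"
      have "\<bar>\<alpha> * f (I g k) X x + \<beta> * f (I g' k) X x - f (I g'' k) X x\<bar>
        \<le> \<bar>\<alpha> * pairing X g x + \<beta> * pairing X g' x - pairing X g'' x\<bar> + (\<bar>\<alpha> * ?d g\<bar> + \<bar>\<beta> * ?d g'\<bar> + \<bar>?d g''\<bar>)"
        unfolding right_diff_distrib by linarith
      also have "\<dots> \<le> K * norm x + (\<bar>\<alpha>\<bar> * (norm x * (1/2) ^ k) + \<bar>\<beta>\<bar> * (norm x * (1/2) ^ k) + norm x * (1/2) ^ k)"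
        unfolding abs_mult by (intro add_mono mult_left_mono close g x le) auto
      also have "\<dots> = (K + C * (1/2) ^ k) * norm x" by (simp add: C_def algebra_simps)
      finally show "\<bar>\<alpha> * f (I g k) X x + \<beta> * f (I g' k) X x - f (I g'' k) X x\<bar> \<le> (K + C * (1/2) ^ k) * norm x" .
    qed
  qed
  moreover have "(\<lambda>k. norm (\<alpha> *\<^sub>R evaluation (I g k) X + \<beta> *\<^sub>R evaluation (I g' k) X - evaluation (I g'' k) X))
      \<longlonglongrightarrow> norm (\<alpha> *\<^sub>R g + \<beta> *\<^sub>R g' - g'')"
    unfolding I_def by (intro tendsto_intros tendsto_approx_index[where a = "\<lambda>n. evaluation n X"] g[unfolded bullet_def])
  moreover have "(\<lambda>k. K + C * (1/2) ^ k) \<longlonglongrightarrow> K + C * 0"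
    by (intro tendsto_intros LIMSEQ_power_zero) simp
  ultimately have "norm (\<alpha> *\<^sub>R g + \<beta> *\<^sub>R g' - g'') \<le> K + C * 0"
    by (intro LIMSEQ_le) auto
  then show ?thesis by simp
qed

end

lemma continuous_on_eval_bcontfun: "continuous_on UNIV (\<lambda>g :: C_cantor. apply_bcontfun g t)"
proof (rule continuous_onI)
  fix g :: C_cantor and \<epsilon> :: real assume "0 < \<epsilon>"
  then show "\<exists>\<delta>>0. \<forall>h\<in>UNIV. dist h g < \<delta> \<longrightarrow> dist (apply_bcontfun h t) (apply_bcontfun g t) \<le> \<epsilon>"
    using dist_bounded[of _ t g] by (intro exI[of _ \<epsilon>]) (force intro: order_trans)
qed

text \<open>By density of the padded strings, a norm bound becomes countably many conditions on
  point values.\<close>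

lemma norm_le_iff_pad:
  fixes g :: C_cantor
  shows "norm g \<le> c \<longleftrightarrow> (\<forall>s. \<bar>apply_bcontfun g (pad s)\<bar> \<le> c)"
proof
  show "\<forall>s. \<bar>apply_bcontfun g (pad s)\<bar> \<le> c" if "norm g \<le> c"
    using that norm_bounded[of g] order_trans by (metis real_norm_def)
  assume *: "\<forall>s. \<bar>apply_bcontfun g (pad s)\<bar> \<le> c"
  show "norm g \<le> c"
  proof (rule norm_bound, rule field_le_epsilon)
    fix t and \<epsilon> :: real assume "0 < \<epsilon>"
    moreover have "continuous_on UNIV (apply_bcontfun g)" by simp
    ultimately obtain n where n: "\<And>u. u \<in> cylinder (initial t n) \<Longrightarrow> dist (apply_bcontfun g u) (apply_bcontfun g t) < \<epsilon>"
      unfolding continuous_on_cantor_iff by blast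
    have "\<bar>apply_bcontfun g (pad (initial t n)) - apply_bcontfun g t\<bar> < \<epsilon>"
      using n[of "pad (initial t n)"] by (simp add: dist_real_def)
    moreover have "\<bar>apply_bcontfun g (pad (initial t n))\<bar> \<le> c" using * by blast
    ultimately show "norm (apply_bcontfun g t) \<le> c + \<epsilon>" by simp
  qed
qed

section \<open>The closure of the evaluations as a copy of the dual\<close>

context functional_family
begin

lemma linear_pairing_right:
  assumes X: "X \<in> space M" and g: "g \<in> bullet X"
  shows "linear_functional_on X (pairing X g)"
  unfolding linear_functional_on_def
proof (intro conjI ballI allI)
  note sub = subspace_member[OF X]
  let ?I = "approx_index (\<lambda>n. evaluation n X) g"
  show "pairing X g (x + y) = pairing X g x + pairing X g y" if x: "x \<in> X" and y: "y \<in> X" for x y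
  proof (rule LIMSEQ_unique)
    show "(\<lambda>k. f (?I k) X (x + y)) \<longlonglongrightarrow> pairing X g (x + y)"
      by (rule tendsto_pairing[OF X subspace_add[OF sub x y] g])
    have "(\<lambda>k. f (?I k) X x + f (?I k) X y) \<longlonglongrightarrow> pairing X g x + pairing X g y"
      by (intro tendsto_add tendsto_pairing X x y g)
    then show "(\<lambda>k. f (?I k) X (x + y)) \<longlonglongrightarrow> pairing X g x + pairing X g y"
      by (simp add: linear_add[OF linear_f])
  qed
  show "pairing X g (c *\<^sub>R x) = c * pairing X g x" if x: "x \<in> X" for c x
  proof (rule LIMSEQ_unique)
    show "(\<lambda>k. f (?I k) X (c *\<^sub>R x)) \<longlonglongrightarrow> pairing X g (c *\<^sub>R x)"
      by (rule tendsto_pairing[OF X subspace_scale[OF sub x] g])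
    have "(\<lambda>k. c * f (?I k) X x) \<longlonglongrightarrow> c * pairing X g x"
      by (intro tendsto_mult_left tendsto_pairing X x g)
    then show "(\<lambda>k. f (?I k) X (c *\<^sub>R x)) \<longlonglongrightarrow> c * pairing X g x"
      by (simp add: linear_cmul[OF linear_f])
  qed
qed

text \<open>Functionals \<open>f (N k) X\<close> converging to \<open>\<phi>\<close> in the dual
  norm have Cauchy evaluations, since evaluation is isometric; completeness of
  \<open>C_cantor\<close> supplies \<open>g\<close>.\<close>

lemma ex_pairing_eq:
  assumes X: "X \<in> space M" and \<phi>: "\<phi> \<in> dual_space X"
  shows "\<exists>g\<in>bullet X. \<forall>x\<in>X. pairing X g x = \<phi> x"
proof -
  have "\<exists>n. \<forall>x\<in>X. \<bar>\<phi> x - f n X x\<bar> \<le> (1/2) ^ k * norm x" for k :: nat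
    by (rule f_dense[OF X \<phi>]) simp
  then obtain N where N: "\<And>k x. x \<in> X \<Longrightarrow> \<bar>\<phi> x - f (N k) X x\<bar> \<le> (1/2) ^ k * norm x" by metis
  have close: "norm (evaluation (N k) X - evaluation (N l) X) \<le> (1/2) ^ k + (1/2) ^ l" for k l
  proof -
    have "\<bar>1 * f (N k) X x + 0 * f 0 X x - f (N l) X x\<bar> \<le> ((1/2) ^ k + (1/2) ^ l) * norm x" if "x \<in> X" for x
      using N[OF that, of k] N[OF that, of l] unfolding distrib_right by linarith
    then have "norm (1 *\<^sub>R evaluation (N k) X + 0 *\<^sub>R evaluation 0 X - evaluation (N l) X) \<le> (1/2) ^ k + (1/2) ^ l"
      by (intro norm_evaluation_le_iff[THEN iffD2, OF X]) auto
    then show ?thesis by simp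
  qed
  have "Cauchy (\<lambda>k. evaluation (N k) X)"
  proof (rule metric_CauchyI)
    fix r :: real assume "0 < r"
    then obtain K where K: "(1/2) ^ K < r / 2" using real_arch_pow_inv[of "r / 2" "1/2"] by auto
    have "dist (evaluation (N k) X) (evaluation (N l) X) < r" if "k \<ge> K" "l \<ge> K" for k l
    proof -
      have "(1/2 :: real) ^ k \<le> (1/2) ^ K" "(1/2 :: real) ^ l \<le> (1/2) ^ K"
        using that by (simp_all add: power_decreasing)
      then show ?thesis using close[of k l] K unfolding dist_norm by linarith
    qed
    then show "\<exists>K. \<forall>k\<ge>K. \<forall>l\<ge>K. dist (evaluation (N k) X) (evaluation (N l) X) < r" by blast
  qed
  then obtain g where g: "(\<lambda>k. evaluation (N k) X) \<longlonglongrightarrow> g"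
    using Cauchy_convergent convergent_def by blast
  have gb: "g \<in> bullet X"
    unfolding bullet_def closure_sequential using g by (intro exI[of _ "\<lambda>k. evaluation (N k) X"]) simp
  have "pairing X g x = \<phi> x" if x: "x \<in> X" for x
  proof (rule LIMSEQ_unique)
    have "(\<lambda>k. f (N k) X x - pairing X g x) \<longlonglongrightarrow> 0"
    proof (rule Lim_null_comparison)
      show "\<forall>\<^sub>F k in sequentially. norm (f (N k) X x - pairing X g x) \<le> norm x * norm (evaluation (N k) X - g)"
        using pairing_dist[OF X x evaluation_in_bullet gb] by (simp add: pairing_evaluation[OF X x])
      show "(\<lambda>k. norm x * norm (evaluation (N k) X - g)) \<longlonglongrightarrow> 0"
        using g by (auto intro!: tendsto_eq_intros)
    qed
    then show "(\<lambda>k. f (N k) X x) \<longlonglongrightarrow> pairing X g x" using Lim_null by blast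
    have "(\<lambda>k. f (N k) X x - \<phi> x) \<longlonglongrightarrow> 0"
    proof (rule Lim_null_comparison)
      show "\<forall>\<^sub>F k in sequentially. norm (f (N k) X x - \<phi> x) \<le> (1/2) ^ k * norm x"
        using N[OF x] by (simp add: abs_minus_commute)
      have "(\<lambda>k. (1/2) ^ k * norm x) \<longlonglongrightarrow> 0 * norm x"
        by (intro tendsto_intros LIMSEQ_power_zero) simp
      then show "(\<lambda>k. (1/2) ^ k * norm x) \<longlonglongrightarrow> 0" by simp
    qed
    then show "(\<lambda>k. f (N k) X x) \<longlonglongrightarrow> \<phi> x" using Lim_null by blast
  qed
  then show ?thesis using gb by blast
qed

lemma pairing_in_dual:
  assumes X: "X \<in> space M" and g: "g \<in> bullet X" "g' \<in> bullet X"
  shows "(\<lambda>x\<in>X. \<alpha> * pairing X g x + \<beta> * pairing X g' x) \<in> dual_space X"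
proof -
  note sub = subspace_member[OF X]
  have lin: "pairing X h (x + y) = pairing X h x + pairing X h y" "pairing X h (c *\<^sub>R x) = c * pairing X h x"
    if "h \<in> bullet X" "x \<in> X" "y \<in> X" for h x y c
    using linear_pairing_right[OF X that(1)] that(2,3) by (simp_all add: linear_functional_on_def)
  have "linear_functional_on X (\<lambda>x\<in>X. \<alpha> * pairing X g x + \<beta> * pairing X g' x)"
    using subspace_add[OF sub] subspace_scale[OF sub] lin[OF g(1)] lin[OF g(2)]
    by (auto simp: linear_functional_on_def algebra_simps)
  moreover have "\<bar>\<alpha> * pairing X g x + \<beta> * pairing X g' x\<bar> \<le> (\<bar>\<alpha>\<bar> * norm g + \<bar>\<beta>\<bar> * norm g') * norm x"
    if x: "x \<in> X" for x
  proof -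
    have "\<bar>\<alpha> * pairing X g x + \<beta> * pairing X g' x\<bar> \<le> \<bar>\<alpha>\<bar> * \<bar>pairing X g x\<bar> + \<bar>\<beta>\<bar> * \<bar>pairing X g' x\<bar>"
      by (metis abs_mult abs_triangle_ineq)
    also have "\<dots> \<le> \<bar>\<alpha>\<bar> * (norm x * norm g) + \<bar>\<beta>\<bar> * (norm x * norm g')"
      by (intro add_mono mult_left_mono pairing_bound X x g) auto
    finally show ?thesis by (simp add: algebra_simps)
  qed
  then have "\<exists>K. \<forall>x\<in>X. \<bar>(\<lambda>x\<in>X. \<alpha> * pairing X g x + \<beta> * pairing X g' x) x\<bar> \<le> K * norm x" by auto
  ultimately show ?thesis unfolding dual_space_def by simp
qed

text \<open>The combined functional is in the dual, so some \<open>h\<close> in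
  \<open>bullet X\<close> represents it; the isometry then identifies \<open>h\<close> with the
  combination of \<open>g\<close> and \<open>g'\<close>.\<close>

lemma bullet_combination:
  assumes X: "X \<in> space M" and g: "g \<in> bullet X" "g' \<in> bullet X"
  shows "\<alpha> *\<^sub>R g + \<beta> *\<^sub>R g' \<in> bullet X"
    and "x \<in> X \<Longrightarrow> pairing X (\<alpha> *\<^sub>R g + \<beta> *\<^sub>R g') x = \<alpha> * pairing X g x + \<beta> * pairing X g' x"
proof -
  obtain h where h: "h \<in> bullet X" "\<And>x. x \<in> X \<Longrightarrow> pairing X h x = \<alpha> * pairing X g x + \<beta> * pairing X g' x"
    using ex_pairing_eq[OF X pairing_in_dual[OF X g, of \<alpha> \<beta>]] by auto
  have "norm (\<alpha> *\<^sub>R g + \<beta> *\<^sub>R g' - h) \<le> 0"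
    using h by (intro norm_le_if_pairing_le[OF X g]) auto
  then have "h = \<alpha> *\<^sub>R g + \<beta> *\<^sub>R g'" by simp
  then show "\<alpha> *\<^sub>R g + \<beta> *\<^sub>R g' \<in> bullet X"
    and "x \<in> X \<Longrightarrow> pairing X (\<alpha> *\<^sub>R g + \<beta> *\<^sub>R g') x = \<alpha> * pairing X g x + \<beta> * pairing X g' x"
    using h by auto
qed

lemma bullet_in_SB:
  assumes X: "X \<in> space M"
  shows "bullet X \<in> SB"
proof -
  have "0 \<in> bullet X" using bullet_combination(1)[OF X evaluation_in_bullet evaluation_in_bullet, where \<alpha> = 0 and \<beta> = 0] by simp
  moreover have "g + g' \<in> bullet X" if "g \<in> bullet X" "g' \<in> bullet X" for g g'
    using bullet_combination(1)[OF X that, where \<alpha> = 1 and \<beta> = 1] by simp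
  moreover have "c *\<^sub>R g \<in> bullet X" if "g \<in> bullet X" for g c
    using bullet_combination(1)[OF X that that, where \<alpha> = c and \<beta> = 0] by simp
  ultimately have "subspace (bullet X)" by (rule subspaceI)
  then show ?thesis by (simp add: SB_def bullet_def)
qed

lemma linear_pairing_left:
  assumes X: "X \<in> space M" and x: "x \<in> X"
  shows "linear_functional_on (bullet X) (\<lambda>g. pairing X g x)"
  unfolding linear_functional_on_def
proof (intro conjI ballI allI)
  show "pairing X (g + g') x = pairing X g x + pairing X g' x" if "g \<in> bullet X" "g' \<in> bullet X" for g g'
    using bullet_combination(2)[OF X that x, where \<alpha> = 1 and \<beta> = 1] by simp
  show "pairing X (c *\<^sub>R g) x = c * pairing X g x" if "g \<in> bullet X" for c g
    using bullet_combination(2)[OF X that that x, where \<alpha> = c and \<beta> = 0] by simp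
qed

lemma bilinear_pairing:
  assumes X: "X \<in> space M"
  shows "bilinear_form_on (bullet X) X (pairing X)"
  unfolding bilinear_form_on_def using linear_pairing_left[OF X] linear_pairing_right[OF X] by simp

lemma dual_norm_pairing:
  assumes X: "X \<in> space M" and g: "g \<in> bullet X"
  shows "dual_norm X (\<lambda>x\<in>X. pairing X g x) = norm g"
proof (rule antisym)
  have bdd: "\<exists>K. \<forall>x\<in>X. \<bar>(\<lambda>x\<in>X. pairing X g x) x\<bar> \<le> K * norm x"
    using pairing_bound[OF X _ g] by (intro exI[of _ "norm g"]) (simp add: mult.commute)
  have zero: "0 \<in> X" using subspace_member[OF X] by (rule subspace_0)
  show "dual_norm X (\<lambda>x\<in>X. pairing X g x) \<le> norm g"
    unfolding dual_norm_def
  proof (rule cSUP_least)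
    show "{x \<in> X. norm x \<le> 1} \<noteq> {}" using zero by force
    fix x assume "x \<in> {x \<in> X. norm x \<le> 1}"
    then have x: "x \<in> X" "norm x \<le> 1" by auto
    have "\<bar>pairing X g x\<bar> \<le> norm x * norm g" using pairing_bound[OF X x(1) g] .
    also have "\<dots> \<le> 1 * norm g" using x(2) by (intro mult_right_mono) auto
    finally show "\<bar>(\<lambda>x\<in>X. pairing X g x) x\<bar> \<le> norm g" using x(1) by simp
  qed
  let ?K = "dual_norm X (\<lambda>x\<in>X. pairing X g x)"
  have K: "0 \<le> ?K"
    by (rule order_trans[OF abs_ge_zero dual_norm_upper[OF bdd zero]]) simp
  \<comment> \<open>Zero coefficients specialise the three-term bound to a single
    functional.\<close>
  have "\<bar>0 * pairing X g x + 0 * pairing X g x - pairing X g x\<bar> \<le> ?K * norm x" if x: "x \<in> X" for x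
  proof (cases "x = 0")
    case True
    then show ?thesis using pairing_bound[OF X x g] by simp
  next
    case False
    have y: "(1 / norm x) *\<^sub>R x \<in> X" using subspace_scale[OF subspace_member[OF X] x] .
    have "norm ((1 / norm x) *\<^sub>R x) \<le> 1" using False by simp
    from dual_norm_upper[OF bdd y this] have "\<bar>pairing X g ((1 / norm x) *\<^sub>R x)\<bar> \<le> ?K"
      unfolding restrict_apply'[OF y] .
    moreover have "pairing X g ((1 / norm x) *\<^sub>R x) = pairing X g x / norm x"
      using linear_pairing_right[OF X g] x by (simp add: linear_functional_on_def)
    ultimately show ?thesis using False by (simp add: abs_divide pos_divide_le_eq)
  qed
  then have "norm (0 *\<^sub>R g + 0 *\<^sub>R g - g) \<le> ?K"
    by (intro norm_le_if_pairing_le[OF X g g g K])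
  then show "norm g \<le> ?K" by simp
qed

lemma isometry_pairing:
  assumes X: "X \<in> space M"
  shows "linear_isometry_onto_dual (bullet X) X (\<lambda>g. \<lambda>x\<in>X. pairing X g x)"
  unfolding linear_isometry_onto_dual_def
proof (intro conjI ballI)
  show "(\<lambda>g. \<lambda>x\<in>X. pairing X g x) ` bullet X = dual_space X"
  proof (intro equalityI subsetI)
    fix \<phi> assume "\<phi> \<in> (\<lambda>g. \<lambda>x\<in>X. pairing X g x) ` bullet X"
    then show "\<phi> \<in> dual_space X" using pairing_in_dual[OF X, of _ _ 1 0] by auto
  next
    fix \<phi> assume \<phi>: "\<phi> \<in> dual_space X"
    then obtain g where g: "g \<in> bullet X" "\<forall>x\<in>X. pairing X g x = \<phi> x"
      using ex_pairing_eq[OF X] by blast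
    have "\<phi> = (\<lambda>x\<in>X. pairing X g x)"
      using \<phi> g(2) by (intro extensionalityI[of _ X]) (auto simp: dual_space_def)
    then show "\<phi> \<in> (\<lambda>g. \<lambda>x\<in>X. pairing X g x) ` bullet X" using g(1) by blast
  qed
  show "linear_functional_on (bullet X) (\<lambda>g. (\<lambda>x\<in>X. pairing X g x) x)" if "x \<in> X" for x
    using linear_pairing_left[OF X that] that by simp
  show "dual_norm X (\<lambda>x\<in>X. pairing X g x) = norm g" if "g \<in> bullet X" for g
    by (rule dual_norm_pairing[OF X that])
qed

lemma continuous_on_pairing:
  assumes X: "X \<in> space M"
  shows "continuous_on (bullet X \<times> X) (\<lambda>(g, x). pairing X g x)"
  unfolding continuous_on_def
proof
  fix w assume "w \<in> bullet X \<times> X"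
  then obtain g0 x0 where w: "w = (g0, x0)" "g0 \<in> bullet X" "x0 \<in> X" by auto
  let ?F = "at w within bullet X \<times> X"
  have lim: "(fst \<longlongrightarrow> g0) ?F" "(snd \<longlongrightarrow> x0) ?F"
    using w(1) by (auto intro: tendsto_eq_intros)
  have "((\<lambda>p. pairing X (fst p) (snd p) - pairing X g0 x0) \<longlongrightarrow> 0) ?F"
  proof (rule Lim_null_comparison)
    show "\<forall>\<^sub>F p in ?F. norm (pairing X (fst p) (snd p) - pairing X g0 x0)
        \<le> norm (snd p) * norm (fst p - g0) + norm (snd p - x0) * norm g0"
      unfolding eventually_at_filter
    proof (intro always_eventually allI impI)
      fix p assume p: "p \<in> bullet X \<times> X"
      have "\<bar>pairing X (fst p) (snd p) - pairing X g0 (snd p)\<bar> \<le> norm (snd p) * norm (fst p - g0)"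
        using p w by (intro pairing_dist X) auto
      moreover have "snd p - x0 \<in> X" using p w subspace_diff[OF subspace_member[OF X]] by auto
      then have "\<bar>pairing X g0 (snd p - x0)\<bar> \<le> norm (snd p - x0) * norm g0"
        by (intro pairing_bound X w)
      moreover have "pairing X g0 (snd p - x0 + x0) = pairing X g0 (snd p - x0) + pairing X g0 x0"
        using linear_pairing_right[OF X w(2)] \<open>snd p - x0 \<in> X\<close> w(3) unfolding linear_functional_on_def by blast
      ultimately show "norm (pairing X (fst p) (snd p) - pairing X g0 x0)
          \<le> norm (snd p) * norm (fst p - g0) + norm (snd p - x0) * norm g0"
        by simp
    qed
    have "((\<lambda>p. norm (snd p) * norm (fst p - g0) + norm (snd p - x0) * norm g0) \<longlongrightarrow>
        norm x0 * norm (g0 - g0) + norm (x0 - x0) * norm g0) ?F"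
      by (intro tendsto_intros lim)
    then show "((\<lambda>p. norm (snd p) * norm (fst p - g0) + norm (snd p - x0) * norm g0) \<longlongrightarrow> 0) ?F" by simp
  qed
  then have "((\<lambda>p. pairing X (fst p) (snd p)) \<longlongrightarrow> pairing X g0 x0) ?F" using Lim_null by blast
  then show "((\<lambda>(g, x). pairing X g x) \<longlongrightarrow> (case w of (g, x) \<Rightarrow> pairing X g x)) ?F"
    by (simp add: w(1) case_prod_beta')
qed

section \<open>Measurability of the copy of the dual and of the pairing\<close>

lemma bullet_measurable: "bullet \<in> M \<rightarrow>\<^sub>M effros_borel"
  unfolding effros_borel_def
proof (rule measurable_measure_of)
  show "{{X \<in> SB. X \<inter> U \<noteq> {}} |U. open U} \<subseteq> Pow SB" by auto
  show "bullet \<in> space M \<rightarrow> SB" using bullet_in_SB by blast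
  fix A assume "A \<in> {{X \<in> SB. X \<inter> U \<noteq> {}} |U. open U}"
  then obtain U where U: "open U" "A = {X \<in> SB. X \<inter> U \<noteq> {}}" by blast
  obtain e' :: "nat \<Rightarrow> C_cantor" where e': "closure (range e') = UNIV" using C_cantor_separable by blast
  interpret C: dense_sequence e' by unfold_locales (rule e')
  \<comment> \<open>Closed balls with centers from a dense sequence are used, as membership in them
    is tested by the values at padded strings.\<close>
  have eq: "bullet X \<inter> U \<noteq> {} \<longleftrightarrow> (\<exists>n l j. cball (e' l) (1 / real (Suc j)) \<subseteq> U \<and>
      (\<forall>s. \<bar>apply_bcontfun (evaluation n X) (pad s) - apply_bcontfun (e' l) (pad s)\<bar> \<le> 1 / real (Suc j)))" for X
  proof -
    have "bullet X \<inter> U \<noteq> {} \<longleftrightarrow> (\<exists>n. evaluation n X \<in> U)"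
      using open_Int_closure_eq_empty[OF U(1), of "range (\<lambda>n. evaluation n X)"]
      by (auto simp: bullet_def Int_commute)
    also have "\<dots> \<longleftrightarrow> (\<exists>n l j. cball (e' l) (1 / real (Suc j)) \<subseteq> U \<and> evaluation n X \<in> cball (e' l) (1 / real (Suc j)))"
    proof
      assume "\<exists>n. evaluation n X \<in> U"
      then obtain n r where n: "evaluation n X \<in> U" "r > 0" "ball (evaluation n X) r \<subseteq> U"
        using U(1) open_contains_ball by blast
      obtain j where j: "1 / real (Suc j) < r / 2" using n(2) nat_approx_posE half_gt_zero by metis
      obtain l where l: "norm (evaluation n X - e' l) < 1 / real (Suc j)"
        by (rule C.dense_approx[of "1 / real (Suc j)" "evaluation n X"]) simp
      have "cball (e' l) (1 / real (Suc j)) \<subseteq> U"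
      proof
        fix y assume "y \<in> cball (e' l) (1 / real (Suc j))"
        then have "dist (evaluation n X) y < r"
          using l j dist_triangle[of "evaluation n X" y "e' l"] by (simp add: dist_norm del: of_nat_Suc)
        then show "y \<in> U" using n(3) by auto
      qed
      moreover have "evaluation n X \<in> cball (e' l) (1 / real (Suc j))"
        using l by (simp add: dist_norm norm_minus_commute)
      ultimately show "\<exists>n l j. cball (e' l) (1 / real (Suc j)) \<subseteq> U \<and> evaluation n X \<in> cball (e' l) (1 / real (Suc j))"
        by (intro exI conjI)
    qed blast
    finally have hit: "bullet X \<inter> U \<noteq> {} \<longleftrightarrow> (\<exists>n l j. cball (e' l) (1 / real (Suc j)) \<subseteq> U \<and> evaluation n X \<in> cball (e' l) (1 / real (Suc j)))" .
    have mem: "evaluation n X \<in> cball (e' l) (1 / real (Suc j)) \<longleftrightarrow>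
        (\<forall>s. \<bar>apply_bcontfun (evaluation n X) (pad s) - apply_bcontfun (e' l) (pad s)\<bar> \<le> 1 / real (Suc j))" for n l j
      using norm_le_iff_pad[of "evaluation n X - e' l" "1 / real (Suc j)"]
      by (simp add: dist_norm norm_minus_commute)
    show ?thesis unfolding hit mem ..
  qed
  note [measurable] = evaluation_measurable
  have "Measurable.pred M (\<lambda>X. bullet X \<inter> U \<noteq> {})"
    unfolding eq by measurable
  moreover have "bullet -` A \<inter> space M = {X \<in> space M. bullet X \<inter> U \<noteq> {}}"
    using bullet_in_SB by (auto simp: U(2))
  ultimately show "bullet -` A \<inter> space M \<in> sets M" by simp
qed

text \<open>A function measurable in \<open>X\<close> and Lipschitz in \<open>x\<close> is a limit
  of functions that read \<open>x\<close> only through an index of a nearby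
  \<open>e l\<close>.\<close>

lemma f_joint_measurable:
  "(\<lambda>(X, x). f n X x) \<in> borel_measurable (M \<Otimes>\<^sub>M borel)"
proof (rule borel_measurable_LIMSEQ_real)
  fix p :: "'a set \<times> 'a"
  obtain X x where p: "p = (X, x)" by (cases p)
  have x: "x \<in> closure (range e)" by (simp add: dense)
  have "(\<lambda>k. f n X (e (approx_index e x k)) - f n X x) \<longlonglongrightarrow> 0"
  proof (rule Lim_null_comparison)
    show "\<forall>\<^sub>F k in sequentially. norm (f n X (e (approx_index e x k)) - f n X x) \<le> a n * norm (e (approx_index e x k) - x)"
    proof (intro always_eventually allI)
      fix k
      show "norm (f n X (e (approx_index e x k)) - f n X x) \<le> a n * norm (e (approx_index e x k) - x)"
        using f_bound[of n X "e (approx_index e x k) - x"] by (simp add: linear_diff[OF linear_f])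
    qed
    have "(\<lambda>k. a n * norm (e (approx_index e x k) - x)) \<longlonglongrightarrow> a n * norm (x - x)"
      by (intro tendsto_intros tendsto_approx_index x)
    then show "(\<lambda>k. a n * norm (e (approx_index e x k) - x)) \<longlonglongrightarrow> 0" by simp
  qed
  then show "(\<lambda>k. case p of (X, x) \<Rightarrow> f n X (e (approx_index e x k))) \<longlonglongrightarrow> (case p of (X, x) \<Rightarrow> f n X x)"
    unfolding p using Lim_null by auto
next
  fix k
  have [measurable]: "(\<lambda>x. norm (x - e l)) \<in> borel_measurable borel" for l
    by (intro borel_measurable_continuous_onI continuous_intros)
  have [measurable]: "(\<lambda>x. approx_index e x k) \<in> borel \<rightarrow>\<^sub>M count_space UNIV"
    unfolding approx_index_def by measurable
  note [measurable] = f_measurable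
  have "(\<lambda>p. f n (fst p) (e (approx_index e (snd p) k))) \<in> borel_measurable (M \<Otimes>\<^sub>M borel)"
    by (rule measurable_compose_countable[where f = "\<lambda>l p. f n (fst p) (e l)" and g = "\<lambda>p. approx_index e (snd p) k"]) measurable
  then show "(\<lambda>(X, x). f n X (e (approx_index e x k))) \<in> borel_measurable (M \<Otimes>\<^sub>M borel)"
    by (simp add: case_prod_beta')
qed

text \<open>The approximating index takes countably many values and depends on \<open>X\<close> and
  \<open>g\<close> in a Borel way; the pairing is the \<open>lim\<close> of the resulting values,
  Borel also where there is no convergence.\<close>

lemma pairing_measurable:
  "(\<lambda>(X, x, g). pairing X g x) \<in> borel_measurable (M \<Otimes>\<^sub>M (borel \<Otimes>\<^sub>M borel))"
proof -
  let ?N = "M \<Otimes>\<^sub>M (borel \<Otimes>\<^sub>M borel) :: ('a set \<times> 'a \<times> C_cantor) measure"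
  have [measurable]: "(\<lambda>g :: C_cantor. apply_bcontfun g t) \<in> borel_measurable borel" for t
    by (intro borel_measurable_continuous_onI continuous_on_eval_bcontfun)
  note [measurable] = evaluation_measurable
  have le: "norm (g - evaluation n X) \<le> c \<longleftrightarrow>
      (\<forall>s. \<bar>apply_bcontfun g (pad s) - apply_bcontfun (evaluation n X) (pad s)\<bar> \<le> c)" for g n X c
    using norm_le_iff_pad[of "g - evaluation n X" c] by simp
  have "(\<lambda>p. approx_index (\<lambda>n. evaluation n (fst p)) (snd (snd p)) k) \<in> ?N \<rightarrow>\<^sub>M count_space UNIV" for k
    unfolding approx_index_def le by measurable
  moreover have "(\<lambda>p. f n (fst p) (fst (snd p))) \<in> borel_measurable ?N" for n
    using measurable_compose[OF _ f_joint_measurable[of n], of "\<lambda>p. (fst p, fst (snd p))" ?N] by simp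
  ultimately have "(\<lambda>p. f (approx_index (\<lambda>n. evaluation n (fst p)) (snd (snd p)) k) (fst p) (fst (snd p))) \<in> borel_measurable ?N" for k
    by (intro measurable_compose_countable[where g = "\<lambda>p. approx_index (\<lambda>n. evaluation n (fst p)) (snd (snd p)) k"
        and f = "\<lambda>n p. f n (fst p) (fst (snd p))"])
  then have "(\<lambda>p. lim (\<lambda>k. f (approx_index (\<lambda>n. evaluation n (fst p)) (snd (snd p)) k) (fst p) (fst (snd p)))) \<in> borel_measurable ?N"
    by (rule borel_measurable_lim_metric)
  then show ?thesis
    unfolding pairing_def extend_def by (simp add: case_prod_beta')
qed

end

section \<open>The theorem\<close>

lemma linear_functional_bound_ball:
  assumes X: "subspace X" and lin: "linear_functional_on X \<phi>" and K: "0 \<le> K"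
    and le: "\<And>x. x \<in> X \<Longrightarrow> norm x \<le> 1 \<Longrightarrow> \<bar>\<phi> x\<bar> \<le> K" and x: "x \<in> X"
  shows "\<bar>\<phi> x\<bar> \<le> K * norm x"
proof (cases "x = 0")
  case True
  have "\<phi> (0 *\<^sub>R x) = 0 * \<phi> x" using lin x unfolding linear_functional_on_def by blast
  then show ?thesis using True by simp
next
  case False
  have "norm ((1 / norm x) *\<^sub>R x) \<le> 1" using False by simp
  moreover have "\<phi> ((1 / norm x) *\<^sub>R x) = (1 / norm x) * \<phi> x"
    using lin x unfolding linear_functional_on_def by blast
  ultimately have "\<bar>(1 / norm x) * \<phi> x\<bar> \<le> K"
    using le[OF subspace_scale[OF X x]] by metis
  then show ?thesis using False by (simp add: abs_mult abs_divide pos_divide_le_eq)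
qed

context dual_separable_family
begin

lemma ex_uniformly_covering_sequence:
  "\<exists>h :: nat \<Rightarrow> 'a set \<Rightarrow> nat \<Rightarrow> bool. (\<forall>n k. Measurable.pred M (\<lambda>X. h n X k)) \<and>
     (\<forall>X\<in>space M. \<forall>c. \<forall>\<epsilon>>0. \<exists>n. \<not> far X \<epsilon> c (h n X))"
proof -
  have "\<forall>j. \<exists>h :: nat \<Rightarrow> 'a set \<Rightarrow> nat \<Rightarrow> bool. (\<forall>n k. Measurable.pred M (\<lambda>X. h n X k)) \<and>
     (\<forall>X\<in>space M. \<forall>c. \<exists>n. \<not> far X (1 / real (Suc j)) c (h n X))"
    by (intro allI ex_covering_sequence) simp
  from choice[OF this] obtain h :: "nat \<Rightarrow> nat \<Rightarrow> 'a set \<Rightarrow> nat \<Rightarrow> bool" where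
    h: "\<And>j n k. Measurable.pred M (\<lambda>X. h j n X k)"
      "\<And>j X c. X \<in> space M \<Longrightarrow> \<exists>n. \<not> far X (1 / real (Suc j)) c (h j n X)"
    by blast
  define h' where "h' n = (case prod_decode n of (j, m) \<Rightarrow> h j m)" for n
  have "Measurable.pred M (\<lambda>X. h' n X k)" for n k
    unfolding h'_def by (simp add: h(1) split: prod.split)
  moreover have "\<exists>n. \<not> far X \<epsilon> c (h' n X)" if X: "X \<in> space M" and \<epsilon>: "0 < \<epsilon>" for X c \<epsilon>
  proof -
    obtain j where j: "1 / real (Suc j) < \<epsilon>" using \<epsilon> nat_approx_posE by metis
    obtain n where n: "\<not> far X (1 / real (Suc j)) c (h j n X)" using h(2)[OF X] by blast
    have "\<not> far X \<epsilon> c (h j n X)"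
      using n j unfolding far_def by (meson mult_right_mono norm_ge_zero le_less_trans less_imp_le)
    then show ?thesis by (intro exI[of _ "prod_encode (j, n)"]) (simp add: h'_def)
  qed
  ultimately show ?thesis by blast
qed

lemma ex_functional_family: "\<exists>f a. functional_family e M f a"
proof -
  obtain h :: "nat \<Rightarrow> 'a set \<Rightarrow> nat \<Rightarrow> bool" where h: "\<And>n k. Measurable.pred M (\<lambda>X. h n X k)"
    "\<And>X c \<epsilon>. X \<in> space M \<Longrightarrow> 0 < \<epsilon> \<Longrightarrow> \<exists>n. \<not> far X \<epsilon> c (h n X)"
    using ex_uniformly_covering_sequence by blast
  \<comment> \<open>The index codes an integer factor and a choice \<open>h\<close>; the factors
    reach functionals of arbitrary norm.\<close>
  define a where "a n = real (fst (prod_decode n))" for n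
  define f where "f n X x = a n * dual_ball (h (snd (prod_decode n)) X) x" for n X x
  have "functional_family e M f a"
  proof (intro functional_family.intro functional_family_axioms.intro dense_sequence_axioms)
    show "subspace X" if "X \<in> space M" for X using subspace_member[OF that] .
    show "Measurable.pred M (\<lambda>X. X \<inter> U \<noteq> {})" if "open U" for U using pred_hits[OF that] .
    show "linear (f n X)" for n X
      unfolding f_def[abs_def]
      by (rule linearI) (simp_all add: linear_add[OF linear_dual_ball] linear_cmul[OF linear_dual_ball] algebra_simps)
    show "0 \<le> a n" for n by (simp add: a_def)
    show "\<bar>f n X x\<bar> \<le> a n * norm x" for n X x
      unfolding f_def abs_mult using dual_ball_le by (simp add: a_def mult_left_mono)
    show "(\<lambda>X. f n X x) \<in> borel_measurable M" for n x
      unfolding f_def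
      by (intro borel_measurable_times borel_measurable_const
          borel_measurable_continuous_cantor[OF continuous_on_dual_ball] h(1))
  next
    fix X \<phi> and \<delta> :: real assume X: "X \<in> space M" and \<phi>: "\<phi> \<in> dual_space X" and \<delta>: "0 < \<delta>"
    obtain K where K: "\<And>x. x \<in> X \<Longrightarrow> \<bar>\<phi> x\<bar> \<le> K * norm x" using \<phi> by (auto simp: dual_space_def)
    have lin: "linear_functional_on X \<phi>" using \<phi> by (simp add: dual_space_def)
    obtain m0 :: nat where m0: "K \<le> real m0" using real_arch_simple by blast
    define m where "m = Suc m0"
    have m: "real m > 0" "K \<le> real m" using m0 by (auto simp: m_def)
    have "linear_functional_on X (\<lambda>x. \<phi> x / real m)"
      using lin by (simp add: linear_functional_on_def add_divide_distrib)
    moreover have "\<bar>\<phi> x / real m\<bar> \<le> norm x" if "x \<in> X" for x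
    proof -
      have "\<bar>\<phi> x\<bar> \<le> real m * norm x"
        using K[OF that] mult_right_mono[OF m(2), of "norm x"] by simp
      then show ?thesis using m(1) by (simp add: abs_divide pos_divide_le_eq mult.commute)
    qed
    ultimately obtain c where c: "\<And>x. x \<in> X \<Longrightarrow> dual_ball c x = \<phi> x / real m"
      using ex_dual_ball_eq_on[OF subspace_member[OF X], of "\<lambda>x. \<phi> x / real m"] by blast
    \<comment> \<open>The factor \<open>m\<close> enlarges the error of the approximation in the
      unit ball, which is therefore kept below \<open>\<delta> / real m\<close>.\<close>
    have "0 < \<delta> / real m" using \<delta> m(1) by simp
    then obtain n where n: "\<not> far X (\<delta> / real m) c (h n X)" using h(2)[OF X] by blast
    have "\<bar>\<phi> x - f (prod_encode (m, n)) X x\<bar> \<le> \<delta> * norm x" if x: "x \<in> X" for x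
    proof -
      have "\<bar>dual_ball c x - dual_ball (h n X) x\<bar> \<le> \<delta> / real m * norm x"
        using n x unfolding far_def by (meson not_less)
      then have "real m * \<bar>dual_ball c x - dual_ball (h n X) x\<bar> \<le> real m * (\<delta> / real m * norm x)"
        by (rule mult_left_mono) simp
      moreover have "real m * \<bar>dual_ball c x - dual_ball (h n X) x\<bar> = \<bar>real m * (dual_ball c x - dual_ball (h n X) x)\<bar>"
        by (simp add: abs_mult)
      moreover have "real m * (dual_ball c x - dual_ball (h n X) x) = \<phi> x - f (prod_encode (m, n)) X x"
        using m(1) by (simp add: c[OF x] f_def a_def right_diff_distrib)
      moreover have "real m * (\<delta> / real m * norm x) = \<delta> * norm x" using m(1) by simp
      ultimately show ?thesis by simp
    qed
    then show "\<exists>n. \<forall>x\<in>X. \<bar>\<phi> x - f n X x\<bar> \<le> \<delta> * norm x" by blast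
  qed
  then show ?thesis by blast
qed

end

lemma uncountable_cantor: "\<not> countable (UNIV :: (nat \<Rightarrow> bool) set)"
proof
  assume "countable (UNIV :: (nat \<Rightarrow> bool) set)"
  then obtain t :: "nat \<Rightarrow> nat \<Rightarrow> bool" where t: "range t = UNIV"
    using uncountable_def by blast
  then obtain n where "t n = (\<lambda>k. \<not> t k k)" by (metis UNIV_I rangeE)
  then show False by (metis (no_types))
qed

text \<open>A pigeonhole argument: among uncountably many functionals, two are within
  \<open>\<epsilon> / 2\<close> of the same point of a countable dense set.\<close>

lemma no_separated_cantor_set_in_separable_dual:
  fixes F :: "(nat \<Rightarrow> bool) \<Rightarrow> 'a::real_normed_vector \<Rightarrow> real"
  assumes X: "subspace X" and sep: "separable_space (Metric_space.mtopology (dual_space X) (dual_dist X))"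
    and F: "\<And>\<alpha>. linear (F \<alpha>)" "\<And>\<alpha> x. \<bar>F \<alpha> x\<bar> \<le> norm x" and \<epsilon>: "0 < \<epsilon>"
  shows "\<exists>\<alpha> \<beta>. \<alpha> \<noteq> \<beta> \<and> (\<forall>x\<in>X. \<bar>F \<alpha> x - F \<beta> x\<bar> \<le> \<epsilon> * norm x)"
proof -
  interpret D: Metric_space "dual_space X" "dual_dist X" by (rule Metric_space_dual[OF X])
  obtain C where C: "countable C" "C \<subseteq> dual_space X" "D.mtopology closure_of C = dual_space X"
    using sep by (auto simp: separable_space_def)
  define G where "G \<alpha> = restrict (F \<alpha>) X" for \<alpha>
  have G: "G \<alpha> \<in> dual_space X" for \<alpha>
  proof -
    have "linear_functional_on X (G \<alpha>)"
      unfolding linear_functional_on_def G_def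
      using subspace_add[OF X] subspace_scale[OF X] linear_add[OF F(1)] linear_cmul[OF F(1)] by simp
    moreover have "\<exists>K. \<forall>x\<in>X. \<bar>G \<alpha> x\<bar> \<le> K * norm x"
      using F(2) by (intro exI[of _ 1]) (simp add: G_def)
    ultimately show ?thesis unfolding dual_space_def by (simp add: G_def)
  qed
  have "\<exists>\<psi>\<in>C. dual_dist X (G \<alpha>) \<psi> < \<epsilon> / 2" for \<alpha>
  proof -
    have "G \<alpha> \<in> D.mtopology closure_of C" using C(3) G by simp
    then have "\<forall>r>0. \<exists>\<psi>\<in>C. dual_dist X (G \<alpha>) \<psi> < r"
      unfolding D.metric_closure_of by auto
    then show ?thesis using \<epsilon> by (meson half_gt_zero)
  qed
  then obtain p where p: "\<And>\<alpha>. p \<alpha> \<in> C" "\<And>\<alpha>. dual_dist X (G \<alpha>) (p \<alpha>) < \<epsilon> / 2" by metis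
  have "\<not> inj p"
  proof
    assume "inj p"
    moreover have "countable (range p)" using p(1) C(1) by (meson countable_subset image_subsetI)
    ultimately show False using countable_image_inj_on uncountable_cantor by blast
  qed
  then obtain \<alpha> \<beta> where \<alpha>\<beta>: "\<alpha> \<noteq> \<beta>" "p \<alpha> = p \<beta>" by (auto simp: inj_def)
  have "dual_dist X (G \<alpha>) (G \<beta>) \<le> dual_dist X (G \<alpha>) (p \<alpha>) + dual_dist X (p \<alpha>) (G \<beta>)"
    using p(1) C(2) by (intro D.triangle G) auto
  also have "\<dots> < \<epsilon> / 2 + \<epsilon> / 2"
    using p(2)[of \<alpha>] p(2)[of \<beta>] \<alpha>\<beta>(2) by (simp add: D.commute)
  finally have d: "dual_norm X (\<lambda>x. G \<alpha> x - G \<beta> x) < \<epsilon>" using G by (simp add: dual_dist_def)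
  have lin: "linear_functional_on X (\<lambda>x. F \<alpha> x - F \<beta> x)"
    using linear_add[OF F(1)] linear_cmul[OF F(1)] by (simp add: linear_functional_on_def algebra_simps)
  have "\<bar>F \<alpha> x - F \<beta> x\<bar> \<le> \<epsilon> * norm x" if x: "x \<in> X" for x
  proof (rule linear_functional_bound_ball[OF X lin _ _ x])
    show "0 \<le> \<epsilon>" using \<epsilon> by simp
    fix y assume y: "y \<in> X" "norm y \<le> 1"
    have "\<bar>G \<alpha> y - G \<beta> y\<bar> \<le> dual_norm X (\<lambda>x. G \<alpha> x - G \<beta> x)"
      using y by (intro dual_norm_upper dual_space_diff_bounded G)
    then show "\<bar>F \<alpha> y - F \<beta> y\<bar> \<le> \<epsilon>" using d y(1) by (simp add: G_def)
  qed
  then show ?thesis using \<alpha>\<beta>(1) by blast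
qed

lemma space_effros_borel: "space effros_borel = SB"
  unfolding effros_borel_def by (rule space_measure_of) auto

lemma hits_in_effros_borel: "open U \<Longrightarrow> {X \<in> SB. X \<inter> U \<noteq> {}} \<in> sets effros_borel"
  unfolding effros_borel_def by (rule in_measure_of) auto

lemma closed_span_measurable: "closed_span \<in> borel \<rightarrow>\<^sub>M effros_borel"
  unfolding effros_borel_def
proof (rule measurable_measure_of)
  show "{{X \<in> SB. X \<inter> U \<noteq> {}} |U. open U} \<subseteq> Pow SB" by auto
  show SB: "closed_span \<in> space borel \<rightarrow> SB" by (simp add: SB_def)
  fix A :: "C_cantor set set" assume "A \<in> {{X \<in> SB. X \<inter> U \<noteq> {}} |U. open U}"
  then obtain U where U: "open U" "A = {X \<in> SB. X \<inter> U \<noteq> {}}" by blast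
  have "closed_span -` A \<inter> space borel = {z. closed_span z \<inter> U \<noteq> {}}"
    using SB by (auto simp: U(2))
  then show "closed_span -` A \<inter> space borel \<in> sets borel"
    using open_closed_span_meets[OF U(1)] by simp
qed

theorem theorem1:
  fixes B :: "C_cantor set set"
  assumes "B \<in> sets effros_borel" and "B \<subseteq> SD"
  shows "\<exists>bullet :: C_cantor set \<Rightarrow> C_cantor set.
      bullet \<in> restrict_space effros_borel B \<rightarrow>\<^sub>M effros_borel \<and>
      (\<forall>X\<in>B. isometric_to_dual (bullet X) X) \<and>
      (let A = {(X, x, g). X \<in> B \<and> x \<in> X \<and> g \<in> bullet X} in
       \<exists>br :: C_cantor set \<Rightarrow> C_cantor \<Rightarrow> C_cantor \<Rightarrow> real.
         (\<lambda>(X, x, g). br X g x) \<in>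
           restrict_space (effros_borel \<Otimes>\<^sub>M (borel \<Otimes>\<^sub>M borel)) A \<rightarrow>\<^sub>M borel \<and>
         (\<forall>X\<in>B.
            bilinear_form_on (bullet X) X (br X) \<and>
            continuous_on (bullet X \<times> X) (\<lambda>(g, x). br X g x) \<and>
            linear_isometry_onto_dual (bullet X) X (\<lambda>g. \<lambda>x\<in>X. br X g x)))"
proof -
  obtain e :: "nat \<Rightarrow> C_cantor" where e: "closure (range e) = UNIV" using C_cantor_separable by blast
  interpret dense_sequence e by unfold_locales (rule e)
  define M where "M = restrict_space effros_borel B"
  have B_SB: "B \<subseteq> SB" using assms(2) by (auto simp: SD_def)
  have space_M: "space M = B"
    using B_SB by (auto simp: M_def space_restrict_space space_effros_borel)
  interpret dual_separable_family e M
  proof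
    show "closed X" "subspace X" if "X \<in> space M" for X
      using that B_SB by (auto simp: space_M SB_def)
    show "Measurable.pred M (\<lambda>X. X \<inter> U \<noteq> {})" if "open U" for U
      unfolding M_def
    proof (rule measurable_restrict_space1)
      show "Measurable.pred effros_borel (\<lambda>X. X \<inter> U \<noteq> {})"
        unfolding pred_def space_effros_borel using hits_in_effros_borel[OF that] .
    qed
    \<comment> \<open>The only place where \<open>B\<close> itself being Borel enters the analytic
      coding: it pulls back along \<open>closed_span\<close> to a Borel set of sequences.\<close>
    have "{z. closed_span z \<in> B} \<in> sets borel"
      using measurable_sets[OF closed_span_measurable assms(1)] by (simp add: vimage_def)
    then show "\<exists>H :: ((nat \<Rightarrow> real) \<times> (nat \<Rightarrow> C_cantor)) set. closed H \<and> snd ` H = {z. closed_span z \<in> space M}"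
      unfolding space_M by (rule borel_projection_closed)
    show "\<not> (\<exists>c :: (nat \<Rightarrow> bool) \<Rightarrow> nat \<Rightarrow> bool. \<forall>\<alpha> \<beta>. \<alpha> \<noteq> \<beta> \<longrightarrow> far X \<epsilon> (c \<alpha>) (c \<beta>))"
      if "X \<in> space M" and \<epsilon>: "0 < \<epsilon>" for X \<epsilon>
    proof
      assume "\<exists>c :: (nat \<Rightarrow> bool) \<Rightarrow> nat \<Rightarrow> bool. \<forall>\<alpha> \<beta>. \<alpha> \<noteq> \<beta> \<longrightarrow> far X \<epsilon> (c \<alpha>) (c \<beta>)"
      then obtain c :: "(nat \<Rightarrow> bool) \<Rightarrow> nat \<Rightarrow> bool" where c: "\<And>\<alpha> \<beta>. \<alpha> \<noteq> \<beta> \<Longrightarrow> far X \<epsilon> (c \<alpha>) (c \<beta>)" by blast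
      have "X \<in> SD" using that(1) assms(2) space_M by blast
      then have "subspace X" "separable_space (Metric_space.mtopology (dual_space X) (dual_dist X))"
        by (simp_all add: SD_def SB_def)
      from no_separated_cantor_set_in_separable_dual[OF this, of "\<lambda>\<alpha>. dual_ball (c \<alpha>)", OF linear_dual_ball dual_ball_le \<epsilon>]
      obtain \<alpha> \<beta> where "\<alpha> \<noteq> \<beta>" "\<forall>x\<in>X. \<bar>dual_ball (c \<alpha>) x - dual_ball (c \<beta>) x\<bar> \<le> \<epsilon> * norm x"
        by blast
      then show False using c[of \<alpha> \<beta>] unfolding far_def by (meson not_less)
    qed
  qed
  obtain f a where "functional_family e M f a" using ex_functional_family by blast
  then interpret F: functional_family e M f a .
  define A where "A = {(X, x, g). X \<in> B \<and> x \<in> X \<and> g \<in> F.bullet X}"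
  let ?E = "effros_borel \<Otimes>\<^sub>M (borel \<Otimes>\<^sub>M borel) :: (C_cantor set \<times> C_cantor \<times> C_cantor) measure"
  \<comment> \<open>Only the first component has to be confined to \<open>B\<close>: on the product
    over \<open>M\<close> the pairing is Borel for all \<open>x\<close> and
    \<open>g\<close>.\<close>
  have "(\<lambda>w. (fst w, snd w)) \<in> restrict_space ?E A \<rightarrow>\<^sub>M M \<Otimes>\<^sub>M (borel \<Otimes>\<^sub>M borel)"
  proof (rule measurable_Pair)
    show "fst \<in> restrict_space ?E A \<rightarrow>\<^sub>M M"
      unfolding M_def
    proof (rule measurable_restrict_space2)
      show "fst \<in> space (restrict_space ?E A) \<rightarrow> B" by (auto simp: space_restrict_space A_def)
      show "fst \<in> restrict_space ?E A \<rightarrow>\<^sub>M effros_borel" by (intro measurable_restrict_space1 measurable_fst)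
    qed
    show "snd \<in> restrict_space ?E A \<rightarrow>\<^sub>M borel \<Otimes>\<^sub>M borel" by (intro measurable_restrict_space1 measurable_snd)
  qed
  from measurable_compose[OF this F.pairing_measurable]
  have "(\<lambda>(X, x, g). F.pairing X g x) \<in> restrict_space ?E A \<rightarrow>\<^sub>M borel"
    by (simp add: case_prod_beta')
  moreover have "F.bullet \<in> restrict_space effros_borel B \<rightarrow>\<^sub>M effros_borel"
    using F.bullet_measurable by (simp add: M_def)
  moreover have "isometric_to_dual (F.bullet X) X" if "X \<in> B" for X
    using F.isometry_pairing[of X] that unfolding isometric_to_dual_def space_M by blast
  moreover have "bilinear_form_on (F.bullet X) X (F.pairing X)"
    "continuous_on (F.bullet X \<times> X) (\<lambda>(g, x). F.pairing X g x)"
    "linear_isometry_onto_dual (F.bullet X) X (\<lambda>g. \<lambda>x\<in>X. F.pairing X g x)" if "X \<in> B" for X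
    using F.bilinear_pairing[of X] F.continuous_on_pairing[of X] F.isometry_pairing[of X] that
    unfolding space_M by blast+
  ultimately show ?thesis
    unfolding Let_def A_def by (intro exI[of _ F.bullet] conjI ballI exI[of _ F.pairing])
qed

end
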